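(* Let $m\in\mathbb{N}$, $1\le p\le\infty$ and $X=\ell^p(\mathbb{C}^m)$. Let $A_0,A_1$ be complex $m\times m$ matrices with $A_1\neq0$, and suppose there exist $\zeta>0$ and $k\in\mathbb{N}$ such that $\sigma(A_0)=\{-\zeta\}$ and $$A_1R(\lambda,A_0)A_1=\phi_A(\lambda)A_1,\qquad \phi_A(\lambda)=\frac{\zeta^k}{(\lambda+\zeta)^k},\qquad\lambda\in\mathbb{C}\setminus\{-\zeta\}.$$ Let $A\in\mathcal{B}(X)$ be given by $A(x_j)_{j\in\mathbb{Z}}=(A_0x_j+A_1x_{j-1})_{j\in\mathbb{Z}}$ and, for $x_0\in X$, let $x(t)$, $t\ge0$, be the solution of $\dot x(t)=Ax(t)$, $t\ge0$, $x(0)=x_0$. Let $M\in\mathcal{B}(X)$ be given by $M(x_j)=(A_1A_0^{-1}x_j)$, let $L:\operatorname{Ran}(A_1)\to\operatorname{Ran}(A_0^{-1}A_1)$ be the inverse of the isomorphism from $\operatorname{Ran}(A_0^{-1}A_1)$ onto $\operatorname{Ran}(A_1)$ obtained by restricting $A_1A_0^{-1}$, and let $Y=\{x_0\in X:\lim_{t\to\infty}x(t)\text{ exists in the norm of }X\}$. Let $S$ be the right shift on $X$. Then the following hold. (a) Given $x_0\in X$, we have $x_0\in Y$ if and only if there exists $y_0\in\operatorname{Ran}(A_1)$ such that the constant sequence $y$ with entry $y_0$ is an element of $X$ and $$\bigg\|\frac1n\sum_{j=1}^nS^jMx_0-y\bigg\|_X\to0,\qquad n\to\infty.\tag{$*$}$$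 Moreover, if this is the case then $\|x(t)-z\|_X\to0$ as $t\to\infty$, where $z\in X$ is the constant sequence with entry $Ly_0$. In particular, $Y=X$ if and only if $1<p<\infty$, and if $1\le p<\infty$ the only possible candidate for $y$ and $z$ is $0$. (b) If $x_0\in X$ is such that the convergence in $( * )$ holds with rate $O(n^{-1})$ as $n\to\infty$ (for some $y$ as in (a)), then, with $z$ as in (a), $\|x(t)-z\|_X=O(t^{-1/2})$ as $t\to\infty$. (c) For all $x_0\in X$ we have $\|\dot x(t)\|_X=O(t^{-1/2})$ as $t\to\infty$. Furthermore, the rates in (b) and (c) are optimal, in the sense that if in (b) or in (c) the rate $t^{-1/2}$ were replaced by $r(t)$ for some positive function $r$ with $r(t)=o(t^{-1/2})$ as $t\to\infty$, then the corresponding statement would become false.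
   Context: $\ell^p(\mathbb{C}^m)$ denotes the Banach space of doubly infinite sequences $x=(x_j)_{j\in\mathbb{Z}}$ with $x_j\in\mathbb{C}^m$ (Euclidean norm) and norm $\|x\|=(\sum_{j\in\mathbb{Z}}\|x_j\|^p)^{1/p}$ if $1\le p<\infty$, $\|x\|=\sup_{j\in\mathbb{Z}}\|x_j\|$ if $p=\infty$. $\mathcal{B}(X)$ is the space of bounded linear operators on $X$, $\sigma(\cdot)$ denotes the spectrum, $\operatorname{Ran}$ the range, and $R(\lambda,A_0)=(\lambda-A_0)^{-1}$ for $\lambda\notin\sigma(A_0)$. The right shift $S\in\mathcal{B}(X)$ is defined by $S(x_j)=(x_{j-1})$. Since $A$ is bounded, the solution is $x(t)=e^{tA}x_0$. Under the stated assumptions, $A_1A_0^{-1}$ does restrict to an isomorphism from $\operatorname{Ran}(A_0^{-1}A_1)$ onto $\operatorname{Ran}(A_1)$, so $L$ is well defined. *)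

theory Defs
  imports "HOL-Analysis.Analysis" "HOL-Library.Landau_Symbols"
begin

text \<open>
  The exponent is an extended real, so the space cannot be a type; it is a carrier set of functions
  together with a norm. The value of the norm is only meaningful on the carrier
  (\<^const>\<open>infsum\<close> is 0 where the sum diverges), hence membership is always stated explicitly.
  The norm on \<^typ>\<open>complex^'m\<close> is the Euclidean one.
\<close>

definition lp_space :: "ennreal \<Rightarrow> (int \<Rightarrow> complex^'m) set" where
  "lp_space p = {x. if p = \<infinity> then bounded (range x)
                    else (\<lambda>j. norm (x j) powr enn2real p) summable_on UNIV}"

definition lp_norm :: "ennreal \<Rightarrow> (int \<Rightarrow> complex^'m) \<Rightarrow> real" where
  "lp_norm p x = (if p = \<infinity> then (SUP j. norm (x j))
                  else (\<Sum>\<^sub>\<infinity>j. norm (x j) powr enn2real p) powr (1 / enn2real p))"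

definition lp_dist :: "ennreal \<Rightarrow> (int \<Rightarrow> complex^'m) \<Rightarrow> (int \<Rightarrow> complex^'m) \<Rightarrow> real" where
  "lp_dist p x y = lp_norm p (\<lambda>j. x j - y j)"

definition const_seq :: "complex^'m \<Rightarrow> int \<Rightarrow> complex^'m" where
  "const_seq v = (\<lambda>j. v)"

definition matrix_spectrum :: "complex^'m^'m \<Rightarrow> complex set" where
  "matrix_spectrum B = {l. \<not> invertible (mat l - B)}"

text \<open>\<^term>\<open>mat l\<close> is the scalar matrix with diagonal entry \<^term>\<open>l\<close>.\<close>

definition matrix_resolvent :: "complex \<Rightarrow> complex^'m^'m \<Rightarrow> complex^'m^'m" where
  "matrix_resolvent l B = matrix_inv (mat l - B)"

definition matrix_range :: "complex^'m^'m \<Rightarrow> (complex^'m) set" where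
  "matrix_range B = range (\<lambda>v. B *v v)"

definition sys_op :: "complex^'m^'m \<Rightarrow> complex^'m^'m \<Rightarrow> (int \<Rightarrow> complex^'m) \<Rightarrow> int \<Rightarrow> complex^'m" where
  "sys_op A0 A1 x = (\<lambda>j. A0 *v x j + A1 *v x (j - 1))"

definition right_shift :: "(int \<Rightarrow> complex^'m) \<Rightarrow> int \<Rightarrow> complex^'m" where
  "right_shift x = (\<lambda>j. x (j - 1))"

definition M_op :: "complex^'m^'m \<Rightarrow> complex^'m^'m \<Rightarrow> (int \<Rightarrow> complex^'m) \<Rightarrow> int \<Rightarrow> complex^'m" where
  "M_op A0 A1 x = (\<lambda>j. (A1 ** matrix_inv A0) *v x j)"

definition L_map :: "complex^'m^'m \<Rightarrow> complex^'m^'m \<Rightarrow> complex^'m \<Rightarrow> complex^'m" where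
  "L_map A0 A1 = inv_into (matrix_range (matrix_inv A0 ** A1)) (\<lambda>v. (A1 ** matrix_inv A0) *v v)"

definition shift_mean :: "nat \<Rightarrow> (int \<Rightarrow> complex^'m) \<Rightarrow> int \<Rightarrow> complex^'m" where
  "shift_mean n x = (\<lambda>i. (1 / real n) *\<^sub>R (\<Sum>j=1..n. (right_shift ^^ j) x i))"

text \<open>Derivative in the norm of the sequence space (one-sided at 0), for curves on the
  nonnegative half-line; \<^term>\<open>v\<close> is the derivative of \<^term>\<open>u\<close> at \<^term>\<open>t\<close>.\<close>

definition has_lp_derivative ::
  "ennreal \<Rightarrow> (real \<Rightarrow> int \<Rightarrow> complex^'m) \<Rightarrow> (int \<Rightarrow> complex^'m) \<Rightarrow> real \<Rightarrow> bool" where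
  "has_lp_derivative p u v t \<longleftrightarrow>
     (\<forall>s\<ge>0. u s \<in> lp_space p) \<and> v \<in> lp_space p \<and>
     ((\<lambda>s. lp_dist p (\<lambda>j. (1 / (s - t)) *\<^sub>R (u s j - u t j)) v) \<longlongrightarrow> 0) (at t within {0..})"

text \<open>\<^term>\<open>u\<close> solves the Cauchy problem with initial value \<^term>\<open>x0\<close>, and \<^term>\<open>u'\<close> is its
  derivative. Values at negative times are irrelevant.\<close>

definition solves_system ::
  "ennreal \<Rightarrow> complex^'m^'m \<Rightarrow> complex^'m^'m \<Rightarrow> (int \<Rightarrow> complex^'m) \<Rightarrow>
   (real \<Rightarrow> int \<Rightarrow> complex^'m) \<Rightarrow> (real \<Rightarrow> int \<Rightarrow> complex^'m) \<Rightarrow> bool" where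
  "solves_system p A0 A1 x0 u u' \<longleftrightarrow>
     u 0 = x0 \<and> (\<forall>t\<ge>0. has_lp_derivative p u (u' t) t \<and> u' t = sys_op A0 A1 (u t))"

definition mean_converges ::
  "ennreal \<Rightarrow> complex^'m^'m \<Rightarrow> complex^'m^'m \<Rightarrow> (int \<Rightarrow> complex^'m) \<Rightarrow> complex^'m \<Rightarrow> bool" where
  "mean_converges p A0 A1 x0 y0 \<longleftrightarrow>
     y0 \<in> matrix_range A1 \<and> const_seq y0 \<in> lp_space p \<and>
     (\<lambda>n. lp_dist p (shift_mean n (M_op A0 A1 x0)) (const_seq y0)) \<longlonglongrightarrow> 0"

definition mean_converges_fast ::
  "ennreal \<Rightarrow> complex^'m^'m \<Rightarrow> complex^'m^'m \<Rightarrow> (int \<Rightarrow> complex^'m) \<Rightarrow> complex^'m \<Rightarrow> bool" where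
  "mean_converges_fast p A0 A1 x0 y0 \<longleftrightarrow>
     mean_converges p A0 A1 x0 y0 \<and>
     (\<lambda>n. lp_dist p (shift_mean n (M_op A0 A1 x0)) (const_seq y0)) \<in> O(\<lambda>n. 1 / real n)"

end

theory Submission
  imports Defs "HOL-Computational_Algebra.Fundamental_Theorem_Algebra"
begin

text \<open>
  With \<open>N = A\<^sub>0 + \<zeta>\<close>, which is nilpotent, the resolvent identity says that \<open>A\<^sub>1 N\<^sup>i A\<^sub>1\<close> vanishes
  for all \<open>i\<close> except \<open>k - 1\<close>, where it is \<open>\<zeta>\<^sup>k A\<^sub>1\<close>. Expanding the powers of
  \<open>\<zeta> + A = N + A\<^sub>1 S\<close> therefore expresses \<open>exp (t A)\<close> by finitely many matrices and by the operators
  \<open>G\<^sub>c = \<Sum>\<^sub>l q (c + k l) S\<^sup>l\<close>, where \<open>q\<close> denotes the Poisson weights with parameter \<open>\<zeta> t\<close>.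
  Since \<open>\<Sum>\<^sub>n \<bar>q n - q (n - 1)\<bar>\<close> is at most the square root of the relative variance,
  all the \<open>G\<^sub>c\<close> agree up to \<open>O (t\<^sup>-\<^sup>1\<^sup>/\<^sup>2)\<close>, they almost annihilate the range of \<open>I - S\<close>, and
  \<open>exp (t A)\<close> equals \<open>\<zeta> A\<^sub>0\<^sup>-\<^sup>1 S G\<^sub>0 M\<close> up to \<open>O (t\<^sup>-\<^sup>1\<^sup>/\<^sup>2)\<close>. Comparing \<open>k G\<^sub>0\<close> with the
  means of the powers of \<open>S\<close> gives (a), summation by parts gives (b), and \<open>A\<^sub>1 A\<^sub>0\<^sup>-\<^sup>1 A\<^sub>1 = - A\<^sub>1\<close>
  gives (c). For the optimality, nonnegativity of the increments of \<open>q\<close> below its mode excludes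
  cancellation when \<open>x\<^sub>0\<close> is the image under \<open>I - S\<close> of a nonnegative profile with infinitely many
  scales.
\<close>

section \<open>Bounds in the sequence spaces\<close>

text \<open>Since p is a variable, X is a set of functions and not a type. All estimates are phrased
  by \<open>lp_le p x C\<close>, which packs membership and the norm bound into inequalities over
  finite sets of coordinates and treats p = \<infinity> alike; C is nonnegative so that C^q is
  monotone in C. Such bounds pass to coordinatewise limits, so a solution has to be known only
  through the Taylor series of its coordinates. Poisson weights appear because exp (t A) = exp
  (-\<zeta> t) exp (t (\<zeta> + A)). In the words that survive in the powers of \<zeta> + A,
  consecutive factors A_1 are separated by exactly k - 1 factors N, so only every k-th weight is
  seen. Such a class has mass close to 1/k, and this is the origin of L = (\<zeta> / k) A_0^(-1) on
  the range of A_1. Complex numbers matter only for extracting coefficients from the resolvent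
  identity; afterwards the maps are real-linear. The two optimality claims share one construction:
  the derivative of a solution is again a solution, and its initial value can be made the critical
  one.\<close>

definition lp_le :: "ennreal \<Rightarrow> (int \<Rightarrow> 'a::real_normed_vector) \<Rightarrow> real \<Rightarrow> bool" where
  "lp_le p x C \<longleftrightarrow> 0 \<le> C \<and>
     (if p = \<infinity> then \<forall>j. norm (x j) \<le> C
      else \<forall>F. finite F \<longrightarrow> (\<Sum>j\<in>F. norm (x j) powr enn2real p) \<le> C powr enn2real p)"

lemma enn2real_ge_1: "1 \<le> p \<Longrightarrow> p \<noteq> \<infinity> \<Longrightarrow> 1 \<le> enn2real p"
  by (cases p) auto

lemma powr_le_powr_iff:
  fixes a b q :: real
  assumes "0 \<le> a" "0 \<le> b" "0 < q"
  shows "a powr q \<le> b powr q \<longleftrightarrow> a \<le> b"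
  using assms by (meson linorder_not_le powr_less_mono2 powr_mono2 less_imp_le)

lemma lp_norm_nonneg: "0 \<le> lp_norm p x" if "x \<in> lp_space p"
proof (cases "p = \<infinity>")
  case True
  with that have "bdd_above (range (\<lambda>j. norm (x j)))"
    by (auto simp: lp_space_def bounded_iff bdd_above_def)
  then have "norm (x 0) \<le> (SUP j. norm (x j))" by (rule cSUP_upper2) auto
  then have "0 \<le> (SUP j. norm (x j))" using norm_ge_zero order_trans by blast
  then show ?thesis using True by (simp add: lp_norm_def)
qed (simp add: lp_norm_def)

text \<open>A family of nonnegative terms is summable exactly if its finite sums are bounded, and
  the sum inherits the bound; taking q-th roots passes between C^q and C.\<close>

lemma lp_le_iff:
  assumes "1 \<le> p"
  shows "lp_le p x C \<longleftrightarrow> x \<in> lp_space p \<and> lp_norm p x \<le> C"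
proof (cases "p = \<infinity>")
  case True
  show ?thesis
  proof
    assume "lp_le p x C"
    then have "\<forall>j. norm (x j) \<le> C" using True by (simp add: lp_le_def)
    then show "x \<in> lp_space p \<and> lp_norm p x \<le> C" using True
      by (auto simp: lp_space_def lp_norm_def bounded_iff intro!: cSUP_least)
  next
    assume a: "x \<in> lp_space p \<and> lp_norm p x \<le> C"
    then have "bdd_above (range (\<lambda>j. norm (x j)))"
      using True by (auto simp: lp_space_def bounded_iff bdd_above_def)
    then have "norm (x j) \<le> C" for j
      using a True cSUP_upper[of j UNIV "\<lambda>j. norm (x j)"] by (auto simp: lp_norm_def)
    moreover have "0 \<le> C" using a lp_norm_nonneg[of x p] by linarith
    ultimately show "lp_le p x C" using True by (simp add: lp_le_def)
  qed
next
  case False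
  define q where "q = enn2real p"
  have q: "1 \<le> q" using assms False enn2real_ge_1 q_def by blast
  let ?f = "\<lambda>j. norm (x j) powr q"
  show ?thesis
  proof
    assume a: "lp_le p x C"
    then have C: "0 \<le> C" and le: "\<And>F. finite F \<Longrightarrow> sum ?f F \<le> C powr q"
      using False by (auto simp: lp_le_def q_def)
    have s: "?f summable_on UNIV"
      by (rule nonneg_bdd_above_summable_on) (auto intro!: bdd_aboveI le)
    have "infsum ?f UNIV \<le> C powr q"
      by (rule infsum_le_finite_sums[OF s]) (use le in auto)
    then have "infsum ?f UNIV powr (1/q) \<le> (C powr q) powr (1/q)"
      by (intro powr_mono2 infsum_nonneg) (use q in auto)
    also have "\<dots> = C" using C q by (simp add: powr_powr)
    finally show "x \<in> lp_space p \<and> lp_norm p x \<le> C"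
      using s False by (auto simp: lp_space_def lp_norm_def q_def)
  next
    assume a: "x \<in> lp_space p \<and> lp_norm p x \<le> C"
    then have s: "?f summable_on UNIV" and n: "infsum ?f UNIV powr (1/q) \<le> C"
      using False by (auto simp: lp_space_def lp_norm_def q_def)
    have C: "0 \<le> C" using n powr_ge_zero order_trans by blast
    have nn: "0 \<le> infsum ?f UNIV" by (simp add: infsum_nonneg)
    have "(infsum ?f UNIV powr (1/q)) powr q \<le> C powr q"
      by (intro powr_mono2 n) (use q in auto)
    then have "infsum ?f UNIV \<le> C powr q" using nn q by (simp add: powr_powr)
    then have "sum ?f F \<le> C powr q" if "finite F" for F
      using finite_sum_le_infsum[OF s that] by force
    then show "lp_le p x C" using C False by (auto simp: lp_le_def q_def)
  qed
qed

lemma lp_le_lp_norm: "1 \<le> p \<Longrightarrow> x \<in> lp_space p \<Longrightarrow> lp_le p x (lp_norm p x)"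
  by (simp add: lp_le_iff)

lemma lp_le_nonneg: "lp_le p x C \<Longrightarrow> 0 \<le> C"
  by (simp add: lp_le_def)

lemma lp_le_mono: "lp_le p x C \<Longrightarrow> C \<le> D \<Longrightarrow> lp_le p x D"
  unfolding lp_le_def
  by (smt (verit, ccfv_threshold) powr_mono2 enn2real_nonneg)

lemma lp_le_coord:
  assumes "1 \<le> p" "lp_le p x C" shows "norm (x j) \<le> C"
proof (cases "p = \<infinity>")
  case False
  have "(\<Sum>j\<in>{j}. norm (x j) powr enn2real p) \<le> C powr enn2real p"
    using assms False unfolding lp_le_def by (metis finite.emptyI finite.insertI)
  then show ?thesis
    using powr_le_powr_iff[of "norm (x j)" C "enn2real p"] enn2real_ge_1[OF assms(1) False]
      lp_le_nonneg[OF assms(2)] by auto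
qed (use assms in \<open>simp add: lp_le_def\<close>)

lemma lp_le_map:
  assumes "1 \<le> p" "lp_le p x C" "0 \<le> K" "\<And>j. norm (y j) \<le> K * norm (x j)"
  shows "lp_le p y (K * C)"
proof (cases "p = \<infinity>")
  case True
  then show ?thesis using assms unfolding lp_le_def
    by (auto intro: order_trans[OF assms(4)] mult_left_mono)
next
  case False
  let ?q = "enn2real p"
  have C: "0 \<le> C" using assms(2) by (simp add: lp_le_def)
  have "(\<Sum>j\<in>F. norm (y j) powr ?q) \<le> (K * C) powr ?q" if "finite F" for F
  proof -
    have "(\<Sum>j\<in>F. norm (y j) powr ?q) \<le> (\<Sum>j\<in>F. K powr ?q * norm (x j) powr ?q)"
      using assms(3,4) by (intro sum_mono) (metis powr_mono2 powr_mult norm_ge_zero enn2real_nonneg)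
    also have "\<dots> = K powr ?q * (\<Sum>j\<in>F. norm (x j) powr ?q)" by (simp add: sum_distrib_left)
    also have "\<dots> \<le> K powr ?q * C powr ?q"
      using assms(2) that False by (intro mult_left_mono) (auto simp: lp_le_def)
    finally show ?thesis using assms(3) C by (simp add: powr_mult)
  qed
  then show ?thesis using False assms C by (simp add: lp_le_def)
qed

lemma lp_le_scaleR:
  assumes "1 \<le> p" "lp_le p x C" shows "lp_le p (\<lambda>j. a *\<^sub>R x j) (\<bar>a\<bar> * C)"
  by (rule lp_le_map[OF assms]) auto

lemma lp_le_bounded_linear:
  assumes "1 \<le> p" "lp_le p x C" "bounded_linear f"
  shows "lp_le p (\<lambda>j. f (x j)) (onorm f * C)"
  by (rule lp_le_map[OF assms(1,2)]) (auto simp: onorm_pos_le onorm assms(3))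

lemma lp_le_zero: "1 \<le> p \<Longrightarrow> 0 \<le> C \<Longrightarrow> lp_le p (\<lambda>j. 0) C"
  by (auto simp: lp_le_def)

lemma lp_le_shift:
  assumes "lp_le p x C" shows "lp_le p (\<lambda>j. x (j - l)) C"
proof (cases "p = \<infinity>")
  case False
  let ?q = "enn2real p"
  have "(\<Sum>j\<in>F. norm (x (j - l)) powr ?q) \<le> C powr ?q" if "finite F" for F
  proof -
    have "(\<Sum>j\<in>F. norm (x (j - l)) powr ?q) = (\<Sum>j\<in>(\<lambda>j. j - l) ` F. norm (x j) powr ?q)"
      by (simp add: sum.reindex inj_on_def)
    also have "\<dots> \<le> C powr ?q" using assms that False by (auto simp: lp_le_def)
    finally show ?thesis .
  qed
  then show ?thesis using False assms by (simp add: lp_le_def)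
qed (use assms in \<open>auto simp: lp_le_def\<close>)

text \<open>Coordinates may vanish, so convexity is needed up to the endpoint 0. There it says t^q
  y^q <= t y^q, which is t^q <= t on (0,1).\<close>

lemma powr_convex_on_nonneg: "1 \<le> q \<Longrightarrow> convex_on {0..} (\<lambda>x::real. x powr q)"
proof (rule convex_on_linorderI)
  fix t x y :: real
  assume q: "1 \<le> q" and t: "0 < t" "t < 1" and xy: "x \<in> {0..}" "y \<in> {0..}" "x < y"
  show "((1 - t) *\<^sub>R x + t *\<^sub>R y) powr q \<le> (1 - t) * x powr q + t * y powr q"
  proof (cases "x = 0")
    case True
    have "t powr q \<le> t powr 1" using t q by (intro powr_mono') auto
    then show ?thesis using True t xy q by (simp add: powr_mult mult_right_mono)
  next
    case False
    then show ?thesis using convex_onD[OF powr_convex[OF q], of t x y] t xy by auto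
  qed
qed (auto simp: convex_real_interval)

text \<open>Minkowski's inequality without duality: (x + y) / (C + D) is bounded by the convex
  combination of x / C and y / D with weights C / (C + D) and D / (C + D), and the q-th power is
  convex. If C or D is 0, the corresponding sequence vanishes.\<close>

lemma lp_le_add:
  assumes p: "1 \<le> p" and x: "lp_le p x C" and y: "lp_le p y D"
  shows "lp_le p (\<lambda>j. x j + y j) (C + D)"
proof (cases "p = \<infinity>")
  case True
  then show ?thesis using x y by (auto simp: lp_le_def intro: norm_triangle_le add_mono)
next
  case False
  define q where "q = enn2real p"
  have q: "1 \<le> q" using p False enn2real_ge_1 q_def by blast
  have CD: "0 \<le> C" "0 \<le> D" using x y by (auto simp: lp_le_def)
  consider "C = 0" | "D = 0" | "C > 0" "D > 0" using CD by linarith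
  then show ?thesis
  proof cases
    case 1
    then have "\<And>j. x j = 0" using lp_le_coord[OF p x] by auto
    then show ?thesis using y 1 by simp
  next
    case 2
    then have "\<And>j. y j = 0" using lp_le_coord[OF p y] by auto
    then show ?thesis using x 2 by simp
  next
    case 3
    have "(\<Sum>j\<in>F. norm (x j + y j) powr q) \<le> (C + D) powr q" if F: "finite F" for F
    proof -
      define s where "s = D / (C + D)"
      have s: "0 \<le> s" "s \<le> 1" "1 - s = C / (C + D)" using 3 by (auto simp: s_def field_simps)
      have 1: "norm (x j + y j) powr q \<le> (C + D) powr q *
          ((1 - s) * (norm (x j) powr q / C powr q) + s * (norm (y j) powr q / D powr q))" for j
      proof -
        have "norm (x j + y j) \<le> (C + D) * ((1 - s) * (norm (x j) / C) + s * (norm (y j) / D))"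
          unfolding s(3) using 3 norm_triangle_ineq[of "x j" "y j"]
          by (simp add: s_def distrib_left)
        then have "norm (x j + y j) powr q \<le>
            ((C + D) * ((1 - s) * (norm (x j) / C) + s * (norm (y j) / D))) powr q"
          using q by (intro powr_mono2) auto
        also have "\<dots> = (C + D) powr q * ((1 - s) * (norm (x j) / C) + s * (norm (y j) / D)) powr q"
          using 3 s by (intro powr_mult)
        also have "\<dots> \<le> (C + D) powr q *
            ((1 - s) * (norm (x j) / C) powr q + s * (norm (y j) / D) powr q)"
          using convex_onD[OF powr_convex_on_nonneg[OF q], of s "norm (x j) / C" "norm (y j) / D"] s 3
          by (intro mult_left_mono) auto
        finally show ?thesis using 3 by (simp add: powr_divide)
      qed
      have "(\<Sum>j\<in>F. norm (x j + y j) powr q) \<le> (\<Sum>j\<in>F. (C + D) powr q *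
          ((1 - s) * (norm (x j) powr q / C powr q) + s * (norm (y j) powr q / D powr q)))"
        by (rule sum_mono) (rule 1)
      also have "\<dots> = (C + D) powr q * ((1 - s) * ((\<Sum>j\<in>F. norm (x j) powr q) / C powr q)
          + s * ((\<Sum>j\<in>F. norm (y j) powr q) / D powr q))"
        by (simp only: sum_distrib_left[symmetric] sum.distrib sum_divide_distrib[symmetric])
      also have "\<dots> \<le> (C + D) powr q * ((1 - s) * 1 + s * 1)"
        using x y False F 3 s by (intro mult_left_mono add_mono) (auto simp: lp_le_def q_def)
      finally show ?thesis by simp
    qed
    then show ?thesis using False CD by (auto simp: lp_le_def q_def)
  qed
qed

lemma lp_le_diff:
  assumes "1 \<le> p" "lp_le p x C" "lp_le p y D"
  shows "lp_le p (\<lambda>j. x j - y j) (C + D)"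
proof -
  have "lp_le p (\<lambda>j. - y j) (1 * D)" by (rule lp_le_map[OF assms(1,3)]) auto
  from lp_le_add[OF assms(1,2) this] show ?thesis by simp
qed

lemma lp_le_sum:
  assumes "1 \<le> p" "finite I" "\<And>i. i \<in> I \<Longrightarrow> lp_le p (x i) (C i)"
  shows "lp_le p (\<lambda>j. \<Sum>i\<in>I. x i j) (\<Sum>i\<in>I. C i)"
  using assms(2,3)
  by (induction I rule: finite_induct) (auto simp: lp_le_zero[OF assms(1)] intro!: lp_le_add[OF assms(1)])

text \<open>A finite sum involves finitely many coordinates and is continuous in them, so a common
  bound survives (Fatou).\<close>

lemma lp_le_limit:
  assumes p: "1 \<le> p" and x: "\<And>n. lp_le p (x n) C" and lim: "\<And>j. (\<lambda>n. x n j) \<longlonglongrightarrow> y j"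
  shows "lp_le p y C"
proof (cases "p = \<infinity>")
  case True
  then have "norm (y j) \<le> C" for j
    using x by (intro Lim_bounded[OF tendsto_norm[OF lim[of j]]]) (auto simp: lp_le_def)
  then show ?thesis using True x[of 0] by (simp add: lp_le_def)
next
  case False
  let ?q = "enn2real p"
  have "(\<Sum>j\<in>F. norm (y j) powr ?q) \<le> C powr ?q" if "finite F" for F
  proof (rule Lim_bounded)
    show "(\<lambda>n. \<Sum>j\<in>F. norm (x n j) powr ?q) \<longlonglongrightarrow> (\<Sum>j\<in>F. norm (y j) powr ?q)"
      using enn2real_ge_1[OF p False]
      by (intro tendsto_sum tendsto_powr' tendsto_norm lim tendsto_const) auto
    show "\<forall>n\<ge>0. (\<Sum>j\<in>F. norm (x n j) powr ?q) \<le> C powr ?q"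
      using x False that by (simp add: lp_le_def)
  qed
  then show ?thesis using False x[of 0] by (simp add: lp_le_def)
qed

lemma summable_scaleR_bounded:
  fixes x :: "nat \<Rightarrow> 'a::banach"
  assumes "summable (\<lambda>l. \<bar>\<kappa> l\<bar>)" "\<And>l. norm (x l) \<le> C"
  shows "summable (\<lambda>l. \<kappa> l *\<^sub>R x l)"
proof (rule summable_comparison_test')
  show "summable (\<lambda>l. \<bar>\<kappa> l\<bar> * C)" using assms(1) by (rule summable_mult2)
  show "norm (\<kappa> l *\<^sub>R x l) \<le> \<bar>\<kappa> l\<bar> * C" for l
    using assms(2)[of l] by (simp add: mult_left_mono)
qed

text \<open>Minkowski for the partial sums, then a coordinatewise limit. With the shifts of one
  sequence as \<open>x l\<close> this is Young's inequality: the l^1 norm of the kernel bounds the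
  convolution.\<close>

lemma lp_le_suminf:
  fixes x :: "nat \<Rightarrow> int \<Rightarrow> 'a::banach"
  assumes p: "1 \<le> p" and x: "\<And>l. lp_le p (x l) C" and s: "summable (\<lambda>l. \<bar>\<kappa> l\<bar>)"
    and K: "(\<Sum>l. \<bar>\<kappa> l\<bar>) \<le> K"
  shows "lp_le p (\<lambda>j. \<Sum>l. \<kappa> l *\<^sub>R x l j) (K * C)"
proof (rule lp_le_limit[OF p])
  fix n
  have "lp_le p (\<lambda>j. \<Sum>l<n. \<kappa> l *\<^sub>R x l j) (\<Sum>l<n. \<bar>\<kappa> l\<bar> * C)"
    by (intro lp_le_sum lp_le_scaleR p x) auto
  moreover have "(\<Sum>l<n. \<bar>\<kappa> l\<bar> * C) \<le> K * C"
    unfolding sum_distrib_right[symmetric] using K sum_le_suminf[OF s, of "{..<n}"] lp_le_nonneg[OF x]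
    by (intro mult_right_mono) force+
  ultimately show "lp_le p (\<lambda>j. \<Sum>l<n. \<kappa> l *\<^sub>R x l j) (K * C)" by (rule lp_le_mono)
  show "(\<lambda>n. \<Sum>l<n. \<kappa> l *\<^sub>R x l j) \<longlonglongrightarrow> (\<Sum>l. \<kappa> l *\<^sub>R x l j)" for j
    by (intro summable_LIMSEQ summable_scaleR_bounded[OF s, of _ C] lp_le_coord[OF p x])
qed

section \<open>Poisson weights\<close>

definition pois :: "real \<Rightarrow> nat \<Rightarrow> real" where
  "pois \<tau> n = exp (- \<tau>) * \<tau> ^ n / fact n"

text \<open>The increment q n - q (n - 1) with q (-1) = 0, because q (n - 1) = (n / \<tau>) q n. The
  product form shows the sign: the weights increase up to \<tau> and decrease afterwards.\<close>

definition pois_diff :: "real \<Rightarrow> nat \<Rightarrow> real" where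
  "pois_diff \<tau> n = pois \<tau> n * (1 - real n / \<tau>)"

lemma pois_nonneg: "0 \<le> \<tau> \<Longrightarrow> 0 \<le> pois \<tau> n"
  by (simp add: pois_def)

lemma pois_Suc: "real (Suc n) * pois \<tau> (Suc n) = \<tau> * pois \<tau> n"
  by (simp add: pois_def del: of_nat_Suc)

lemma pois_diff_Suc: "0 < \<tau> \<Longrightarrow> pois_diff \<tau> (Suc n) = pois \<tau> (Suc n) - pois \<tau> n"
  using pois_Suc[of n \<tau>] by (simp add: pois_diff_def field_simps)

lemma pois_sums: "pois \<tau> sums 1"
proof -
  have "(\<lambda>n. exp (- \<tau>) * (\<tau> ^ n /\<^sub>R fact n)) sums (exp (- \<tau>) * exp \<tau>)"
    by (rule sums_mult[OF exp_converges])
  then show ?thesis by (simp add: pois_def[abs_def] exp_minus field_simps)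
qed

lemma pois_le_1: "0 \<le> \<tau> \<Longrightarrow> pois \<tau> n \<le> 1"
  using sum_le_suminf[of "pois \<tau>" "{n}"] pois_sums[of \<tau>] pois_nonneg[of \<tau>]
  by (auto simp: sums_iff)

lemma pois_mean_sums: "(\<lambda>n. real n * pois \<tau> n) sums \<tau>"
proof -
  have "(\<lambda>n. real (Suc n) * pois \<tau> (Suc n)) sums (\<tau> * 1)"
    unfolding pois_Suc by (rule sums_mult[OF pois_sums])
  from sums_Suc[OF this] show ?thesis by simp
qed

lemma pois_variance_sums: "(\<lambda>n. (real n - \<tau>)\<^sup>2 * pois \<tau> n) sums \<tau>"
proof -
  have "real (Suc n) * (real (Suc n) - 1) * pois \<tau> (Suc n) = \<tau> * (real n * pois \<tau> n)" for n
    using arg_cong[OF pois_Suc[of n \<tau>], of "\<lambda>x. real n * x"] by (simp add: algebra_simps)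
  then have "(\<lambda>n. real (Suc n) * (real (Suc n) - 1) * pois \<tau> (Suc n)) sums (\<tau> * \<tau>)"
    by (simp only:) (rule sums_mult[OF pois_mean_sums])
  from sums_Suc[OF this] have "(\<lambda>n. real n * (real n - 1) * pois \<tau> n) sums (\<tau> * \<tau>)" by simp
  from sums_add[OF sums_add[OF this sums_mult[OF pois_mean_sums[of \<tau>], of "1 - 2 * \<tau>"]]
      sums_mult[OF pois_sums[of \<tau>], of "\<tau>\<^sup>2"]]
  show ?thesis by (simp add: algebra_simps power2_eq_square)
qed

text \<open>Cauchy-Schwarz in pointwise form: 2 |n - \<tau>| sqrt \<tau> <= (n - \<tau>)^2 + \<tau>.
  Summed against q, the variance and the mass contribute 1 / (2 sqrt \<tau>) each.\<close>

lemma pois_diff_abs_summable: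
  assumes "0 < \<tau>"
  shows "summable (\<lambda>n. \<bar>pois_diff \<tau> n\<bar>)" "(\<Sum>n. \<bar>pois_diff \<tau> n\<bar>) \<le> 1 / sqrt \<tau>"
proof -
  have le: "\<bar>pois_diff \<tau> n\<bar> \<le>
      (1 / (2 * \<tau> * sqrt \<tau>)) * ((real n - \<tau>)\<^sup>2 * pois \<tau> n) + (1 / (2 * sqrt \<tau>)) * pois \<tau> n" for n
  proof -
    define s where "s = sqrt \<tau>"
    have s: "0 < s" "\<tau> = s\<^sup>2" using assms by (auto simp: s_def)
    have "2 * (\<bar>real n - s\<^sup>2\<bar> * s) \<le> \<bar>real n - s\<^sup>2\<bar>\<^sup>2 + s\<^sup>2"
      using zero_le_power2[of "\<bar>real n - s\<^sup>2\<bar> - s"] by (simp add: power2_diff)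
    then have "\<bar>1 - real n / s\<^sup>2\<bar> \<le> (1 / (2 * s\<^sup>2 * s)) * (real n - s\<^sup>2)\<^sup>2 + 1 / (2 * s)"
    proof -
      have "\<bar>1 - real n / s\<^sup>2\<bar> = \<bar>real n - s\<^sup>2\<bar> / s\<^sup>2"
        using s by (simp add: field_simps abs_if)
      also have "\<dots> \<le> (1 / (2 * s\<^sup>2 * s)) * (real n - s\<^sup>2)\<^sup>2 + 1 / (2 * s)"
        using s \<open>2 * (\<bar>real n - s\<^sup>2\<bar> * s) \<le> _\<close> by (simp add: divide_simps power2_eq_square)
      finally show ?thesis .
    qed
    from mult_right_mono[OF this pois_nonneg[of \<tau> n]]
    have "\<bar>1 - real n / \<tau>\<bar> * pois \<tau> n \<le>
        ((1 / (2 * \<tau> * s)) * (real n - \<tau>)\<^sup>2 + 1 / (2 * s)) * pois \<tau> n"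
      using assms by (simp add: s(2))
    moreover have "\<bar>pois_diff \<tau> n\<bar> = \<bar>1 - real n / \<tau>\<bar> * pois \<tau> n"
      using pois_nonneg[of \<tau> n] assms by (simp add: pois_diff_def abs_mult)
    ultimately show ?thesis unfolding s_def[symmetric] by (simp add: distrib_right)
  qed
  have S: "(\<lambda>n. (1 / (2 * \<tau> * sqrt \<tau>)) * ((real n - \<tau>)\<^sup>2 * pois \<tau> n)
      + (1 / (2 * sqrt \<tau>)) * pois \<tau> n) sums (1 / sqrt \<tau>)"
    using sums_add[OF sums_mult[OF pois_variance_sums] sums_mult[OF pois_sums],
        of "1 / (2 * \<tau> * sqrt \<tau>)" \<tau> "1 / (2 * sqrt \<tau>)" \<tau>] assms
    by simp
  show 1: "summable (\<lambda>n. \<bar>pois_diff \<tau> n\<bar>)"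
    by (rule summable_comparison_test'[OF sums_summable[OF S]]) (use le in auto)
  show "(\<Sum>n. \<bar>pois_diff \<tau> n\<bar>) \<le> 1 / sqrt \<tau>"
    by (rule sums_le[OF le summable_sums[OF 1] S])
qed

text \<open>For a fixed index the weight is even O(1/\<tau>), as \<tau> q n = (n + 1) q (n + 1) <= n
  + 1; it is weakened to the common rate. It controls the finitely many terms with a pure power of
  N.\<close>

lemma pois_le_inverse_sqrt:
  assumes "1 \<le> \<tau>" shows "pois \<tau> n \<le> real (Suc n) / sqrt \<tau>"
proof -
  have "\<tau> * pois \<tau> n \<le> real (Suc n)"
    using pois_le_1[of \<tau> "Suc n"] assms unfolding pois_Suc[symmetric]
    by (simp add: mult_left_le)
  then have "pois \<tau> n \<le> real (Suc n) / \<tau>" using assms by (simp add: field_simps)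
  also have "\<dots> \<le> real (Suc n) / sqrt \<tau>"
    using assms by (intro divide_left_mono) (auto simp: real_le_lsqrt power2_eq_square)
  finally show ?thesis .
qed

section \<open>Weights sampled along a residue class modulo k\<close>

lemma pois_diff_telescope:
  assumes "0 < \<tau>" shows "pois \<tau> (m + c) - pois \<tau> m = (\<Sum>i<c. pois_diff \<tau> (Suc (m + i)))"
  by (induction c) (auto simp: pois_diff_Suc[OF assms])

lemma pois_diff_sampled:
  assumes "0 < \<tau>" "0 < k"
  shows "summable (\<lambda>l. \<bar>pois_diff \<tau> (c + k * l)\<bar>)"
    and "(\<Sum>l. \<bar>pois_diff \<tau> (c + k * l)\<bar>) \<le> 1 / sqrt \<tau>"
proof -
  have inj: "inj (\<lambda>l. c + k * l)" using assms(2) by (auto simp: inj_def)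
  note t = pois_diff_abs_summable[OF assms(1)]
  show "summable (\<lambda>l. \<bar>pois_diff \<tau> (c + k * l)\<bar>)"
    using summable_reindex[OF t(1) inj] by (simp add: o_def)
  show "(\<Sum>l. \<bar>pois_diff \<tau> (c + k * l)\<bar>) \<le> 1 / sqrt \<tau>"
    using suminf_reindex_mono[OF t(1) inj] t(2) by (simp add: o_def)
qed

text \<open>Moving the sample by b adds b unit increments, and each of them, summed along an
  arithmetic progression, is at most the variation of the full sequence. The case b = k bounds the
  variation of one sampled sequence.\<close>

lemma pois_shift_sampled:
  assumes "0 < \<tau>" "0 < k"
  shows "summable (\<lambda>l. \<bar>pois \<tau> (c + b + k * l) - pois \<tau> (c + k * l)\<bar>)"
    and "(\<Sum>l. \<bar>pois \<tau> (c + b + k * l) - pois \<tau> (c + k * l)\<bar>) \<le> real b / sqrt \<tau>"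
proof -
  have le: "\<bar>pois \<tau> (c + b + k * l) - pois \<tau> (c + k * l)\<bar> \<le>
      (\<Sum>i<b. \<bar>pois_diff \<tau> (Suc (c + i) + k * l)\<bar>)" for l
    using pois_diff_telescope[OF assms(1), of "c + k * l" b]
      sum_abs[of "\<lambda>i. pois_diff \<tau> (Suc (c + i) + k * l)" "{..<b}"]
    by (simp add: algebra_simps)
  have s: "summable (\<lambda>l. \<Sum>i<b. \<bar>pois_diff \<tau> (Suc (c + i) + k * l)\<bar>)"
    by (intro summable_sum pois_diff_sampled assms)
  show 1: "summable (\<lambda>l. \<bar>pois \<tau> (c + b + k * l) - pois \<tau> (c + k * l)\<bar>)"
    by (rule summable_comparison_test'[OF s]) (use le in auto)
  have "(\<Sum>l. \<bar>pois \<tau> (c + b + k * l) - pois \<tau> (c + k * l)\<bar>) \<le>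
      (\<Sum>l. \<Sum>i<b. \<bar>pois_diff \<tau> (Suc (c + i) + k * l)\<bar>)"
    by (rule suminf_le[OF le 1 s])
  also have "\<dots> = (\<Sum>i<b. \<Sum>l. \<bar>pois_diff \<tau> (Suc (c + i) + k * l)\<bar>)"
    by (rule suminf_sum) (rule pois_diff_sampled[OF assms])
  also have "\<dots> \<le> (\<Sum>i<b. 1 / sqrt \<tau>)"
    by (intro sum_mono pois_diff_sampled assms)
  finally show "(\<Sum>l. \<bar>pois \<tau> (c + b + k * l) - pois \<tau> (c + k * l)\<bar>) \<le> real b / sqrt \<tau>" by simp
qed

lemma pois_sampled_summable:
  assumes "0 \<le> \<tau>" "0 < k"
  shows "summable (\<lambda>l. pois \<tau> (c + k * l))" "(\<Sum>l. pois \<tau> (c + k * l)) \<le> 1"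
proof -
  have inj: "inj (\<lambda>l. c + k * l)" using assms(2) by (auto simp: inj_def)
  note s = sums_summable[OF pois_sums[of \<tau>]]
  show "summable (\<lambda>l. pois \<tau> (c + k * l))"
    using summable_reindex[OF s inj] pois_nonneg[OF assms(1)] by (simp add: o_def)
  show "(\<Sum>l. pois \<tau> (c + k * l)) \<le> 1"
    using suminf_reindex_mono[OF s inj] pois_nonneg[OF assms(1)] pois_sums[of \<tau>]
    by (simp add: o_def sums_iff)
qed

text \<open>Used in \<open>mean_tendsto_of_pois_conv\<close>, where the l-th shift costs l + 1. As l
  <= k l, the first moment of the full distribution dominates.\<close>

lemma pois_sampled_moment:
  assumes "0 \<le> \<tau>" "0 < k"
  shows "summable (\<lambda>l. pois \<tau> (k * l) * real (Suc l))"
    and "(\<Sum>l. pois \<tau> (k * l) * real (Suc l)) \<le> \<tau> + 1"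
proof -
  have inj: "inj (\<lambda>l. k * l)" using assms(2) by (auto simp: inj_def)
  have S: "(\<lambda>n. pois \<tau> n * real (Suc n)) sums (\<tau> + 1)"
    using sums_add[OF pois_mean_sums pois_sums, of \<tau> \<tau>] by (simp add: algebra_simps)
  note s = sums_summable[OF S]
  have nn: "\<And>n. 0 \<le> pois \<tau> n * real (Suc n)" using pois_nonneg[OF assms(1)] by simp
  have s2: "summable (\<lambda>l. pois \<tau> (k * l) * real (Suc (k * l)))"
    using summable_reindex[OF s inj nn] by (simp only: o_def)
  have le: "pois \<tau> (k * l) * real (Suc l) \<le> pois \<tau> (k * l) * real (Suc (k * l))" for l
    using assms by (intro mult_left_mono pois_nonneg of_nat_mono) auto
  show s3: "summable (\<lambda>l. pois \<tau> (k * l) * real (Suc l))"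
    by (rule summable_comparison_test'[OF s2]) (use le nn pois_nonneg[OF assms(1)] in auto)
  have "(\<Sum>l. pois \<tau> (k * l) * real (Suc l)) \<le> (\<Sum>l. pois \<tau> (k * l) * real (Suc (k * l)))"
    by (rule suminf_le[OF le s3 s2])
  also have "\<dots> \<le> (\<Sum>n. pois \<tau> n * real (Suc n))"
    using suminf_reindex_mono[OF s inj nn] by (simp only: o_def)
  finally show "(\<Sum>l. pois \<tau> (k * l) * real (Suc l)) \<le> \<tau> + 1" using S by (simp add: sums_iff)
qed

text \<open>The k residue classes have total mass 1, and the mass of each differs from that of class
  0 by at most k / sqrt \<tau>.\<close>

lemma pois_sampled_mass:
  assumes "0 < \<tau>" "0 < k"
  shows "\<bar>real k * (\<Sum>l. pois \<tau> (k * l)) - 1\<bar> \<le> real (k * k) / sqrt \<tau>"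
proof -
  have t: "0 \<le> \<tau>" using assms by simp
  note P = pois_sampled_summable[OF t assms(2)]
  have "(\<lambda>n. sum (pois \<tau>) {n * k..<n * k + k}) sums 1"
    by (rule sums_group[OF pois_sums assms(2)])
  moreover have "sum (pois \<tau>) {n * k..<n * k + k} = (\<Sum>c<k. pois \<tau> (c + k * n))" for n
    using sum.shift_bounds_nat_ivl[of "pois \<tau>" 0 "n * k" k]
    by (simp add: algebra_simps lessThan_atLeast0)
  ultimately have "(\<Sum>l. \<Sum>c<k. pois \<tau> (c + k * l)) = 1" by (simp add: sums_iff)
  then have one: "(\<Sum>c<k. \<Sum>l. pois \<tau> (c + k * l)) = 1"
    by (subst suminf_sum[symmetric]) (use P in auto)
  have d: "\<bar>(\<Sum>l. pois \<tau> (c + k * l)) - (\<Sum>l. pois \<tau> (k * l))\<bar> \<le> real k / sqrt \<tau>" if "c < k" for c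
  proof -
    have "(\<Sum>l. pois \<tau> (c + k * l)) - (\<Sum>l. pois \<tau> (k * l)) = (\<Sum>l. pois \<tau> (c + k * l) - pois \<tau> (k * l))"
      using suminf_diff[OF P(1)[of c] P(1)[of 0]] by simp
    then have "\<bar>(\<Sum>l. pois \<tau> (c + k * l)) - (\<Sum>l. pois \<tau> (k * l))\<bar> \<le> real c / sqrt \<tau>"
      using summable_rabs[OF pois_shift_sampled(1)[OF assms, of 0 c]]
        pois_shift_sampled(2)[OF assms, of 0 c] by simp
    also have "\<dots> \<le> real k / sqrt \<tau>" using that t by (intro divide_right_mono) auto
    finally show ?thesis .
  qed
  have "real k * (\<Sum>l. pois \<tau> (k * l)) - 1 =
      (\<Sum>c<k. (\<Sum>l. pois \<tau> (k * l)) - (\<Sum>l. pois \<tau> (c + k * l)))"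
    by (simp add: sum_subtractf one)
  also have "\<bar>\<dots>\<bar> \<le> (\<Sum>c<k. \<bar>(\<Sum>l. pois \<tau> (k * l)) - (\<Sum>l. pois \<tau> (c + k * l))\<bar>)"
    by (rule sum_abs)
  also have "\<dots> \<le> (\<Sum>c<k. real k / sqrt \<tau>)"
    by (rule sum_mono) (use d in \<open>simp add: abs_minus_commute\<close>)
  finally show ?thesis by simp
qed

section \<open>Weights and increments near the mode\<close>

lemma pois_mono_below_mode:
  assumes "m \<le> n" "real n \<le> \<tau>" "0 < \<tau>" shows "pois \<tau> m \<le> pois \<tau> n"
  using assms(1,2)
proof (induction rule: dec_induct)
  case (step n)
  have "0 \<le> pois_diff \<tau> (Suc n)"
    using step pois_nonneg[of \<tau>] assms(3) by (auto simp: pois_diff_def simp del: of_nat_Suc)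
  then show ?case using step pois_diff_Suc[OF assms(3), of n] by auto
qed auto

lemma pois_antimono_above_mode:
  assumes "m \<le> n" "\<tau> \<le> real m" "0 < \<tau>" shows "pois \<tau> n \<le> pois \<tau> m"
  using assms(1)
proof (induction rule: dec_induct)
  case (step n)
  have "\<tau> \<le> real (Suc n)" using step assms by linarith
  then have "pois_diff \<tau> (Suc n) \<le> 0"
    using pois_nonneg[of \<tau>] assms(3)
    by (auto simp: pois_diff_def mult_nonneg_nonpos simp del: of_nat_Suc)
  then show ?case using step pois_diff_Suc[OF assms(3), of n] by auto
qed auto

text \<open>By Chebyshev's inequality, three quarters of the mass lie within two standard deviations of
  the mean, so the largest of the weights there is at least of the order of the inverse deviation.\<close>

lemma pois_mode_lower:
  assumes "1 \<le> s"
  shows "3 / (20 * real s) \<le> pois ((real s)\<^sup>2) (s\<^sup>2)"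
proof -
  define \<tau> where "\<tau> = (real s)\<^sup>2"
  have t: "0 < \<tau>" "\<tau> = real (s\<^sup>2)" using assms by (auto simp: \<tau>_def)
  \<comment> \<open>The terms are q n (1 - (n - \<tau>)^2 / (4 \<tau>)). They sum to 1 - 1/4 and are
    nonpositive outside the window \<open>W\<close>, whose part of the sum is thus at least 3/4.
    \<open>W\<close> has at most 4 s + 1 <= 5 s points, hence the constant 3 / (20 s).\<close>
  let ?f = "\<lambda>n. pois \<tau> n - (1 / (4 * \<tau>)) * ((real n - \<tau>)\<^sup>2 * pois \<tau> n)"
  have S: "?f sums (3 / 4)"
    using sums_diff[OF pois_sums sums_mult[OF pois_variance_sums], of \<tau> "1 / (4 * \<tau>)" \<tau>] t
    by simp
  \<comment> \<open>Truncated subtraction matters only for s = 1, where it cuts off a negative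
    position.\<close>
  define W where "W = {s\<^sup>2 - 2 * s .. s\<^sup>2 + 2 * s}"
  have out: "?f n \<le> 0" if "n \<notin> W" for n
  proof -
    have "2 * real s \<le> \<bar>real n - \<tau>\<bar>"
    proof -
    have "n + 2 * s < s\<^sup>2 \<or> s\<^sup>2 + 2 * s < n" using that unfolding W_def by auto
    then have "real (n + 2 * s) < \<tau> \<or> \<tau> + real (2 * s) < real n"
      unfolding t(2) of_nat_add[symmetric] of_nat_less_iff .
    then show ?thesis by auto
  qed
    then have "(2 * real s)\<^sup>2 \<le> \<bar>real n - \<tau>\<bar>\<^sup>2" by (intro power_mono) auto
    then have "4 * \<tau> \<le> (real n - \<tau>)\<^sup>2" by (simp add: \<tau>_def power_mult_distrib)
    then have "1 \<le> (1 / (4 * \<tau>)) * (real n - \<tau>)\<^sup>2" using t by (simp add: field_simps)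
    from mult_right_mono[OF this pois_nonneg[of \<tau> n]] t show ?thesis by (simp add: mult.assoc)
  qed
  have inn: "?f n \<le> pois \<tau> (s\<^sup>2)" for n
  proof -
    have "?f n \<le> pois \<tau> n" using t pois_nonneg[of \<tau> n] by simp
    also have "\<dots> \<le> pois \<tau> (s\<^sup>2)"
      using pois_mono_below_mode[of n "s\<^sup>2" \<tau>] pois_antimono_above_mode[of "s\<^sup>2" n \<tau>] t
      by (cases "n \<le> s\<^sup>2") auto
    finally show ?thesis .
  qed
  have fW: "finite W" by (simp add: W_def)
  have "3 / 4 \<le> (\<Sum>n\<in>W. ?f n)"
  proof (rule sums_le[OF _ S sums_If_finite_set[OF fW]])
    show "?f n \<le> (if n \<in> W then ?f n else 0)" for n using out by simp
  qed
  also have "\<dots> \<le> (\<Sum>n\<in>W. pois \<tau> (s\<^sup>2))" by (rule sum_mono) (rule inn)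
  also have "\<dots> = real (card W) * pois \<tau> (s\<^sup>2)" by simp
  also have "\<dots> \<le> (5 * real s) * pois \<tau> (s\<^sup>2)"
  proof (rule mult_right_mono)
    have "card W \<le> 5 * s" unfolding W_def using assms by simp
    then show "real (card W) \<le> 5 * real s" by linarith
  qed (use t in \<open>simp add: pois_nonneg\<close>)
  finally show ?thesis using assms by (simp add: \<tau>_def field_simps)
qed

text \<open>Each step down from the mode multiplies the weight by 1 - m / \<tau>. The product of
  these factors loses only a term of order m^2 / \<tau>, so the weight is comparable to the maximum
  within a fraction of a deviation.\<close>

lemma pois_near_mode:
  assumes "1 \<le> s" "m \<le> s"
  shows "(1 - (real m)\<^sup>2 / (real s)\<^sup>2) * pois ((real s)\<^sup>2) (s\<^sup>2) \<le> pois ((real s)\<^sup>2) (s\<^sup>2 - m)"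
  using assms(2)
proof (induction m)
  case (Suc m)
  define \<tau> where "\<tau> = (real s)\<^sup>2"
  define P where "P = pois \<tau> (s\<^sup>2)"
  have t: "0 < \<tau>" "\<tau> = real (s\<^sup>2)" using assms by (auto simp: \<tau>_def)
  have ms: "Suc m \<le> s\<^sup>2" using Suc.prems by (metis order_trans power2_nat_le_imp_le le_refl power2_nat_le_eq_le self_le_power assms(1) zero_less_numeral)
  have P: "0 \<le> P" using t by (simp add: P_def pois_nonneg)
  have "real (s\<^sup>2 - m) * pois \<tau> (s\<^sup>2 - m) = \<tau> * pois \<tau> (s\<^sup>2 - Suc m)"
    using pois_Suc[of "s\<^sup>2 - Suc m" \<tau>] ms by (simp add: Suc_diff_Suc del: of_nat_Suc of_nat_diff)
  then have eq: "pois \<tau> (s\<^sup>2 - Suc m) = (1 - real m / \<tau>) * pois \<tau> (s\<^sup>2 - m)"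
    using t ms by (simp add: field_simps of_nat_diff)
  have "(1 - (real (Suc m))\<^sup>2 / \<tau>) * P \<le> ((1 - real m / \<tau>) * (1 - (real m)\<^sup>2 / \<tau>)) * P"
  proof (rule mult_right_mono[OF _ P])
    have "(1 - real m / \<tau>) * (1 - (real m)\<^sup>2 / \<tau>) - (1 - (real (Suc m))\<^sup>2 / \<tau>)
        = real m * (real m)\<^sup>2 / (\<tau> * \<tau>) + (real m + 1) / \<tau>"
      using t(1) by (simp add: field_simps power2_eq_square)
    moreover have "0 \<le> real m * (real m)\<^sup>2 / (\<tau> * \<tau>) + (real m + 1) / \<tau>" using t(1) by simp
    ultimately show "1 - (real (Suc m))\<^sup>2 / \<tau> \<le> (1 - real m / \<tau>) * (1 - (real m)\<^sup>2 / \<tau>)"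
      by linarith
  qed
  also have "\<dots> = (1 - real m / \<tau>) * ((1 - (real m)\<^sup>2 / \<tau>) * P)" by simp
  also have "\<dots> \<le> (1 - real m / \<tau>) * pois \<tau> (s\<^sup>2 - m)"
    using Suc ms t by (intro mult_left_mono) (auto simp: P_def \<tau>_def field_simps simp flip: of_nat_power)
  finally show ?case by (simp add: eq[unfolded \<tau>_def] P_def \<tau>_def)
qed simp

text \<open>Between a quarter and half a deviation below the mode, the weight is at least 3/4 of the
  maximum, hence 9 / (80 s), and the relative increment m / \<tau> is at least 1 / (4 s). The
  product 9 / (320 s^2) exceeds 1 / (40 s^2).\<close>

lemma pois_diff_lower:
  assumes s: "1 \<le> s" and m: "real s \<le> 4 * real m" "2 * real m \<le> real s"
  shows "1 / (40 * (real s)\<^sup>2) \<le> pois_diff ((real s)\<^sup>2) (s\<^sup>2 - m)"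
proof -
  define \<tau> where "\<tau> = (real s)\<^sup>2"
  have t: "0 < \<tau>" "\<tau> = real (s\<^sup>2)" using s by (auto simp: \<tau>_def)
  have ms: "m \<le> s" using m by linarith
  have ms2: "m \<le> s\<^sup>2" using ms by (metis order_trans self_le_power s zero_less_numeral)
  have "(2 * real m)\<^sup>2 \<le> (real s)\<^sup>2" using m by (intro power_mono) auto
  then have q: "3 / 4 \<le> 1 - (real m)\<^sup>2 / \<tau>" using t by (simp add: \<tau>_def field_simps power_mult_distrib)
  have "3 / 4 * (3 / (20 * real s)) \<le> (1 - (real m)\<^sup>2 / \<tau>) * pois \<tau> (s\<^sup>2)"
    using pois_mode_lower[OF s] q order_trans[OF _ q, of 0]
    by (intro mult_mono) (auto simp: \<tau>_def)
  also have "\<dots> \<le> pois \<tau> (s\<^sup>2 - m)" using pois_near_mode[OF s ms] by (simp add: \<tau>_def)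
  finally have p: "9 / (80 * real s) \<le> pois \<tau> (s\<^sup>2 - m)" by simp
  have "1 / (40 * \<tau>) \<le> 9 / (80 * real s) * (1 / (4 * real s))"
    using s by (simp add: \<tau>_def power2_eq_square field_simps)
  also have "\<dots> \<le> pois \<tau> (s\<^sup>2 - m) * (real m / \<tau>)"
  proof (rule mult_mono[OF p])
    show "1 / (4 * real s) \<le> real m / \<tau>"
      using s m mult_left_mono[OF m(1), of "real s"] by (simp add: \<tau>_def power2_eq_square field_simps)
  qed (use t in \<open>auto simp: pois_nonneg\<close>)
  also have "real m / \<tau> = 1 - real (s\<^sup>2 - m) / \<tau>"
    using ms2 t by (simp add: of_nat_diff field_simps)
  finally show ?thesis by (simp add: pois_diff_def \<tau>_def)
qed

section \<open>Nilpotent matrices and the resolvent identity\<close>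

lemma of_real_vec_scale: "complex_of_real c *s v = c *\<^sub>R v"
  unfolding vec_eq_iff by (simp add: scaleR_conv_of_real[where 'a = complex])

definition poly_apply :: "complex poly \<Rightarrow> complex^'m^'m \<Rightarrow> complex^'m \<Rightarrow> complex^'m" where
  "poly_apply f N v = (\<Sum>i\<le>degree f. coeff f i *s ((*v) N ^^ i) v)"

lemma funpow_mat_scale: "((*v) N ^^ i) (c *s v) = c *s ((*v) N ^^ i) v" for N :: "complex^'m^'m"
  by (induction i) (auto simp: vector_scalar_commute)

lemma funpow_mat_diff: "((*v) N ^^ i) (v - w) = ((*v) N ^^ i) v - ((*v) N ^^ i) w"
  for N :: "complex^'m^'m"
  by (induction i) (auto simp: matrix_vector_mult_diff_distrib)

lemma poly_apply_eq:
  assumes "degree f \<le> n"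
  shows "poly_apply f N v = (\<Sum>i\<le>n. coeff f i *s ((*v) N ^^ i) v)"
  unfolding poly_apply_def
  by (rule sum.mono_neutral_left) (use assms in \<open>auto simp: coeff_eq_0\<close>)

lemma poly_apply_linear_factor:
  "poly_apply ([:- l, 1:] * g) N v = poly_apply g N (N *v v - l *s v)"
proof -
  let ?n = "Suc (degree g)" and ?p = "\<lambda>i. ((*v) N ^^ i) v"
  have d: "degree ([:- l, 1:] * g) \<le> ?n"
    using degree_mult_le[of "[:- l, 1:]" g] by simp
  have c: "[:- l, 1:] * g = smult (- l) g + pCons 0 g" by simp
  have "poly_apply ([:- l, 1:] * g) N v = (\<Sum>i\<le>?n. coeff (smult (- l) g + pCons 0 g) i *s ?p i)"
    by (simp only: poly_apply_eq[OF d]) (simp only: c)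
  also have "\<dots> = (\<Sum>i\<le>?n. (- l * coeff g i) *s ?p i) + (\<Sum>i\<le>?n. coeff (pCons 0 g) i *s ?p i)"
    by (simp only: coeff_add coeff_smult vec.scale_left_distrib sum.distrib)
  also have "(\<Sum>i\<le>?n. (- l * coeff g i) *s ?p i) = (\<Sum>i\<le>degree g. (- l * coeff g i) *s ?p i)"
    by (simp add: coeff_eq_0)
  also have "(\<Sum>i\<le>?n. coeff (pCons 0 g) i *s ?p i) = (\<Sum>i\<le>degree g. coeff g i *s ?p (Suc i))"
    by (subst sum.atMost_Suc_shift) simp
  finally show ?thesis
    unfolding poly_apply_def sum.distrib[symmetric]
    by (simp add: funpow_mat_diff funpow_mat_scale vec.scale_right_diff_distrib funpow_swap1
        mult.commute vec_eq_iff right_diff_distrib)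
qed

text \<open>Induction on the degree. Splitting off a root l of f, the induction hypothesis for N v -
  l v says that N^n v is an eigenvector for l or zero. For l nonzero it vanishes by assumption, for
  l = 0 the next power does.\<close>

lemma poly_apply_zero_imp_nilpotent:
  assumes inj: "\<And>\<mu> v. \<mu> \<noteq> 0 \<Longrightarrow> N *v v = \<mu> *s v \<Longrightarrow> v = 0"
  shows "degree f \<le> n \<Longrightarrow> f \<noteq> 0 \<Longrightarrow> poly_apply f N v = 0 \<Longrightarrow> ((*v) N ^^ n) v = 0"
proof (induction n arbitrary: f v)
  case 0
  then show ?case by (auto simp: poly_apply_def elim!: degree_eq_zeroE)
next
  case (Suc n)
  show ?case
  proof (cases "degree f = 0")
    case True
    then have "v = 0" using Suc.prems by (auto simp: poly_apply_def elim!: degree_eq_zeroE)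
    then show ?thesis using funpow_mat_scale[of "Suc n" N 0 v] by simp
  next
    case False
    then obtain l where "poly f l = 0"
      using fundamental_theorem_of_algebra[of f] constant_degree[of f] by auto
    then obtain g where g: "f = [:- l, 1:] * g" by (meson dvdE poly_eq_0_iff_dvd)
    with Suc.prems have "g \<noteq> 0" by auto
    then have "degree f = Suc (degree g)"
      unfolding g by (subst degree_mult_eq) auto
    then have "degree g \<le> n" using Suc.prems by simp
    from Suc.IH[OF this \<open>g \<noteq> 0\<close>] Suc.prems(3)
    have "((*v) N ^^ n) (N *v v - l *s v) = 0" by (simp only: g poly_apply_linear_factor)
    then have *: "N *v (((*v) N ^^ n) v) = l *s (((*v) N ^^ n) v)"
      by (simp add: funpow_mat_diff funpow_mat_scale funpow_swap1)
    then show ?thesis using inj[OF _ *] by (cases "l = 0") auto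
  qed
qed

text \<open>Every vector is annihilated by some nonzero polynomial in N, since too many iterates are
  linearly dependent. The exponent is the real dimension, twice the number of coordinates; a bound
  uniform in v is all that is wanted.\<close>

lemma nilpotent_if_no_nonzero_eigenvalue:
  fixes N :: "complex^'m^'m"
  assumes inj: "\<And>\<mu> v. \<mu> \<noteq> 0 \<Longrightarrow> N *v v = \<mu> *s v \<Longrightarrow> v = 0"
  shows "((*v) N ^^ DIM(complex^'m)) v = 0"
proof -
  let ?D = "DIM(complex^'m)" and ?p = "\<lambda>i. ((*v) N ^^ i) v"
  have "\<exists>f. f \<noteq> 0 \<and> degree f \<le> ?D \<and> poly_apply f N v = 0"
  \<comment> \<open>Dependence is a property of sets and says nothing about repeated iterates. If
    two iterates coincide, the difference of two monomials annihilates v.\<close>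
  proof (cases "inj_on ?p {..?D}")
    case True
    have "dependent (?p ` {..?D})"
      by (rule dependent_biggerset) (subst card_image[OF True], simp)
    then obtain u w where w: "w \<in> ?p ` {..?D}" "u w \<noteq> 0"
      and u: "(\<Sum>w\<in>?p ` {..?D}. u w *\<^sub>R w) = 0"
      by (auto simp: real_vector.dependent_finite)
    define f where "f = (\<Sum>i\<le>?D. monom (complex_of_real (u (?p i))) i)"
    have c: "coeff f i = (if i \<le> ?D then complex_of_real (u (?p i)) else 0)" for i
      by (simp add: f_def coeff_sum)
    have d: "degree f \<le> ?D" by (rule degree_le) (simp add: c)
    from w obtain i where "i \<le> ?D" "u (?p i) \<noteq> 0" by auto
    then have "coeff f i \<noteq> 0" by (simp add: c)
    then have "f \<noteq> 0" by auto
    have "poly_apply f N v = (\<Sum>i\<le>?D. u (?p i) *\<^sub>R ?p i)"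
      unfolding poly_apply_eq[OF d] by (rule sum.cong) (auto simp: c of_real_vec_scale)
    also have "\<dots> = 0" using u unfolding sum.reindex[OF True] o_def .
    finally show ?thesis using d \<open>f \<noteq> 0\<close> by blast
  next
    case False
    then obtain i j where ij: "i < j" "j \<le> ?D" "?p i = ?p j"
      by (auto simp: inj_on_def) (metis linorder_neqE_nat)
    define f :: "complex poly" where "f = monom 1 j - monom 1 i"
    have d: "degree f \<le> ?D"
      unfolding f_def by (rule degree_diff_le) (use ij in \<open>auto simp: degree_monom_eq\<close>)
    have "coeff f j = 1" using ij by (simp add: f_def)
    then have "f \<noteq> 0" by auto
    have "poly_apply f N v = (\<Sum>k\<le>?D. (if k = j then ?p j else 0) - (if k = i then ?p i else 0))"
      unfolding poly_apply_eq[OF d] by (rule sum.cong) (auto simp: f_def)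
    also have "\<dots> = 0" using ij by (simp add: sum_subtractf)
    finally show ?thesis using d \<open>f \<noteq> 0\<close> by blast
  qed
  then obtain f where "f \<noteq> 0" "degree f \<le> ?D" "poly_apply f N v = 0" by blast
  from poly_apply_zero_imp_nilpotent[OF _ this(2,1,3)] inj show ?thesis by blast
qed

section \<open>Resolvents of nilpotent matrices and comparison of coefficients\<close>

lemma matrix_inv_mult:
  assumes "invertible M" shows "M ** matrix_inv M = mat 1" "matrix_inv M ** M = mat 1"
  using someI_ex[of "\<lambda>M'. M ** M' = mat 1 \<and> M' ** M = mat 1"] assms
  by (auto simp: invertible_def matrix_inv_def)

lemma matrix_inv_vec:
  assumes "invertible M" "M *v w = v" shows "matrix_inv M *v v = w"
  using assms(2) matrix_inv_mult(2)[OF assms(1)] by (auto simp: matrix_vector_mul_assoc)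

lemma mat_mult_vec: "mat c *v v = c *s v" for v :: "complex^'m"
  by (simp add: vec_eq_iff matrix_vector_mult_def mat_def if_distrib[of "\<lambda>x. x * _"] cong: if_cong)

text \<open>The Neumann series, which stops because N is nilpotent; multiplied out it
  telescopes.\<close>

lemma resolvent_of_nilpotent:
  fixes N :: "complex^'m^'m"
  assumes nil: "\<And>v. ((*v) N ^^ d) v = 0" and \<mu>: "\<mu> \<noteq> 0" and inv: "invertible (mat \<mu> - N)"
  shows "matrix_inv (mat \<mu> - N) *v v = (\<Sum>i<d. (1 / \<mu>) ^ Suc i *s ((*v) N ^^ i) v)"
proof (rule matrix_inv_vec[OF inv])
  let ?t = "\<lambda>i. (1 / \<mu>) ^ i *s ((*v) N ^^ i) v"
  have "(mat \<mu> - N) *v (\<Sum>i<d. (1 / \<mu>) ^ Suc i *s ((*v) N ^^ i) v) = (\<Sum>i<d. ?t i - ?t (Suc i))"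
    unfolding vec.linear_sum[OF matrix_vector_mul_linear_gen] matrix_vector_mult_diff_rdistrib mat_mult_vec
    using \<mu> by (intro sum.cong) (auto simp: vector_scalar_commute)
  also have "\<dots> = v" by (subst sum_lessThan_telescope') (simp add: nil)
  finally show "(mat \<mu> - N) *v (\<Sum>i<d. (1 / \<mu>) ^ Suc i *s ((*v) N ^^ i) v) = v" .
qed

text \<open>The resolvent identity is an identity of polynomials in the reciprocal of the spectral
  parameter; comparing coefficients decouples it.\<close>

lemma resolvent_identity_coefficients:
  fixes N A :: "complex^'m^'m" and z :: complex
  assumes nil: "\<And>v. ((*v) N ^^ d) v = 0" and inv: "\<And>\<mu>. \<mu> \<noteq> 0 \<Longrightarrow> invertible (mat \<mu> - N)"
    and id: "\<And>\<mu>. \<mu> \<noteq> 0 \<Longrightarrow> A ** matrix_inv (mat \<mu> - N) ** A = mat (z ^ k / \<mu> ^ k) ** A"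
  shows "A *v (((*v) N ^^ i) (A *v v)) = (if Suc i = k then z ^ k *s (A *v v) else 0)"
    and "k = 0 \<Longrightarrow> A = 0"
proof -
  have coeffs: "(if 2 \<le> j \<and> j - 2 < d then (A *v (((*v) N ^^ (j - 2)) (A *v v))) $ r else 0) =
      (if j = Suc k then z ^ k * (A *v v) $ r else 0)" for j r v
  proof -
    define a where "a i = (A *v (((*v) N ^^ i) (A *v v))) $ r" for i
    \<comment> \<open>In s = 1/\<mu> the identity has the exponents i + 1 and k; both sides are
      multiplied by s once more. Then p vanishes also at s = 0, a point that no \<mu> represents,
      even for k = 0.\<close>
    define p where "p = (\<Sum>i<d. monom (a i) (i + 2)) - monom (z ^ k * (A *v v) $ r) (Suc k)"
    have "poly p s = 0" for s
    proof (cases "s = 0")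
      case False
      define \<mu> where "\<mu> = 1 / s"
      have m: "\<mu> \<noteq> 0" "1 / \<mu> = s" using False by (auto simp: \<mu>_def)
      have "A *v (matrix_inv (mat \<mu> - N) *v (A *v v)) = (z ^ k / \<mu> ^ k) *s (A *v v)"
        using arg_cong[OF id[OF m(1)], of "\<lambda>M. M *v v"]
        by (simp only: matrix_vector_mul_assoc[symmetric] mat_mult_vec)
      then have "(\<Sum>i<d. s ^ Suc i *s (A *v (((*v) N ^^ i) (A *v v)))) = (z ^ k * s ^ k) *s (A *v v)"
        unfolding resolvent_of_nilpotent[OF nil m(1) inv[OF m(1)]] m(2)
          vec.linear_sum[OF matrix_vector_mul_linear_gen] vector_scalar_commute
        using m by (simp add: \<mu>_def power_one_over)
      then have "(\<Sum>i<d. s ^ Suc i * a i) = z ^ k * s ^ k * (A *v v) $ r"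
        unfolding a_def by (simp add: vec_eq_iff)
      then have "(\<Sum>i<d. s * (s ^ Suc i * a i)) = s * (z ^ k * s ^ k * (A *v v) $ r)"
        by (simp add: sum_distrib_left[symmetric])
      then show ?thesis
        by (simp add: p_def poly_sum poly_monom mult_ac)
    qed (simp add: p_def poly_sum poly_monom)
    then have "p = 0" using poly_all_0_iff_0 by blast
    then have "coeff p j = 0" by simp
    moreover have "coeff p j = (if 2 \<le> j \<and> j - 2 < d then a (j - 2) else 0) -
        (if j = Suc k then z ^ k * (A *v v) $ r else 0)"
    proof -
      have "(\<Sum>i<d. if i + 2 = j then a i else 0) = (if 2 \<le> j \<and> j - 2 < d then a (j - 2) else 0)"
      proof (cases "2 \<le> j \<and> j - 2 < d")
        case True
        then have "(\<Sum>i<d. if i + 2 = j then a i else 0) = (\<Sum>i<d. if i = j - 2 then a i else 0)"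
          by (intro sum.cong) auto
        then show ?thesis using True by simp
      qed (auto intro!: sum.neutral)
      then show ?thesis by (auto simp: p_def coeff_sum coeff_monom)
    qed
    ultimately show ?thesis by (simp only: a_def right_minus_eq)
  qed
  have hi: "((*v) N ^^ i) w = 0" if "d \<le> i" for i w
  proof -
    have "((*v) N ^^ (i - d + d)) w = ((*v) N ^^ (i - d)) (0 *s w)"
      unfolding funpow_add o_apply nil by simp
    then show ?thesis using that unfolding funpow_mat_scale by simp
  qed
  show "A *v (((*v) N ^^ i) (A *v v)) = (if Suc i = k then z ^ k *s (A *v v) else 0)"
  proof (cases "i < d")
    case True
    then show ?thesis using coeffs[of "i + 2" v] by (auto simp: vec_eq_iff)
  next
    case False
    then have "((*v) N ^^ i) (A *v v) = 0" by (simp add: hi)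
    \<comment> \<open>Here k exceeds the nilpotency index, so the left-hand side has no term of this
      degree and the comparison itself makes the right-hand side vanish.\<close>
    moreover have "z ^ k *s (A *v v) = 0" if "Suc i = k"
      using coeffs[of "i + 2" v] False that by (auto simp: vec_eq_iff)
    ultimately show ?thesis by simp
  qed
  show "A = 0" if "k = 0"
  proof -
    \<comment> \<open>Degree 1 occurs only on the right-hand side, and only for k = 0.\<close>
    have "A *v v = 0" for v using coeffs[of 1 v] that by (auto simp: vec_eq_iff)
    then show ?thesis by (simp add: matrix_eq)
  qed
qed

section \<open>Solutions as Poisson averages of shifts\<close>

text \<open>One form for two operators: A itself, with F = A_0, and \<zeta> + A, with F = N.\<close>

definition delay_op :: "('a \<Rightarrow> 'a::plus) \<Rightarrow> ('a \<Rightarrow> 'a) \<Rightarrow> (int \<Rightarrow> 'a) \<Rightarrow> int \<Rightarrow> 'a" where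
  "delay_op F G x = (\<lambda>j. F (x j) + G (x (j - 1)))"

text \<open>The derivative of the (n+1)-st remainder is the operator applied to the n-th, so the
  mean value inequality integrates the bound once per step. Coordinatewise derivatives and a bound
  uniform in the coordinates suffice, which frees the argument from p.\<close>

lemma delay_op_Taylor_remainder:
  fixes u :: "real \<Rightarrow> int \<Rightarrow> 'a::real_normed_vector"
  assumes F: "bounded_linear F" and G: "bounded_linear G"
    and K: "\<And>v. norm (F v) \<le> K\<^sub>1 * norm v" "\<And>v. norm (G v) \<le> K\<^sub>2 * norm v" "0 \<le> K\<^sub>1" "0 \<le> K\<^sub>2"
    and der: "\<And>t j. 0 \<le> t \<Longrightarrow> ((\<lambda>s. u s j) has_vector_derivative delay_op F G (u t) j) (at t within {0..})"
    and bnd: "\<And>t j. 0 \<le> t \<Longrightarrow> t \<le> T \<Longrightarrow> norm (u t j) \<le> C"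
    and t: "0 \<le> t" "t \<le> T"
  shows "norm (u t j - (\<Sum>i<n. (t ^ i / fact i) *\<^sub>R (delay_op F G ^^ i) (u 0) j))
    \<le> C * (K\<^sub>1 + K\<^sub>2) ^ n * t ^ n / fact n"
  using t
proof (induction n arbitrary: t j)
  case 0
  then show ?case using bnd by simp
next
  case (Suc n)
  interpret F: bounded_linear F by fact
  interpret G: bounded_linear G by fact
  let ?D = "delay_op F G" and ?K = "K\<^sub>1 + K\<^sub>2"
  define R where "R n t j = u t j - (\<Sum>i<n. (t ^ i / fact i) *\<^sub>R (?D ^^ i) (u 0) j)" for n t j
  have C: "0 \<le> C" using bnd[of t j] Suc.prems norm_ge_zero order_trans by blast
  show ?case
  proof (cases "t = 0")
    case True
    have "(\<Sum>i<Suc n. ((0::real) ^ i / fact i) *\<^sub>R (?D ^^ i) (u 0) j) = u 0 j"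
      by (subst sum.lessThan_Suc_shift) simp
    then show ?thesis using True C by simp
  next
    case False
    have dR: "((\<lambda>s. R (Suc n) s j) has_vector_derivative ?D (R n s) j) (at s within {0..})" if "0 \<le> s" for s
    proof -
      have p: "((\<lambda>s. s ^ i / fact i) has_vector_derivative (if i = 0 then 0 else s ^ (i - 1) / fact (i - 1)))
          (at s within {0..})" for i
      proof (cases i)
        case (Suc m)
        have "((\<lambda>s. s ^ i / fact i) has_real_derivative (real i * s ^ (i - 1) / fact i)) (at s within {0..})"
          by (auto intro!: derivative_eq_intros)
        moreover have "real i * s ^ (i - 1) / fact i = s ^ (i - 1) / fact (i - 1)"
          using Suc by (simp add: field_simps del: of_nat_Suc)
        ultimately show ?thesis using Suc by (simp add: has_real_derivative_iff_has_vector_derivative)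
      qed simp
      have "((\<lambda>s. R (Suc n) s j) has_vector_derivative ?D (u s) j -
          (\<Sum>i<Suc n. (if i = 0 then 0 else s ^ (i - 1) / fact (i - 1)) *\<^sub>R (?D ^^ i) (u 0) j)) (at s within {0..})"
        unfolding R_def
        by (intro has_vector_derivative_diff der that has_vector_derivative_sum)
           (intro bounded_linear.has_vector_derivative[OF bounded_linear_scaleR_left] p)
      moreover have "(\<Sum>i<Suc n. (if i = 0 then 0 else s ^ (i - 1) / fact (i - 1)) *\<^sub>R (?D ^^ i) (u 0) j) =
          (\<Sum>i<n. (s ^ i / fact i) *\<^sub>R ?D ((?D ^^ i) (u 0)) j)"
        by (subst sum.lessThan_Suc_shift) simp
      moreover have "?D (R n s) j = ?D (u s) j - (\<Sum>i<n. (s ^ i / fact i) *\<^sub>R ?D ((?D ^^ i) (u 0)) j)"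
        by (simp add: delay_op_def R_def F.diff G.diff F.sum G.sum F.scaleR G.scaleR scaleR_add_right
            sum.distrib)
      ultimately show ?thesis by simp
    qed
    have "norm (R (Suc n) t j - R (Suc n) 0 j) \<le> C * ?K ^ Suc n * t ^ Suc n / fact (Suc n)
        - C * ?K ^ Suc n * 0 ^ Suc n / fact (Suc n)"
    proof (rule differentiable_bound_general)
      show "0 < t" using False Suc.prems by simp
      show "continuous_on {0..t} (\<lambda>s. R (Suc n) s j)"
      proof (rule continuous_on_vector_derivative)
        fix s assume "s \<in> {0..t}"
        then show "((\<lambda>s. R (Suc n) s j) has_vector_derivative ?D (R n s) j) (at s within {0..t})"
          using dR by (intro has_vector_derivative_within_subset[OF dR]) auto
      qed
      show "continuous_on {0..t} (\<lambda>s. C * ?K ^ Suc n * s ^ Suc n / fact (Suc n))"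
        by (intro continuous_intros) auto
      fix s assume s: "0 < s" "s < t"
      have "at s within {0..} = at s" using s by (intro at_within_interior) simp
      then show "((\<lambda>s. R (Suc n) s j) has_vector_derivative ?D (R n s) j) (at s)"
        using dR[of s] s by simp
      have "((\<lambda>s. C * ?K ^ Suc n * s ^ Suc n / fact (Suc n)) has_real_derivative
          C * ?K ^ Suc n * (real (Suc n) * s ^ n) / fact (Suc n)) (at s)"
        by (rule derivative_eq_intros | simp)+
      moreover have "C * ?K ^ Suc n * (real (Suc n) * s ^ n) / fact (Suc n) = C * ?K ^ Suc n * s ^ n / fact n"
        by (simp del: of_nat_Suc)
      ultimately show "((\<lambda>s. C * ?K ^ Suc n * s ^ Suc n / fact (Suc n)) has_vector_derivative
          C * ?K ^ Suc n * s ^ n / fact n) (at s)"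
        by (simp only: has_real_derivative_iff_has_vector_derivative)
      have R: "norm (R n s i) \<le> C * ?K ^ n * s ^ n / fact n" for i
        using Suc.IH[of s i] s Suc.prems by (simp add: R_def)
      have "norm (?D (R n s) j) \<le> K\<^sub>1 * norm (R n s j) + K\<^sub>2 * norm (R n s (j - 1))"
        unfolding delay_op_def by (intro norm_triangle_le add_mono K)
      also have "\<dots> \<le> K\<^sub>1 * (C * ?K ^ n * s ^ n / fact n) + K\<^sub>2 * (C * ?K ^ n * s ^ n / fact n)"
        by (intro add_mono mult_left_mono R K)
      also have "\<dots> = C * ?K ^ Suc n * s ^ n / fact n"
        by (simp add: algebra_simps add_divide_distrib)
      finally show "norm (?D (R n s) j) \<le> C * ?K ^ Suc n * s ^ n / fact n" .
    qed
    moreover have "R (Suc n) 0 j = 0"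
      unfolding R_def by (subst sum.lessThan_Suc_shift) simp
    ultimately show ?thesis by (simp add: R_def)
  qed
qed

text \<open>The Taylor series of every solution is determined by the initial value, which proves
  uniqueness along with the formula.\<close>

lemma delay_op_solution_sums:
  fixes u :: "real \<Rightarrow> int \<Rightarrow> 'a::real_normed_vector"
  assumes F: "bounded_linear F" and G: "bounded_linear G"
    and der: "\<And>t j. 0 \<le> t \<Longrightarrow> ((\<lambda>s. u s j) has_vector_derivative delay_op F G (u t) j) (at t within {0..})"
    and bnd: "\<And>s j. 0 \<le> s \<Longrightarrow> s \<le> t \<Longrightarrow> norm (u s j) \<le> C"
    and t: "0 \<le> t"
  shows "(\<lambda>n. (t ^ n / fact n) *\<^sub>R (delay_op F G ^^ n) (u 0) j) sums u t j"
proof -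
  define K where "K = onorm F + onorm G"
  have b: "norm (u t j - (\<Sum>i<n. (t ^ i / fact i) *\<^sub>R (delay_op F G ^^ i) (u 0) j)) \<le>
      C * K ^ n * t ^ n / fact n" for n
    unfolding K_def using t
    by (intro delay_op_Taylor_remainder[OF F G onorm[OF F] onorm[OF G] onorm_pos_le[OF F] onorm_pos_le[OF G] der bnd])
      auto
  have "(\<lambda>n. C * (inverse (fact n) * (K * t) ^ n)) \<longlonglongrightarrow> C * 0"
    by (intro tendsto_mult tendsto_const summable_LIMSEQ_zero summable_exp)
  then have lim: "(\<lambda>n. C * K ^ n * t ^ n / fact n) \<longlonglongrightarrow> 0"
    by (simp add: power_mult_distrib field_simps)
  have "(\<lambda>n. u t j - (\<Sum>i<n. (t ^ i / fact i) *\<^sub>R (delay_op F G ^^ i) (u 0) j)) \<longlonglongrightarrow> 0"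
    by (rule Lim_null_comparison[OF _ lim]) (use b in auto)
  from tendsto_diff[OF tendsto_const[of "u t j"] this] show ?thesis by (simp add: sums_def)
qed

text \<open>The spectral assumption survives as \<open>nilpotent\<close> and the resolvent identity
  as \<open>compress\<close>. Since \<zeta> is real, both make sense for real-linear maps on a
  euclidean space.\<close>

locale delay_chain =
  fixes N A :: "'a::euclidean_space \<Rightarrow> 'a" and \<zeta> :: real and k d :: nat
  assumes N: "bounded_linear N" and A: "bounded_linear A"
    and nilpotent: "(N ^^ d) v = 0"
    and compress: "A ((N ^^ i) (A v)) = (if Suc i = k then \<zeta> ^ k *\<^sub>R A v else 0)"
    and zeta_pos: "0 < \<zeta>" and k_pos: "0 < k" and A_nonzero: "\<exists>v. A v \<noteq> 0"
begin

sublocale N: bounded_linear N by (rule N)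
sublocale A: bounded_linear A by (rule A)

lemma bounded_linear_pow: "bounded_linear (N ^^ i)"
proof (induction i)
  case (Suc i)
  then show ?case using bounded_linear_compose[OF N] by (simp add: o_def)
qed (simp add: id_def)

sublocale Npow: bounded_linear "N ^^ i" for i by (rule bounded_linear_pow)

lemma pow_zero: "d \<le> i \<Longrightarrow> (N ^^ i) v = 0"
  using funpow_add[of "i - d" d N] nilpotent Npow.zero by simp

text \<open>Otherwise N^(k-1) = 0, contradicting \<open>compress\<close>. It guarantees that the
  index k - 1 occurs in the sums over i < d below.\<close>

lemma k_le_d: "k \<le> d"
proof (rule ccontr)
  assume "\<not> k \<le> d"
  then have "(N ^^ (k - 1)) (A v) = 0" for v by (intro pow_zero) simp
  then have "\<zeta> ^ k *\<^sub>R A v = 0" for v using compress[of "k - 1" v] k_pos A.zero by simp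
  then show False using A_nonzero zeta_pos by simp
qed

section \<open>Powers of \<zeta> + A\<close>

abbreviation B where "B \<equiv> delay_op N A"

text \<open>Discrete variation of constants: the words in N and A are sorted by the number a of
  factors N in front of their leftmost A.\<close>

lemma B_pow_Duhamel:
  "(B ^^ n) x j = (N ^^ n) (x j) + (\<Sum>a<n. (N ^^ a) (A ((B ^^ (n - 1 - a)) x (j - 1))))"
proof (induction n arbitrary: j)
  case (Suc n)
  have "(B ^^ Suc n) x j = N ((B ^^ n) x j) + A ((B ^^ n) x (j - 1))"
    by (simp add: delay_op_def)
  also have "\<dots> = (N ^^ Suc n) (x j) + (\<Sum>a<Suc n. (N ^^ a) (A ((B ^^ (Suc n - 1 - a)) x (j - 1))))"
    by (subst sum.lessThan_Suc_shift) (simp add: Suc[of j] N.add N.sum)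
  finally show ?case .
qed simp

text \<open>Applying A to the previous formula produces A N^a A, and only a = k - 1
  survives.\<close>

lemma A_B_pow_rec:
  "A ((B ^^ n) x j) = A ((N ^^ n) (x j)) +
    (if k \<le> n then \<zeta> ^ k *\<^sub>R A ((B ^^ (n - k)) x (j - 1)) else 0)"
proof -
  have e: "Suc a = k \<longleftrightarrow> a = k - 1" for a using k_pos by auto
  have "A ((B ^^ n) x j) = A ((N ^^ n) (x j)) +
      (\<Sum>a<n. if a = k - 1 then \<zeta> ^ k *\<^sub>R A ((B ^^ (n - 1 - a)) x (j - 1)) else 0)"
    unfolding B_pow_Duhamel[of n] A.add A.sum compress e ..
  moreover have "n - 1 - (k - 1) = n - k" "k - 1 \<in> {..<n} \<longleftrightarrow> k \<le> n" using k_pos by auto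
  ultimately show ?thesis unfolding sum.delta[OF finite_lessThan] by simp
qed

text \<open>Unrolled l times, the recursion leaves \<zeta>^(k l) A N^b at position j - l with b = n
  - k l. Indexing by b instead of l makes the number of terms independent of n, as N^b = 0 from d
  on.\<close>

lemma A_B_pow:
  "A ((B ^^ n) x j) = (\<Sum>b<d. if b \<le> n \<and> k dvd n - b
      then \<zeta> ^ (n - b) *\<^sub>R A ((N ^^ b) (x (j - int ((n - b) div k)))) else 0)"
proof (induction n arbitrary: j rule: less_induct)
  case (less n)
  let ?f = "\<lambda>n j b. if b \<le> n \<and> k dvd n - b
      then \<zeta> ^ (n - b) *\<^sub>R A ((N ^^ b) (x (j - int ((n - b) div k)))) else 0"
  have first: "A ((N ^^ n) (x j)) = (\<Sum>b<d. if b = n then A ((N ^^ n) (x j)) else 0)"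
    using pow_zero[of n] A.zero by auto
  show ?case
  proof (cases "k \<le> n")
    case False
    have "?f n j b = (if b = n then A ((N ^^ n) (x j)) else 0)" for b
    proof (cases "b \<le> n \<and> k dvd n - b")
      case True
      then have "b = n" using False k_pos by (auto dest: dvd_imp_le)
      then show ?thesis by simp
    qed auto
    then show ?thesis using False first by (simp add: A_B_pow_rec[of n])
  next
    case True
    have "?f n j b = (if b = n then A ((N ^^ n) (x j)) else 0) + \<zeta> ^ k *\<^sub>R ?f (n - k) (j - 1) b" for b
    proof (cases "b \<le> n \<and> k dvd n - b \<and> b \<noteq> n")
      case True
      then have "k \<le> n - b" by (auto dest: dvd_imp_le)
      then have e: "b \<le> n - k" "n - k - b = n - b - k" using True \<open>k \<le> n\<close> by auto
      have e': "k dvd n - b - k" using True by (metis dvd_diff_nat dvd_refl)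
      have "(n - b) div k = Suc ((n - b - k) div k)"
        using \<open>k \<le> n - b\<close> k_pos by (simp add: le_div_geq)
      moreover have "\<zeta> ^ (n - b) = \<zeta> ^ k * \<zeta> ^ (n - b - k)"
        using \<open>k \<le> n - b\<close> by (simp only: power_add[symmetric] le_add_diff_inverse)
      ultimately show ?thesis using True e e' by (simp add: algebra_simps)
    next
      case no: False
      have "\<not> (b \<le> n - k \<and> k dvd n - k - b)"
      proof
        assume a: "b \<le> n - k \<and> k dvd n - k - b"
        then have "k dvd n - k - b + k" by simp
        also have "n - k - b + k = n - b" using conjunct1[OF a] True by simp
        finally show False using no a True k_pos by auto
      qed
      then show ?thesis using no by auto
    qed
    then show ?thesis
      using True k_pos less.IH[of "n - k" "j - 1"] first
      by (simp add: A_B_pow_rec[of n] sum.distrib scaleR_sum_right)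
  qed
qed

text \<open>The surviving words are N^a A N^(k-1) A ... N^(k-1) A N^b. With l + 1 factors A such a
  word has length a + b + 1 + k l and shifts by l + 1.\<close>

lemma B_pow:
  "(B ^^ n) x j = (N ^^ n) (x j) + (\<Sum>a<d. \<Sum>b<d.
    if a + b + 1 \<le> n \<and> k dvd n - (a + b + 1)
    then \<zeta> ^ (n - (a + b + 1)) *\<^sub>R (N ^^ a) (A ((N ^^ b) (x (j - 1 - int ((n - (a + b + 1)) div k)))))
    else 0)"
proof -
  let ?g = "\<lambda>a. (N ^^ a) (A ((B ^^ (n - 1 - a)) x (j - 1)))"
  have "(\<Sum>a<n. ?g a) = (\<Sum>a<d. if a < n then ?g a else 0)"
  proof -
    have "(\<Sum>a<n. ?g a) = (\<Sum>a\<in>{..<n} \<inter> {..<d}. ?g a)"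
      by (rule sum.mono_neutral_right) (auto, metis pow_zero linorder_not_less)
    also have "\<dots> = (\<Sum>a<d. if a < n then ?g a else 0)"
      by (simp add: sum.inter_restrict[symmetric] Int_commute)
        (rule sum.mono_neutral_cong, auto)
    finally show ?thesis .
  qed
  also have "\<dots> = (\<Sum>a<d. \<Sum>b<d. if a + b + 1 \<le> n \<and> k dvd n - (a + b + 1)
      then \<zeta> ^ (n - (a + b + 1)) *\<^sub>R (N ^^ a) (A ((N ^^ b) (x (j - 1 - int ((n - (a + b + 1)) div k)))))
      else 0)"
  proof (intro sum.cong refl)
    fix a
    show "(if a < n then ?g a else 0) = (\<Sum>b<d. if a + b + 1 \<le> n \<and> k dvd n - (a + b + 1)
      then \<zeta> ^ (n - (a + b + 1)) *\<^sub>R (N ^^ a) (A ((N ^^ b) (x (j - 1 - int ((n - (a + b + 1)) div k)))))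
      else 0)"
    proof (cases "a < n")
      case True
      then have "b \<le> n - 1 - a \<longleftrightarrow> a + b + 1 \<le> n" "n - 1 - a - b = n - (a + b + 1)" for b by auto
      then show ?thesis unfolding A_B_pow Npow.sum using True
        by (auto intro!: sum.cong simp: Npow.scaleR Npow.zero)
    qed auto
  qed
  finally show ?thesis unfolding B_pow_Duhamel[of n] by simp
qed

section \<open>Resummation of the Taylor series\<close>

lemma pois_series:
  fixes y :: "nat \<Rightarrow> 'b::banach"
  assumes t: "0 \<le> t" and y: "\<And>l. norm (y l) \<le> C"
  shows "(\<lambda>n. (t ^ n / fact n) *\<^sub>R (if c \<le> n \<and> k dvd n - c
      then \<zeta> ^ (n - c) *\<^sub>R y ((n - c) div k) else 0))
    sums (exp (\<zeta> * t) *\<^sub>R (1 / \<zeta>) ^ c *\<^sub>R (\<Sum>l. pois (\<zeta> * t) (c + k * l) *\<^sub>R y l))"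
    (is "?f sums ?S")
proof -
  let ?h = "\<lambda>l. c + k * l"
  have m: "strict_mono ?h" using k_pos by (auto simp: strict_mono_def)
  have z: "?f n = 0" if "n \<notin> range ?h" for n
  proof -
    have no: "\<not> (c \<le> n \<and> k dvd n - c)"
      using that by (auto elim!: dvdE) (metis le_add_diff_inverse rangeI)
    show ?thesis unfolding if_not_P[OF no] by simp
  qed
  \<comment> \<open>For n = c + k l, the factor t^n \<zeta>^(n-c) / n! is exp (\<zeta> t)
    \<zeta>^(-c) times the Poisson weight at n.\<close>
  have pw: "?f (?h l) = (exp (\<zeta> * t) * (1 / \<zeta>) ^ c) *\<^sub>R pois (\<zeta> * t) (?h l) *\<^sub>R y l" for l
    using zeta_pos k_pos
    by (simp add: pois_def exp_minus power_mult_distrib power_add power_one_over field_simps)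
  have "summable (\<lambda>l. pois (\<zeta> * t) (?h l) *\<^sub>R y l)"
  proof (rule summable_scaleR_bounded[OF _ y])
    show "summable (\<lambda>l. \<bar>pois (\<zeta> * t) (?h l)\<bar>)"
      using pois_sampled_summable(1)[of "\<zeta> * t" k c] pois_nonneg[of "\<zeta> * t"] t zeta_pos k_pos by simp
  qed
  then have "(\<lambda>l. (exp (\<zeta> * t) * (1 / \<zeta>) ^ c) *\<^sub>R pois (\<zeta> * t) (?h l) *\<^sub>R y l) sums
      ((exp (\<zeta> * t) * (1 / \<zeta>) ^ c) *\<^sub>R (\<Sum>l. pois (\<zeta> * t) (?h l) *\<^sub>R y l))"
    by (intro sums_scaleR_right summable_sums)
  then have "(\<lambda>l. ?f (?h l)) sums ?S" unfolding pw by simp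
  then show ?thesis using sums_mono_reindex[OF m, of ?f] z by blast
qed

text \<open>The operator G_c of the overview. Its value type is free because the lower bounds apply
  it to real sequences and the solutions to vectors.\<close>

definition pois_conv :: "real \<Rightarrow> nat \<Rightarrow> (int \<Rightarrow> 'b::banach) \<Rightarrow> int \<Rightarrow> 'b" where
  "pois_conv \<tau> c x j = (\<Sum>l. pois \<tau> (c + k * l) *\<^sub>R x (j - int l))"

lemma pois_abs_summable: "0 \<le> \<tau> \<Longrightarrow> summable (\<lambda>l. \<bar>pois \<tau> (c + k * l)\<bar>)"
  using pois_sampled_summable(1)[of \<tau> k c] pois_nonneg[of \<tau>] k_pos by simp

lemma pois_conv_summable:
  fixes x :: "int \<Rightarrow> 'b::banach"
  assumes "0 \<le> \<tau>" "\<And>j. norm (x j) \<le> C"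
  shows "summable (\<lambda>l. pois \<tau> (c + k * l) *\<^sub>R x (j - int l))"
  by (rule summable_scaleR_bounded[OF pois_abs_summable[OF assms(1)] assms(2)])

lemma pois_conv_linear:
  fixes x :: "int \<Rightarrow> 'b::banach" and L :: "'b \<Rightarrow> 'c::banach"
  assumes "0 \<le> \<tau>" "\<And>j. norm (x j) \<le> C" "bounded_linear L"
  shows "pois_conv \<tau> c (\<lambda>j. L (x j)) j = L (pois_conv \<tau> c x j)"
  unfolding pois_conv_def
  using bounded_linear.suminf[OF assms(3) pois_conv_summable[where x = x and c = c and j = j, OF assms(1,2)]]
  by (simp add: linear_scale[OF bounded_linear.linear[OF assms(3)]])

text \<open>\<open>w\<close> is the coordinate of the solution at time t; the hypothesis carries exp
  (\<zeta> t) because the series belongs to \<zeta> + A. All words with the same outer exponents a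
  and b are collected in one Poisson average.\<close>

lemma solution_formula:
  fixes x :: "int \<Rightarrow> 'a"
  assumes t: "0 \<le> t" and x: "\<And>j. norm (x j) \<le> C"
    and S: "(\<lambda>n. (t ^ n / fact n) *\<^sub>R (B ^^ n) x j) sums (exp (\<zeta> * t) *\<^sub>R w)"
  shows "w = (\<Sum>n<d. ((1 / \<zeta>) ^ n * pois (\<zeta> * t) n) *\<^sub>R (N ^^ n) (x j)) +
    (\<Sum>a<d. \<Sum>b<d. (1 / \<zeta>) ^ (a + b + 1) *\<^sub>R
      (N ^^ a) (A ((N ^^ b) (pois_conv (\<zeta> * t) (a + b + 1) (\<lambda>j. x (j - 1)) j))))"
proof -
  let ?\<tau> = "\<zeta> * t"
  have \<tau>: "0 \<le> ?\<tau>" using t zeta_pos by simp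
  let ?L = "\<lambda>a b v. (N ^^ a) (A ((N ^^ b) v))"
  have L: "bounded_linear (?L a b)" for a b
    using bounded_linear_compose[OF bounded_linear_pow bounded_linear_compose[OF A bounded_linear_pow]] .
  have 1: "(\<lambda>n. (t ^ n / fact n) *\<^sub>R (N ^^ n) (x j)) sums
      (\<Sum>n<d. (t ^ n / fact n) *\<^sub>R (N ^^ n) (x j))"
    by (rule sums_finite) (auto simp: pow_zero)
  have 2: "(\<lambda>n. (t ^ n / fact n) *\<^sub>R (if a + b + 1 \<le> n \<and> k dvd n - (a + b + 1)
      then \<zeta> ^ (n - (a + b + 1)) *\<^sub>R ?L a b (x (j - 1 - int ((n - (a + b + 1)) div k))) else 0))
     sums (exp ?\<tau> *\<^sub>R (1 / \<zeta>) ^ (a + b + 1) *\<^sub>R ?L a b (pois_conv ?\<tau> (a + b + 1) (\<lambda>j. x (j - 1)) j))" for a b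
  proof -
    have "norm (?L a b (x (j - 1 - int l))) \<le> onorm (?L a b) * C" for l
      using onorm[OF L, of a b "x (j - 1 - int l)"]
        mult_left_mono[OF x[of "j - 1 - int l"] onorm_pos_le[OF L[of a b]]] by linarith
    from pois_series[OF t this, of "a + b + 1"]
    have "(\<lambda>n. (t ^ n / fact n) *\<^sub>R (if a + b + 1 \<le> n \<and> k dvd n - (a + b + 1)
      then \<zeta> ^ (n - (a + b + 1)) *\<^sub>R ?L a b (x (j - 1 - int ((n - (a + b + 1)) div k))) else 0))
      sums (exp ?\<tau> *\<^sub>R (1 / \<zeta>) ^ (a + b + 1) *\<^sub>R
        pois_conv ?\<tau> (a + b + 1) (\<lambda>j. ?L a b (x (j - 1))) j)"
      by (simp add: pois_conv_def algebra_simps)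
    then show ?thesis
      using pois_conv_linear[of ?\<tau> "\<lambda>j. x (j - 1)" C "?L a b" "a + b + 1" j, OF \<tau> x L] by simp
  qed
  have "(\<lambda>n. (t ^ n / fact n) *\<^sub>R (B ^^ n) x j) sums
      ((\<Sum>n<d. (t ^ n / fact n) *\<^sub>R (N ^^ n) (x j)) + (\<Sum>a<d. \<Sum>b<d.
        exp ?\<tau> *\<^sub>R (1 / \<zeta>) ^ (a + b + 1) *\<^sub>R ?L a b (pois_conv ?\<tau> (a + b + 1) (\<lambda>j. x (j - 1)) j)))"
    unfolding B_pow scaleR_add_right scaleR_sum_right by (intro sums_add sums_sum 1 2)
  from sums_unique2[OF S this]
  have "exp (- ?\<tau>) *\<^sub>R exp ?\<tau> *\<^sub>R w = exp (- ?\<tau>) *\<^sub>R ((\<Sum>n<d. (t ^ n / fact n) *\<^sub>R (N ^^ n) (x j)) +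
      (\<Sum>a<d. \<Sum>b<d. exp ?\<tau> *\<^sub>R (1 / \<zeta>) ^ (a + b + 1) *\<^sub>R
        ?L a b (pois_conv ?\<tau> (a + b + 1) (\<lambda>j. x (j - 1)) j)))"
    by simp
  then show ?thesis
    unfolding scaleR_add_right scaleR_sum_right scaleR_scaleR
    using zeta_pos by (simp add: exp_minus pois_def power_mult_distrib power_one_over field_simps)
qed

text \<open>With A on both ends, \<open>compress\<close> leaves only b = k - 1, and the solution
  becomes a scalar convolution without error term. Lower bounds can then be proved for real
  sequences.\<close>

lemma A_solution_formula:
  fixes f :: "int \<Rightarrow> real"
  assumes t: "0 \<le> t" and f: "\<And>j. norm (f j) \<le> C"
    and S: "(\<lambda>n. (t ^ n / fact n) *\<^sub>R (B ^^ n) (\<lambda>j. f j *\<^sub>R A v) j) sums (exp (\<zeta> * t) *\<^sub>R w)"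
  shows "A w = (\<zeta> * pois_conv (\<zeta> * t) (k - 1) f j) *\<^sub>R A v"
proof -
  let ?\<tau> = "\<zeta> * t"
  have \<tau>: "0 \<le> ?\<tau>" using t zeta_pos by simp
  have B: "A ((B ^^ n) (\<lambda>j. f j *\<^sub>R A v) j) = (if k - 1 \<le> n \<and> k dvd n - (k - 1)
      then \<zeta> ^ (n - (k - 1)) *\<^sub>R \<zeta> ^ k *\<^sub>R f (j - int ((n - (k - 1)) div k)) *\<^sub>R A v else 0)" for n
  proof -
    have "A ((B ^^ n) (\<lambda>j. f j *\<^sub>R A v) j) = (\<Sum>b<d. if b = k - 1 then (if k - 1 \<le> n \<and> k dvd n - (k - 1)
      then \<zeta> ^ (n - (k - 1)) *\<^sub>R \<zeta> ^ k *\<^sub>R f (j - int ((n - (k - 1)) div k)) *\<^sub>R A v else 0) else 0)"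
      unfolding A_B_pow Npow.scaleR A.scaleR compress using k_pos
      by (intro sum.cong refl) (auto simp: mult_ac)
    then show ?thesis using k_le_d k_pos by auto
  qed
  have "norm (\<zeta> ^ k *\<^sub>R f i *\<^sub>R A v) \<le> \<zeta> ^ k * (C * norm (A v))" for i
    using f[of i] zeta_pos by (simp add: abs_mult mult_left_mono mult_right_mono mult.assoc)
  from pois_series[OF t this, of "k - 1"]
  have S1: "(\<lambda>n. (t ^ n / fact n) *\<^sub>R A ((B ^^ n) (\<lambda>j. f j *\<^sub>R A v) j)) sums
     (exp ?\<tau> *\<^sub>R (1 / \<zeta>) ^ (k - 1) *\<^sub>R pois_conv ?\<tau> (k - 1) (\<lambda>j. \<zeta> ^ k *\<^sub>R f j *\<^sub>R A v) j)"
    unfolding B pois_conv_def .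
  have S2: "pois_conv ?\<tau> (k - 1) (\<lambda>j. \<zeta> ^ k *\<^sub>R f j *\<^sub>R A v) j =
      \<zeta> ^ k *\<^sub>R pois_conv ?\<tau> (k - 1) f j *\<^sub>R A v"
    by (rule pois_conv_linear[OF \<tau> f])
      (intro bounded_linear_scaleR_right[THEN bounded_linear_compose] bounded_linear_scaleR_left)
  have z: "(1 / \<zeta>) ^ (k - 1) * \<zeta> ^ k = \<zeta>"
    using zeta_pos k_pos power_add[of \<zeta> 1 "k - 1"] by (simp add: power_one_over)
  have z': "(1 / \<zeta>) ^ (k - 1) *\<^sub>R \<zeta> ^ k *\<^sub>R y = \<zeta> *\<^sub>R y" for y :: 'a
    by (simp only: scaleR_scaleR z)
  have 1: "(\<lambda>n. (t ^ n / fact n) *\<^sub>R A ((B ^^ n) (\<lambda>j. f j *\<^sub>R A v) j)) sums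
     (exp ?\<tau> *\<^sub>R (\<zeta> * pois_conv ?\<tau> (k - 1) f j) *\<^sub>R A v)"
    using S1 unfolding S2 z' by (simp only: scaleR_scaleR)
  have "(\<lambda>n. (t ^ n / fact n) *\<^sub>R A ((B ^^ n) (\<lambda>j. f j *\<^sub>R A v) j)) sums (exp ?\<tau> *\<^sub>R A w)"
    using A.sums[OF S] by (simp add: A.scaleR)
  from sums_unique2[OF this 1] show ?thesis unfolding scaleR_cancel_left by simp
qed

end

section \<open>Poisson averages and means of shifts\<close>

lemma Abel_partial_sums:
  fixes e :: "nat \<Rightarrow> 'b::real_vector"
  assumes "e 0 = 0"
  shows "(\<Sum>l<n. q l *\<^sub>R (e (Suc l) - e l)) = q n *\<^sub>R e n + (\<Sum>l<n. (q l - q (Suc l)) *\<^sub>R e (Suc l))"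
  by (induction n) (auto simp: assms algebra_simps)

lemma lp_le_constD:
  assumes "1 \<le> p" "p < \<infinity>" "lp_le p (\<lambda>j. v) C"
  shows "v = 0"
proof (rule ccontr)
  assume v: "v \<noteq> 0"
  let ?q = "enn2real p"
  have p: "p \<noteq> \<infinity>" using assms by auto
  define c where "c = norm v powr ?q"
  have c: "0 < c" using v by (simp add: c_def)
  obtain n :: nat where n: "C powr ?q < real n * c" using reals_Archimedean3[OF c] by blast
  have "(\<Sum>j\<in>{0..<int n}. norm v powr ?q) \<le> C powr ?q"
    using assms(3) p unfolding lp_le_def by (metis finite_atLeastLessThan_int)
  then show False using n by (simp add: c_def)
qed

lemma eventually_div_sqrt_less:
  assumes "0 < \<epsilon>" shows "\<forall>\<^sub>F \<tau> in at_top. c / sqrt \<tau> < (\<epsilon> :: real)"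
  using order_tendstoD(2)[OF real_tendsto_divide_at_top[OF tendsto_const[of c] sqrt_at_top] assms] .

lemma eventually_div_nat_less:
  assumes "0 < \<epsilon>" shows "\<forall>\<^sub>F n in sequentially. c / real n < \<epsilon>"
  using order_tendstoD(2)[OF real_tendsto_divide_at_top[OF tendsto_const[of c] filterlim_real_sequentially] assms] .

definition mean :: "nat \<Rightarrow> (int \<Rightarrow> 'b::real_vector) \<Rightarrow> int \<Rightarrow> 'b" where
  "mean n w j = (1 / real n) *\<^sub>R (\<Sum>i=1..n. w (j - int i))"

lemma mean_lp_le:
  assumes p: "1 \<le> p" and w: "lp_le p w D" and n: "1 \<le> n"
  shows "lp_le p (mean n w) D"
proof -
  have "lp_le p (\<lambda>j. \<Sum>i=1..n. w (j - int i)) (\<Sum>i=1..n. D)"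
    by (intro lp_le_sum p lp_le_shift w) auto
  from lp_le_scaleR[OF p this, of "1 / real n"] n show ?thesis
    unfolding mean_def[abs_def] by simp
qed

text \<open>All but the first and last few summands of the mean of \<open>w - S\<^sup>m w\<close> cancel.\<close>

lemma mean_shift_diff_lp_le:
  assumes p: "1 \<le> p" and w: "lp_le p w D" and n: "1 \<le> n"
  shows "lp_le p (mean n (\<lambda>j. w j - w (j - int m))) (2 * real m * D / real n)"
proof -
  have t: "(\<Sum>i=1..n. w (j - int i) - w (j - int i - int m)) =
      (\<Sum>i=1..m. w (j - int i)) - (\<Sum>i=1..m. w (j - int i - int n))" for j
  proof (induction m)
    case (Suc m)
    have "(\<Sum>i=1..n. w (j - int i) - w (j - int i - int (Suc m))) =
        (\<Sum>i=1..n. w (j - int i) - w (j - int i - int m)) +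
        (\<Sum>i=1..n. w (j - int i - int m) - w (j - int (Suc i) - int m))"
      by (simp add: sum.distrib[symmetric] algebra_simps)
    also have "(\<Sum>i=1..n. w (j - int i - int m) - w (j - int (Suc i) - int m)) =
        w (j - int 1 - int m) - w (j - int (Suc n) - int m)"
      using sum_telescope''[of 1 "Suc n" "\<lambda>i. - w (j - int i - int m)"]
        sum_Suc_diff[of 1 n "\<lambda>i. - w (j - int i - int m)"] n by simp
    finally show ?case unfolding Suc by (simp add: algebra_simps)
  qed simp
  have "lp_le p (\<lambda>j. (\<Sum>i=1..m. w (j - int i)) - (\<Sum>i=1..m. w (j - int i - int n)))
      ((\<Sum>i=1..m. D) + (\<Sum>i=1..m. D))"
  proof (intro lp_le_diff lp_le_sum p)
    show "lp_le p (\<lambda>j. w (j - int i - int n)) D" for i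
      using lp_le_shift[OF w, of "int i + int n"] by (simp add: algebra_simps)
  qed (auto intro: lp_le_shift w)
  from lp_le_scaleR[OF p this, of "1 / real n"] show ?thesis
    unfolding mean_def[abs_def] t by (simp add: mult_ac)
qed

context delay_chain
begin

lemma pois_conv_lp_le:
  fixes y :: "int \<Rightarrow> 'b::banach"
  assumes p: "1 \<le> p" and \<tau>: "0 \<le> \<tau>" and y: "lp_le p y D"
  shows "lp_le p (pois_conv \<tau> c y) D"
proof -
  have "(\<Sum>l. \<bar>pois \<tau> (c + k * l)\<bar>) \<le> 1"
    using pois_sampled_summable(2)[OF \<tau> k_pos] pois_nonneg[OF \<tau>] by simp
  from lp_le_suminf[OF p lp_le_shift[OF y] pois_abs_summable[OF \<tau>] this]
  show ?thesis unfolding pois_conv_def[abs_def] by simp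
qed

lemma pois_conv_diff_lp_le:
  fixes y :: "int \<Rightarrow> 'b::banach"
  assumes p: "1 \<le> p" and \<tau>: "0 < \<tau>" and y: "lp_le p y D"
  shows "lp_le p (\<lambda>j. pois_conv \<tau> c y j - pois_conv \<tau> 0 y j) (real c / sqrt \<tau> * D)"
proof -
  have "pois_conv \<tau> c y j - pois_conv \<tau> 0 y j =
      (\<Sum>l. (pois \<tau> (c + k * l) - pois \<tau> (k * l)) *\<^sub>R y (j - int l))" for j
    using suminf_diff[OF pois_conv_summable[of \<tau> y D c j] pois_conv_summable[of \<tau> y D 0 j]]
      lp_le_coord[OF p y] \<tau>
    by (simp add: pois_conv_def scaleR_diff_left)
  moreover have "lp_le p (\<lambda>j. \<Sum>l. (pois \<tau> (c + k * l) - pois \<tau> (k * l)) *\<^sub>R y (j - int l))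
      (real c / sqrt \<tau> * D)"
    by (rule lp_le_suminf[OF p lp_le_shift[OF y]]) (use pois_shift_sampled[OF \<tau> k_pos, of 0 c] in auto)
  ultimately show ?thesis by simp
qed

text \<open>Summation by parts: \<open>e l\<close> is the sum of the first l shifts of y, and the
  boundary term tends to 0 as the sampled weights do. What remains is bounded partial sums against
  the variation of the weights in steps of k.\<close>

lemma pois_conv_Abel_lp_le:
  fixes y :: "int \<Rightarrow> 'b::banach"
  assumes p: "1 \<le> p" and \<tau>: "0 < \<tau>" and e: "\<And>l. lp_le p (e l) C" and e0: "\<And>j. e 0 j = 0"
    and y: "\<And>j l. y (j - int l) = e (Suc l) j - e l j"
  shows "lp_le p (pois_conv \<tau> 0 y) (real k / sqrt \<tau> * C)"
proof -
  let ?q = "\<lambda>l. pois \<tau> (k * l)"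
  have s: "summable (\<lambda>l. \<bar>?q l - ?q (Suc l)\<bar>)" "(\<Sum>l. \<bar>?q l - ?q (Suc l)\<bar>) \<le> real k / sqrt \<tau>"
    using pois_shift_sampled[OF \<tau> k_pos, of 0 k] by (simp_all add: abs_minus_commute)
  have C: "norm (e l j) \<le> C" for l j by (rule lp_le_coord[OF p e])
  have yb: "norm (y j) \<le> C" for j using y[of j 0] e0[of j] C[of 1 j] by simp
  have "pois_conv \<tau> 0 y j = (\<Sum>l. (?q l - ?q (Suc l)) *\<^sub>R e (Suc l) j)" for j
  proof -
    have "(\<lambda>n. ?q n *\<^sub>R e n j) \<longlonglongrightarrow> 0"
    proof (rule Lim_null_comparison)
      show "\<forall>\<^sub>F n in sequentially. norm (?q n *\<^sub>R e n j) \<le> ?q n * C"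
        using C \<tau> by (auto simp: pois_nonneg mult_left_mono)
      show "(\<lambda>n. ?q n * C) \<longlonglongrightarrow> 0"
        using summable_LIMSEQ_zero[OF pois_sampled_summable(1)[of \<tau> k 0]] \<tau> k_pos
        by (intro tendsto_mult_left_zero) simp
    qed
    moreover have "(\<lambda>n. \<Sum>l<n. (?q l - ?q (Suc l)) *\<^sub>R e (Suc l) j) \<longlonglongrightarrow>
        (\<Sum>l. (?q l - ?q (Suc l)) *\<^sub>R e (Suc l) j)"
      by (intro summable_LIMSEQ) (rule summable_scaleR_bounded[OF s(1) C])
    ultimately have "(\<lambda>n. \<Sum>l<n. ?q l *\<^sub>R (e (Suc l) j - e l j)) \<longlonglongrightarrow>
        0 + (\<Sum>l. (?q l - ?q (Suc l)) *\<^sub>R e (Suc l) j)"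
      unfolding Abel_partial_sums[of "\<lambda>l. e l j" ?q, OF e0] by (rule tendsto_add)
    then have "(\<lambda>l. ?q l *\<^sub>R y (j - int l)) sums (\<Sum>l. (?q l - ?q (Suc l)) *\<^sub>R e (Suc l) j)"
      unfolding sums_def y by simp
    then show ?thesis by (simp add: pois_conv_def sums_iff)
  qed
  then have "pois_conv \<tau> 0 y = (\<lambda>j. \<Sum>l. (?q l - ?q (Suc l)) *\<^sub>R e (Suc l) j)" by blast
  then show ?thesis using lp_le_suminf[OF p e s(1) s(2), of Suc] by (simp only:)
qed

text \<open>The partial sums of shifts of (I - S) v telescope to v - S^l v, whose norm does not grow
  with l.\<close>

lemma pois_conv_difference_lp_le:
  fixes v :: "int \<Rightarrow> 'b::banach"
  assumes p: "1 \<le> p" and \<tau>: "0 < \<tau>" and v: "lp_le p v V"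
  shows "lp_le p (pois_conv \<tau> 0 (\<lambda>j. v j - v (j - 1))) (real k / sqrt \<tau> * (V + V))"
proof (rule pois_conv_Abel_lp_le[OF p \<tau>, where e = "\<lambda>l j. v j - v (j - int l)"])
  show "lp_le p (\<lambda>j. v j - v (j - int l)) (V + V)" for l
    by (intro lp_le_diff p v lp_le_shift)
qed (auto simp: algebra_simps)

lemma pois_conv_diff:
  fixes x y :: "int \<Rightarrow> 'b::banach"
  assumes "0 \<le> \<tau>" "\<And>j. norm (x j) \<le> C" "\<And>j. norm (y j) \<le> D"
  shows "pois_conv \<tau> c (\<lambda>j. x j - y j) j = pois_conv \<tau> c x j - pois_conv \<tau> c y j"
  using suminf_diff[OF pois_conv_summable[of \<tau> x C c j] pois_conv_summable[of \<tau> y D c j]] assms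
  by (simp add: pois_conv_def scaleR_diff_right)

lemma pois_conv_const:
  "0 \<le> \<tau> \<Longrightarrow> pois_conv \<tau> 0 (\<lambda>j. v) j = (\<Sum>l. pois \<tau> (k * l)) *\<^sub>R (v :: 'b::banach)"
  using suminf_scaleR_left[OF pois_sampled_summable(1)[of \<tau> k 0], of v] k_pos
  by (simp add: pois_conv_def)

lemma pois_conv_const_lp_le:
  fixes v :: "'b::banach"
  assumes p: "1 \<le> p" and \<tau>: "0 < \<tau>" and v: "lp_le p (\<lambda>j. v) V"
  shows "lp_le p (\<lambda>j. pois_conv \<tau> 0 (\<lambda>j. v) j - (1 / real k) *\<^sub>R v) (real k / sqrt \<tau> * V)"
proof (rule lp_le_map[OF p v])
  fix j
  define m where "m = (\<Sum>l. pois \<tau> (k * l))"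
  have "m - 1 / real k = (real k * m - 1) / real k" using k_pos by (simp add: field_simps)
  then have "\<bar>m - 1 / real k\<bar> = \<bar>real k * m - 1\<bar> / real k" by simp
  also have "\<dots> \<le> (real (k * k) / sqrt \<tau>) / real k"
    unfolding m_def by (intro divide_right_mono pois_sampled_mass \<tau> k_pos) simp
  also have "\<dots> = real k / sqrt \<tau>" using k_pos by simp
  finally have le: "\<bar>m - 1 / real k\<bar> \<le> real k / sqrt \<tau>" .
  have "pois_conv \<tau> 0 (\<lambda>j. v) j - (1 / real k) *\<^sub>R v = (m - 1 / real k) *\<^sub>R v"
    using \<tau> by (simp add: pois_conv_const m_def scaleR_diff_left)
  then show "norm (pois_conv \<tau> 0 (\<lambda>j. v) j - (1 / real k) *\<^sub>R v) \<le> real k / sqrt \<tau> * norm v"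
    by (simp only: norm_scaleR mult_right_mono[OF le norm_ge_zero])
qed (use \<tau> in simp)

text \<open>\<open>w\<close> minus its \<open>n\<close>-th mean lies in the range of \<open>I - S\<close>.\<close>

lemma pois_conv_minus_mean_lp_le:
  fixes w :: "int \<Rightarrow> 'b::banach"
  assumes p: "1 \<le> p" and \<tau>: "0 < \<tau>" and w: "lp_le p w D" and n: "1 \<le> n"
  shows "lp_le p (pois_conv \<tau> 0 (\<lambda>j. w j - mean n w j)) (2 * real k * real n * D / sqrt \<tau>)"
proof -
  \<comment> \<open>v is the mean over m = 1, ..., n of the partial sums of the first m shifts of w;
    I - S turns the m-th of them into w - S^m w.\<close>
  define v where "v j = (1 / real n) *\<^sub>R (\<Sum>m=1..n. \<Sum>i<m. w (j - int i))" for j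
  have "lp_le p (\<lambda>j. \<Sum>m=1..n. \<Sum>i<m. w (j - int i)) (\<Sum>m=1..n. \<Sum>i<m. D)"
    by (intro lp_le_sum p lp_le_shift w) auto
  moreover have "(\<Sum>m=1..n. \<Sum>i<m. D) \<le> (\<Sum>m=1..n. real n * D)"
    using lp_le_nonneg[OF w] by (intro sum_mono) (auto intro: mult_right_mono)
  ultimately have "lp_le p (\<lambda>j. \<Sum>m=1..n. \<Sum>i<m. w (j - int i)) (real n * (real n * D))"
    by (auto intro: lp_le_mono)
  from lp_le_scaleR[OF p this, of "1 / real n"] n have v: "lp_le p v (real n * D)"
    unfolding v_def[abs_def] by simp
  have vd: "v j - v (j - 1) = w j - mean n w j" for j
  proof -
    have "(\<Sum>i<m. w (j - int i)) - (\<Sum>i<m. w (j - 1 - int i)) = w j - w (j - int m)" for m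
      by (induction m) (auto simp: algebra_simps)
    then have "v j - v (j - 1) = (1 / real n) *\<^sub>R (\<Sum>m=1..n. w j - w (j - int m))"
      by (simp add: v_def scaleR_diff_right[symmetric] sum_subtractf[symmetric])
    then show ?thesis
      using n by (simp add: mean_def sum_subtractf scaleR_diff_right sum_constant_scaleR)
  qed
  show ?thesis using pois_conv_difference_lp_le[OF p \<tau> v] unfolding vd by (simp add: mult_ac)
qed

text \<open>Split w into w - \<open>mean n w\<close>, \<open>mean n w\<close> - v and v. First n is
  fixed to make the second part small; then large \<tau> makes the first part small and brings the
  mass close to 1/k. One good n for each \<epsilon> is enough.\<close>

lemma pois_conv_tendsto_of_mean:
  fixes w :: "int \<Rightarrow> 'b::banach"
  assumes p: "1 \<le> p" and w: "lp_le p w D" and v: "lp_le p (\<lambda>j. v) V"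
    and mean: "\<And>\<epsilon>. 0 < \<epsilon> \<Longrightarrow> \<exists>n\<ge>1. lp_le p (\<lambda>j. mean n w j - v) \<epsilon>" and \<epsilon>: "0 < \<epsilon>"
  shows "\<forall>\<^sub>F \<tau> in at_top. lp_le p (\<lambda>j. pois_conv \<tau> 0 w j - (1 / real k) *\<^sub>R v) \<epsilon>"
proof -
  obtain n where n: "1 \<le> n" and m: "lp_le p (\<lambda>j. mean n w j - v) (\<epsilon> / 2)"
    using mean[of "\<epsilon> / 2"] \<epsilon> by auto
  define c where "c = 2 * real k * real n * D + real k * V"
  have "\<forall>\<^sub>F \<tau> in at_top. c / sqrt \<tau> < \<epsilon> / 2" using \<epsilon> by (intro eventually_div_sqrt_less) simp
  moreover have "\<forall>\<^sub>F \<tau>::real in at_top. 0 < \<tau>" by (rule eventually_gt_at_top)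
  ultimately show ?thesis
  proof eventually_elim
    case (elim \<tau>)
    have mw: "lp_le p (mean n w) D" by (rule mean_lp_le[OF p w n])
    have b: "norm (w j) \<le> D" "norm (mean n w j) \<le> D" "norm v \<le> V" for j
      using lp_le_coord[OF p w] lp_le_coord[OF p mw] lp_le_coord[OF p v] by auto
    have bd: "norm (w j - mean n w j) \<le> D + D" "norm (mean n w j - v) \<le> D + V" for j
      using b norm_triangle_ineq4[of "w j" "mean n w j"] norm_triangle_ineq4[of "mean n w j" v]
      by (meson add_mono order_trans)+
    have eq: "pois_conv \<tau> 0 w j - (1 / real k) *\<^sub>R v =
      pois_conv \<tau> 0 (\<lambda>j. w j - mean n w j) j + pois_conv \<tau> 0 (\<lambda>j. mean n w j - v) j +
      (pois_conv \<tau> 0 (\<lambda>j. v) j - (1 / real k) *\<^sub>R v)" for j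
      using elim b by (simp add: pois_conv_diff[of \<tau> w D "mean n w" D] pois_conv_diff[of \<tau> "mean n w" D "\<lambda>j. v" V])
    have le: "lp_le p (\<lambda>j. pois_conv \<tau> 0 (\<lambda>j. w j - mean n w j) j + pois_conv \<tau> 0 (\<lambda>j. mean n w j - v) j +
      (pois_conv \<tau> 0 (\<lambda>j. v) j - (1 / real k) *\<^sub>R v)) (2 * real k * real n * D / sqrt \<tau> + \<epsilon> / 2 + real k / sqrt \<tau> * V)"
      using elim by (intro lp_le_add p pois_conv_minus_mean_lp_le w n pois_conv_lp_le m pois_conv_const_lp_le v) auto
    have "2 * real k * real n * D / sqrt \<tau> + \<epsilon> / 2 + real k / sqrt \<tau> * V \<le> \<epsilon>"
    proof -
      have "c / sqrt \<tau> = 2 * real k * real n * D / sqrt \<tau> + real k / sqrt \<tau> * V"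
        by (simp add: c_def add_divide_distrib)
      then show ?thesis using elim by linarith
    qed
    with le show ?case unfolding eq by (rule lp_le_mono)
  qed
qed

text \<open>The assumption bounds the partial sums of S w - v, which is what summation by parts asks
  for; the shift in the conclusion accounts for these sums starting at i = 1.\<close>

lemma pois_conv_rate_of_mean:
  fixes w :: "int \<Rightarrow> 'b::banach"
  assumes p: "1 \<le> p" and w: "lp_le p w D" and v: "lp_le p (\<lambda>j. v) V"
    and mean: "\<And>n. lp_le p (\<lambda>j. (\<Sum>i=1..n. w (j - int i)) - real n *\<^sub>R v) C" and \<tau>: "0 < \<tau>"
  shows "lp_le p (\<lambda>j. pois_conv \<tau> 0 (\<lambda>j. w (j - 1)) j - (1 / real k) *\<^sub>R v) (real k * (C + V) / sqrt \<tau>)"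
proof -
  have "lp_le p (pois_conv \<tau> 0 (\<lambda>j. w (j - 1) - v)) (real k / sqrt \<tau> * C)"
    by (rule pois_conv_Abel_lp_le[OF p \<tau>, where e = "\<lambda>n j. (\<Sum>i=1..n. w (j - int i)) - real n *\<^sub>R v"])
      (auto intro: mean[unfolded One_nat_def] simp: algebra_simps)
  from lp_le_add[OF p this pois_conv_const_lp_le[OF p \<tau> v]]
  have "lp_le p (\<lambda>j. pois_conv \<tau> 0 (\<lambda>j. w (j - 1) - v) j + (pois_conv \<tau> 0 (\<lambda>j. v) j - (1 / real k) *\<^sub>R v))
      (real k * (C + V) / sqrt \<tau>)"
    by (simp only: distrib_left[symmetric] times_divide_eq_left add_divide_distrib[symmetric])
  then show ?thesis
    using \<tau> lp_le_coord[OF p w] lp_le_coord[OF p v]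
    by (simp add: pois_conv_diff[of \<tau> "\<lambda>j. w (j - 1)" D "\<lambda>j. v" V])
qed

text \<open>Converse comparison, in the opposite order: \<tau> is fixed first. With m the mass, P
  the Poisson average of S w and q_l the weights, w is the sum of (1 - k m) w, k times the sum of
  q_l (w - S^(l+1) w), and k P. The mean of the middle part is O(1/n), because that of w - S^(l+1) w
  costs (l + 1) / n and the weights have a first moment.\<close>

lemma mean_tendsto_of_pois_conv:
  fixes w :: "int \<Rightarrow> 'b::banach"
  assumes p: "1 \<le> p" and w: "lp_le p w D"
    and conv: "\<And>\<epsilon>. 0 < \<epsilon> \<Longrightarrow> \<forall>\<^sub>F \<tau> in at_top. lp_le p (\<lambda>j. pois_conv \<tau> 0 (\<lambda>j. w (j - 1)) j - v) \<epsilon>"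
    and \<epsilon>: "0 < \<epsilon>"
  shows "\<forall>\<^sub>F n in sequentially. lp_le p (\<lambda>j. mean n w j - real k *\<^sub>R v) \<epsilon>"
proof -
  \<comment> \<open>Each of the three parts may use \<epsilon> / 3, and the last one is multiplied
    by k.\<close>
  define \<eta> where "\<eta> = \<epsilon> / (3 * real k)"
  have \<eta>: "0 < \<eta>" using \<epsilon> k_pos by (simp add: \<eta>_def)
  have D: "0 \<le> D" by (rule lp_le_nonneg[OF w])
  have "\<forall>\<^sub>F \<tau> in at_top. (real (k * k) * D) / sqrt \<tau> < \<epsilon> / 3"
    using \<epsilon> by (intro eventually_div_sqrt_less) simp
  moreover have "\<forall>\<^sub>F \<tau>::real in at_top. 0 < \<tau>" by (rule eventually_gt_at_top)
  ultimately have "\<forall>\<^sub>F \<tau> in at_top. 0 < \<tau> \<and> (real (k * k) * D) / sqrt \<tau> < \<epsilon> / 3 \<and>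
      lp_le p (\<lambda>j. pois_conv \<tau> 0 (\<lambda>j. w (j - 1)) j - v) \<eta>"
    using conv[OF \<eta>] by eventually_elim auto
  then obtain \<tau> where \<tau>: "0 < \<tau>" "(real (k * k) * D) / sqrt \<tau> < \<epsilon> / 3"
    and c: "lp_le p (\<lambda>j. pois_conv \<tau> 0 (\<lambda>j. w (j - 1)) j - v) \<eta>"
    by (auto dest: eventually_happens)
  let ?q = "\<lambda>l. pois \<tau> (k * l)" and ?P = "\<lambda>j. pois_conv \<tau> 0 (\<lambda>j. w (j - 1)) j"
  define m where "m = (\<Sum>l. ?q l)"
  have sq: "summable ?q" using pois_sampled_summable(1)[of \<tau> k 0] \<tau> k_pos by simp
  have mass: "\<bar>real k * m - 1\<bar> * D \<le> \<epsilon> / 3"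
    using mult_right_mono[OF pois_sampled_mass[OF \<tau>(1) k_pos] D] \<tau>(2)
    unfolding m_def times_divide_eq_left by linarith
  have "\<forall>\<^sub>F n in sequentially. (2 * real k * (\<tau> + 1) * D) / real n < \<epsilon> / 3"
    using \<epsilon> by (intro eventually_div_nat_less) simp
  moreover have "\<forall>\<^sub>F n::nat in sequentially. 1 \<le> n" by (rule eventually_ge_at_top)
  ultimately show ?thesis
  proof eventually_elim
    case (elim n)
    have wb: "norm (w j) \<le> D" for j by (rule lp_le_coord[OF p w])
    have ws: "summable (\<lambda>l. ?q l *\<^sub>R w (j - 1 - int l))" for j
      using pois_conv_summable[of \<tau> w D 0 "j - 1"] wb \<tau> by simp
    have 1: "lp_le p (mean n (\<lambda>j. (1 - real k * m) *\<^sub>R w j)) (\<bar>real k * m - 1\<bar> * D)"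
      using lp_le_scaleR[OF p w, of "1 - real k * m"]
      by (intro mean_lp_le p elim) (simp add: abs_minus_commute)
    \<comment> \<open>The factor l + 1 is moved from the sequences to the coefficients, so that the
      sequences have the common bound 2 D / n.\<close>
    have 2: "lp_le p (\<lambda>j. \<Sum>l. (?q l * real (Suc l)) *\<^sub>R
        (1 / real (Suc l)) *\<^sub>R mean n (\<lambda>j. w j - w (j - int (Suc l))) j) ((\<tau> + 1) * (2 * D / real n))"
    proof (rule lp_le_suminf[OF p])
      fix l
      have "lp_le p (\<lambda>j. (1 / real (Suc l)) *\<^sub>R mean n (\<lambda>j. w j - w (j - int (Suc l))) j)
          (\<bar>1 / real (Suc l)\<bar> * (2 * real (Suc l) * D / real n))"
        by (rule lp_le_scaleR[OF p mean_shift_diff_lp_le[OF p w elim(2)]])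
      then show "lp_le p (\<lambda>j. (1 / real (Suc l)) *\<^sub>R mean n (\<lambda>j. w j - w (j - int (Suc l))) j) (2 * D / real n)"
        by (simp del: of_nat_Suc)
    next
      have "\<bar>?q l * real (Suc l)\<bar> = ?q l * real (Suc l)" for l
        using pois_nonneg[of \<tau>] \<tau> by simp
      then show "summable (\<lambda>l. \<bar>?q l * real (Suc l)\<bar>)" "(\<Sum>l. \<bar>?q l * real (Suc l)\<bar>) \<le> \<tau> + 1"
        using pois_sampled_moment[of \<tau> k] \<tau> k_pos by simp_all
    qed
    have 3: "lp_le p (mean n (\<lambda>j. real k *\<^sub>R (?P j - v))) (\<bar>real k\<bar> * \<eta>)"
      by (intro mean_lp_le p elim lp_le_scaleR c)
    have eq: "mean n w j - real k *\<^sub>R v = mean n (\<lambda>j. (1 - real k * m) *\<^sub>R w j) j +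
      real k *\<^sub>R (\<Sum>l. (?q l * real (Suc l)) *\<^sub>R (1 / real (Suc l)) *\<^sub>R mean n (\<lambda>j. w j - w (j - int (Suc l))) j) +
      mean n (\<lambda>j. real k *\<^sub>R (?P j - v)) j" for j
    proof -
      have "(\<Sum>l. (?q l * real (Suc l)) *\<^sub>R (1 / real (Suc l)) *\<^sub>R mean n (\<lambda>j. w j - w (j - int (Suc l))) j) =
          (\<Sum>l. ?q l *\<^sub>R mean n (\<lambda>j. w j - w (j - int (Suc l))) j)"
        by (simp del: of_nat_Suc)
      also have "\<dots> = (\<Sum>l. (1 / real n) *\<^sub>R (\<Sum>i=1..n. ?q l *\<^sub>R w (j - int i) - ?q l *\<^sub>R w (j - int i - 1 - int l)))"
        by (simp add: mean_def scaleR_sum_right scaleR_diff_right algebra_simps)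
      also have "\<dots> = (1 / real n) *\<^sub>R (\<Sum>l. \<Sum>i=1..n. ?q l *\<^sub>R w (j - int i) - ?q l *\<^sub>R w (j - int i - 1 - int l))"
        by (intro suminf_scaleR_right[symmetric] summable_sum summable_diff ws summable_scaleR_left sq)
      also have "\<dots> = (1 / real n) *\<^sub>R (\<Sum>i=1..n. \<Sum>l. ?q l *\<^sub>R w (j - int i) - ?q l *\<^sub>R w (j - int i - 1 - int l))"
        by (subst suminf_sum) (auto intro!: summable_diff ws summable_scaleR_left sq)
      also have "\<dots> = (1 / real n) *\<^sub>R (\<Sum>i=1..n. m *\<^sub>R w (j - int i) - ?P (j - int i))"
      proof -
        have "(\<Sum>l. ?q l *\<^sub>R w i - ?q l *\<^sub>R w (i - 1 - int l)) = m *\<^sub>R w i - ?P i" for i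
          using suminf_diff[OF summable_scaleR_left[OF sq, of "w i"] ws[of i]] suminf_scaleR_left[OF sq, of "w i"]
          by (simp add: m_def pois_conv_def algebra_simps)
        then show ?thesis by simp
      qed
      finally have e: "(\<Sum>l. (?q l * real (Suc l)) *\<^sub>R (1 / real (Suc l)) *\<^sub>R mean n (\<lambda>j. w j - w (j - int (Suc l))) j) =
          mean n (\<lambda>j. m *\<^sub>R w j - ?P j) j" by (simp add: mean_def)
      show ?thesis unfolding e using elim(2)
        by (simp add: mean_def sum.distrib sum_subtractf algebra_simps scaleR_sum_right sum_constant_scaleR)
    qed
    have le: "lp_le p (\<lambda>j. mean n (\<lambda>j. (1 - real k * m) *\<^sub>R w j) j +
      real k *\<^sub>R (\<Sum>l. (?q l * real (Suc l)) *\<^sub>R (1 / real (Suc l)) *\<^sub>R mean n (\<lambda>j. w j - w (j - int (Suc l))) j) +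
      mean n (\<lambda>j. real k *\<^sub>R (?P j - v)) j)
       (\<bar>real k * m - 1\<bar> * D + \<bar>real k\<bar> * ((\<tau> + 1) * (2 * D / real n)) + \<bar>real k\<bar> * \<eta>)"
      by (intro lp_le_add p 1 lp_le_scaleR 2 3)
    have "\<bar>real k * m - 1\<bar> * D + \<bar>real k\<bar> * ((\<tau> + 1) * (2 * D / real n)) + \<bar>real k\<bar> * \<eta> \<le> \<epsilon>"
    proof -
      have "\<bar>real k\<bar> * ((\<tau> + 1) * (2 * D / real n)) = (2 * real k * (\<tau> + 1) * D) / real n" by simp
      moreover have "\<bar>real k\<bar> * \<eta> = \<epsilon> / 3" using k_pos by (simp add: \<eta>_def)
      ultimately show ?thesis using mass elim(1) by linarith
    qed
    with le show ?case unfolding eq by (rule lp_le_mono)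
  qed
qed

text \<open>The average of w - S w tends to 0, so any limit is invariant under S, hence
  constant.\<close>

lemma pois_conv_limit_const:
  fixes w :: "int \<Rightarrow> 'b::banach"
  assumes p: "1 \<le> p" and w: "lp_le p w D"
    and conv: "\<And>\<epsilon>. 0 < \<epsilon> \<Longrightarrow> \<forall>\<^sub>F \<tau> in at_top. lp_le p (\<lambda>j. pois_conv \<tau> 0 w j - g j) \<epsilon>"
  shows "g j = g (j - 1)" and "((\<lambda>\<tau>. pois_conv \<tau> 0 w j) \<longlongrightarrow> g j) at_top"
proof -
  show lim: "((\<lambda>\<tau>. pois_conv \<tau> 0 w j) \<longlongrightarrow> g j) at_top" for j
  proof (rule tendstoI)
    fix \<epsilon> :: real assume "0 < \<epsilon>"
    then have "\<forall>\<^sub>F \<tau> in at_top. lp_le p (\<lambda>j. pois_conv \<tau> 0 w j - g j) (\<epsilon> / 2)" by (intro conv) simp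
    then show "\<forall>\<^sub>F \<tau> in at_top. dist (pois_conv \<tau> 0 w j) (g j) < \<epsilon>"
    proof eventually_elim
      case (elim \<tau>)
      from lp_le_coord[OF p this, of j] \<open>0 < \<epsilon>\<close> show ?case by (simp add: dist_norm)
    qed
  qed
  have "((\<lambda>\<tau>. real k * (D + D) / sqrt \<tau>) \<longlongrightarrow> 0) at_top"
    by (rule real_tendsto_divide_at_top[OF tendsto_const sqrt_at_top])
  moreover have "\<forall>\<^sub>F \<tau> in at_top. norm (pois_conv \<tau> 0 w j - pois_conv \<tau> 0 w (j - 1)) \<le> real k * (D + D) / sqrt \<tau>"
    using eventually_gt_at_top[of "0::real"]
  proof eventually_elim
    case (elim \<tau>)
    have "pois_conv \<tau> 0 (\<lambda>j. w j - w (j - 1)) j = pois_conv \<tau> 0 w j - pois_conv \<tau> 0 (\<lambda>j. w (j - 1)) j"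
      using elim lp_le_coord[OF p w] by (intro pois_conv_diff) auto
    also have "pois_conv \<tau> 0 (\<lambda>j. w (j - 1)) j = pois_conv \<tau> 0 w (j - 1)"
      by (simp add: pois_conv_def algebra_simps)
    finally show ?case
      using lp_le_coord[OF p pois_conv_difference_lp_le[OF p elim w], of j] by simp
  qed
  ultimately have "((\<lambda>\<tau>. pois_conv \<tau> 0 w j - pois_conv \<tau> 0 w (j - 1)) \<longlongrightarrow> 0) at_top"
    by (rule Lim_null_comparison[rotated])
  moreover have "((\<lambda>\<tau>. pois_conv \<tau> 0 w j - pois_conv \<tau> 0 w (j - 1)) \<longlongrightarrow> g j - g (j - 1)) at_top"
    by (intro tendsto_diff lim)
  ultimately show "g j = g (j - 1)" using tendsto_unique[OF trivial_limit_at_top_linorder] by fastforce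
qed

end

section \<open>Leading term of the solutions and lower bounds\<close>

text \<open>m coordinates of size \<alpha> m^(-1/p) already have norm \<alpha>. This makes the lower
  bounds independent of the number of coordinates at each scale.\<close>

lemma lp_le_card:
  assumes p: "1 \<le> p" and f: "lp_le p f C" and I: "finite I" "real m \<le> real (card I)" "1 \<le> m"
    and le: "\<And>i. i \<in> I \<Longrightarrow> \<alpha> * (if p = \<infinity> then 1 else real m powr (- (1 / enn2real p))) \<le> norm (f i)"
    and \<alpha>: "0 \<le> \<alpha>"
  shows "\<alpha> \<le> C"
proof (cases "p = \<infinity>")
  case True
  obtain i where "i \<in> I" using I by fastforce
  from le[OF this] True lp_le_coord[OF p f, of i] show ?thesis by simp
next
  case False
  define q where "q = enn2real p"
  have q: "1 \<le> q" using enn2real_ge_1[OF p False] by (simp add: q_def)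
  have C: "0 \<le> C" by (rule lp_le_nonneg[OF f])
  have "(real m powr (- (1 / q))) powr q = 1 / real m"
    using I q unfolding powr_powr by (simp add: powr_minus_divide)
  then have "\<alpha> powr q = real m * (\<alpha> * real m powr (- (1 / q))) powr q"
    using I \<alpha> by (simp add: powr_mult)
  also have "\<dots> \<le> real (card I) * (\<alpha> * real m powr (- (1 / q))) powr q"
    using I by (intro mult_right_mono) auto
  also have "\<dots> = (\<Sum>i\<in>I. (\<alpha> * real m powr (- (1 / q))) powr q)" by simp
  also have "\<dots> \<le> (\<Sum>i\<in>I. norm (f i) powr q)"
    using le False \<alpha> q by (intro sum_mono powr_mono2) (auto simp: q_def)
  also have "\<dots> \<le> C powr q" using f False I by (simp add: lp_le_def q_def)
  finally show ?thesis using powr_le_powr_iff[OF \<alpha> C] q by simp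
qed

text \<open>The \<open>p\<close>-th powers of the normalized indicators are superposed, instead of the indicators
  themselves, so that the norm of the profile is a double sum of nonnegative terms.\<close>

lemma lp_profile_exists:
  fixes M :: "nat \<Rightarrow> nat"
  assumes p: "1 \<le> p" and M: "\<And>n. 1 \<le> M n"
  shows "\<exists>(v :: int \<Rightarrow> real) D. (\<forall>j. 0 \<le> v j) \<and> (\<forall>j<0. v j = 0) \<and> lp_le p v D \<and>
    (\<forall>n j. 0 \<le> j \<and> j \<le> 4 * int (M n) \<longrightarrow>
      (1 / 2) ^ n * (if p = \<infinity> then 1 else real (M n) powr (- (1 / enn2real p))) \<le> v j)"
proof (cases "p = \<infinity>")
  case True
  have "lp_le p (\<lambda>j::int. if j < 0 then 0 else 1 :: real) 1" using True by (simp add: lp_le_def)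
  moreover have "(1 / 2) ^ n \<le> (1::real)" for n by (simp add: power_le_one)
  ultimately show ?thesis using True
    by (intro exI[of _ "\<lambda>j::int. if j < 0 then 0 else 1 :: real"] exI[of _ 1]) auto
next
  case False
  define q where "q = enn2real p"
  have q: "1 \<le> q" using enn2real_ge_1[OF p False] by (simp add: q_def)
  \<comment> \<open>The n-th interval has 4 M + 1 <= 5 M points of height 2^(-n) / M, so it
    contributes at most 5 * 2^(-n) and all of them at most 10.\<close>
  define c where "c n j = (if 0 \<le> j \<and> j \<le> 4 * int (M n) then (1 / 2) ^ n / real (M n) else 0)" for n and j :: int
  define s where "s j = (\<Sum>n. c n j)" for j
  have c0: "0 \<le> c n j" for n j by (simp add: c_def)
  have cle: "c n j \<le> (1 / 2) ^ n" for n j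
    using M[of n] by (simp add: c_def divide_le_eq mult_left_le)
  have geo: "summable (\<lambda>n. (1 / 2 :: real) ^ n)" by simp
  have sc: "summable (\<lambda>n. c n j)" for j
    by (rule summable_comparison_test'[OF geo]) (use c0 cle in auto)
  have s0: "0 \<le> s j" for j unfolding s_def by (intro suminf_nonneg sc c0)
  have fin: "(\<Sum>j\<in>F. s j) \<le> 10" if F: "finite F" for F
  proof -
    have "(\<Sum>j\<in>F. s j) = (\<Sum>n. \<Sum>j\<in>F. c n j)"
      unfolding s_def by (rule suminf_sum[symmetric]) (rule sc)
    also have "\<dots> \<le> (\<Sum>n. 5 * (1 / 2) ^ n)"
    proof (rule suminf_le)
      fix n
      have "(\<Sum>j\<in>F. c n j) = (\<Sum>j\<in>F \<inter> {0..4 * int (M n)}. (1 / 2) ^ n / real (M n))"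
        using F by (intro sum.mono_neutral_cong_right) (auto simp: c_def)
      also have "\<dots> = real (card (F \<inter> {0..4 * int (M n)})) * ((1 / 2) ^ n / real (M n))" by simp
      also have "\<dots> \<le> (5 * real (M n)) * ((1 / 2) ^ n / real (M n))"
      proof (rule mult_right_mono)
        have "card (F \<inter> {0..4 * int (M n)}) \<le> card {0..4 * int (M n)}" by (intro card_mono) auto
        then show "real (card (F \<inter> {0..4 * int (M n)})) \<le> 5 * real (M n)" using M[of n] by simp
      qed simp
      finally show "(\<Sum>j\<in>F. c n j) \<le> 5 * (1 / 2) ^ n" using M[of n] by simp
    qed (auto intro!: summable_sum sc summable_mult)
    also have "\<dots> = 10" using suminf_mult[OF geo, of 5] suminf_geometric[of "1/2 :: real"] by simp
    finally show ?thesis .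
  qed
  define v where "v j = s j powr (1 / q)" for j
  have vq: "norm (v j) powr q = s j" for j using q s0 by (simp add: v_def powr_powr)
  have "lp_le p v (10 powr (1 / q))"
    using False fin q by (simp add: lp_le_def q_def[symmetric] vq[simplified] powr_powr)
  moreover have "v j = 0" if "j < 0" for j
    using that by (simp add: v_def s_def c_def)
  moreover have "(1 / 2) ^ n * real (M n) powr (- (1 / q)) \<le> v j" if j: "0 \<le> j" "j \<le> 4 * int (M n)" for n j
  proof -
    have "(1 / 2) ^ n / real (M n) = c n j" using j by (simp add: c_def)
    also have "\<dots> \<le> s j" unfolding s_def using sum_le_suminf[OF sc, of "{n}" j] c0 by auto
    finally have "((1 / 2) ^ n / real (M n)) powr (1 / q) \<le> v j"
      unfolding v_def using q by (intro powr_mono2) auto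
    \<comment> \<open>The root turns the amplitude 2^(-n) into 2^(-n/q), which is at least 2^(-n) as
      q >= 1.\<close>
    moreover have "((1 / 2) ^ n :: real) powr 1 \<le> ((1 / 2) ^ n) powr (1 / q)"
      using q by (intro powr_mono') (auto simp: power_le_one)
    then have "(1 / 2) ^ n * real (M n) powr (- (1 / q)) \<le> ((1 / 2) ^ n / real (M n)) powr (1 / q)"
      using M[of n] by (simp add: powr_divide powr_minus_divide divide_right_mono)
    ultimately show ?thesis by linarith
  qed
  moreover have "0 \<le> v j" for j by (simp add: v_def)
  ultimately show ?thesis using False by (auto simp: q_def)
qed

context delay_chain
begin

text \<open>With \<open>A\<^sub>0 = N - \<zeta>\<close>, \<open>R0\<close> is the inverse of \<open>A\<^sub>0\<close> and \<open>M0\<close> is \<open>A\<^sub>1 A\<^sub>0\<^sup>-\<^sup>1\<close>.\<close>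

definition R0 :: "'a \<Rightarrow> 'a" where
  "R0 v = - (\<Sum>i<d. (1 / \<zeta>) ^ Suc i *\<^sub>R (N ^^ i) v)"

definition M0 :: "'a \<Rightarrow> 'a" where "M0 v = A (R0 v)"

lemma bounded_linear_R0: "bounded_linear R0"
  unfolding R0_def[abs_def]
  by (intro bounded_linear_minus bounded_linear_sum bounded_linear_pow
      bounded_linear_compose[OF bounded_linear_scaleR_right])

lemma bounded_linear_M0: "bounded_linear M0"
  unfolding M0_def[abs_def] by (rule bounded_linear_compose[OF A bounded_linear_R0])

sublocale R0: bounded_linear R0 by (rule bounded_linear_R0)
sublocale M0: bounded_linear M0 by (rule bounded_linear_M0)

lemma R0_inverse: "N (R0 v) - \<zeta> *\<^sub>R R0 v = v"
proof -
  have "N (R0 v) - \<zeta> *\<^sub>R R0 v =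
      (\<Sum>i<d. (1 / \<zeta>) ^ i *\<^sub>R (N ^^ i) v - (1 / \<zeta>) ^ Suc i *\<^sub>R (N ^^ Suc i) v)"
    using zeta_pos
    by (simp add: R0_def N.neg N.sum N.scaleR scaleR_sum_right sum_subtractf)
  also have "\<dots> = v" by (subst sum_lessThan_telescope') (simp add: nilpotent)
  finally show ?thesis .
qed

text \<open>The resolvent identity at \<lambda> = 0, where \<phi>_A = 1 and R(0, A_0) =
  -A_0^(-1).\<close>

lemma M0_A: "M0 (A v) = - A v"
proof -
  have "M0 (A v) = - (\<Sum>i<d. if i = k - 1 then A v else 0)"
    unfolding M0_def R0_def A.neg A.sum A.scaleR compress neg_equal_iff_equal
    using k_pos zeta_pos by (intro sum.cong) (auto simp: power_one_over)
  then show ?thesis using k_pos k_le_d by auto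
qed

lemma A_pow_add_A: "A ((N ^^ i) ((N ^^ l) (A v))) = (if Suc (i + l) = k then \<zeta> ^ k *\<^sub>R A v else 0)"
  using compress[of "i + l" v] by (simp add: funpow_add)

text \<open>The derivative of the resolvent identity at 0: A_1 A_0^(-2) A_1 = -\<phi>_A'(0) A_1. In
  coefficients, k pairs satisfy i + l = k - 1 and each gives 1/\<zeta>. It determines L.\<close>

lemma M0_R0_A: "M0 (R0 (A v)) = (real k / \<zeta>) *\<^sub>R A v"
proof -
  have "M0 (R0 (A v)) = (\<Sum>i<d. \<Sum>l<d. ((1 / \<zeta>) ^ Suc i * (1 / \<zeta>) ^ Suc l) *\<^sub>R
      (if Suc (i + l) = k then \<zeta> ^ k *\<^sub>R A v else 0))"
    unfolding M0_def R0_def Npow.neg Npow.sum Npow.scaleR A.neg A.sum A.scaleR A_pow_add_A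
    by (simp add: sum_negf scaleR_sum_right)
  also have "\<dots> = (\<Sum>i<d. if i < k then (1 / \<zeta>) *\<^sub>R A v else 0)"
  proof (intro sum.cong refl)
    fix i
    have "(\<Sum>l<d. ((1 / \<zeta>) ^ Suc i * (1 / \<zeta>) ^ Suc l) *\<^sub>R (if Suc (i + l) = k then \<zeta> ^ k *\<^sub>R A v else 0)) =
        (\<Sum>l<d. if l = k - Suc i then (if i < k then (1 / \<zeta>) *\<^sub>R A v else 0) else 0)"
    proof (intro sum.cong refl)
      fix l
      have "(1 / \<zeta>) ^ Suc i * (1 / \<zeta>) ^ Suc l * \<zeta> ^ Suc (i + l) = 1 / \<zeta>"
        using zeta_pos by (simp add: power_add power_one_over field_simps)
      then show "((1 / \<zeta>) ^ Suc i * (1 / \<zeta>) ^ Suc l) *\<^sub>R (if Suc (i + l) = k then \<zeta> ^ k *\<^sub>R A v else 0) =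
          (if l = k - Suc i then (if i < k then (1 / \<zeta>) *\<^sub>R A v else 0) else 0)"
        by auto
    qed
    then show "(\<Sum>l<d. ((1 / \<zeta>) ^ Suc i * (1 / \<zeta>) ^ Suc l) *\<^sub>R (if Suc (i + l) = k then \<zeta> ^ k *\<^sub>R A v else 0)) =
        (if i < k then (1 / \<zeta>) *\<^sub>R A v else 0)"
      using k_le_d k_pos by auto
  qed
  also have "\<dots> = (\<Sum>i<k. (1 / \<zeta>) *\<^sub>R A v)"
    using k_le_d by (intro sum.mono_neutral_cong_right) auto
  finally show ?thesis by (simp add: sum_constant_scaleR)
qed

text \<open>The double sum of \<open>solution_formula\<close> with all averages replaced by the same
  vector. This is how the leading term is recognized as \<zeta> A_0^(-1) M applied to an
  average.\<close>

lemma R0_A_R0: "\<zeta> *\<^sub>R R0 (M0 v) =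
    (\<Sum>a<d. \<Sum>b<d. (1 / \<zeta>) ^ (a + b + 1) *\<^sub>R (N ^^ a) (A ((N ^^ b) v)))"
proof -
  have "\<zeta> *\<^sub>R R0 (M0 v) = (\<Sum>a<d. \<Sum>b<d. (\<zeta> * (1 / \<zeta>) ^ Suc a * (1 / \<zeta>) ^ Suc b) *\<^sub>R (N ^^ a) (A ((N ^^ b) v)))"
    unfolding M0_def R0_def Npow.neg Npow.sum Npow.scaleR A.neg A.sum A.scaleR
    by (simp only: sum_negf scaleR_sum_right scaleR_minus_right minus_minus scaleR_scaleR mult.assoc)
  also have "\<dots> = (\<Sum>a<d. \<Sum>b<d. (1 / \<zeta>) ^ (a + b + 1) *\<^sub>R (N ^^ a) (A ((N ^^ b) v)))"
    using zeta_pos by (intro sum.cong refl arg_cong2[of _ _ _ _ scaleR]) (simp add: power_add)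
  finally show ?thesis .
qed

text \<open>The Taylor series for \<zeta> + A replaces the differential equation. Solutions and
  their derivatives both satisfy it, so every estimate is available for both.\<close>

definition is_solution :: "(real \<Rightarrow> int \<Rightarrow> 'a) \<Rightarrow> bool" where
  "is_solution u \<longleftrightarrow> (\<forall>t\<ge>0. \<forall>j. (\<lambda>n. (t ^ n / fact n) *\<^sub>R (B ^^ n) (u 0) j) sums (exp (\<zeta> * t) *\<^sub>R u t j))"

abbreviation leading :: "(int \<Rightarrow> 'a) \<Rightarrow> real \<Rightarrow> int \<Rightarrow> 'a" where
  "leading y \<tau> j \<equiv> \<zeta> *\<^sub>R R0 (pois_conv \<tau> 0 (\<lambda>j. M0 (y (j - 1))) j)"

text \<open>Two kinds of error: the weights at the fixed indices n < d, and the replacement of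
  G_(a+b+1) by G_0 at a cost of (a + b + 1) / sqrt \<tau>. The constant depends neither on the
  solution nor on t.\<close>

lemma solution_approx:
  assumes p: "1 \<le> p"
  shows "\<exists>E\<ge>0. \<forall>u D t. is_solution u \<longrightarrow> lp_le p (u 0) D \<longrightarrow> 1 \<le> \<zeta> * t \<longrightarrow>
    lp_le p (\<lambda>j. u t j - leading (u 0) (\<zeta> * t) j) (E * D / sqrt (\<zeta> * t))"
proof -
  let ?L = "\<lambda>a b v. (N ^^ a) (A ((N ^^ b) v))"
  have L: "bounded_linear (?L a b)" for a b
    using bounded_linear_compose[OF bounded_linear_pow bounded_linear_compose[OF A bounded_linear_pow]] .
  define E where "E = (\<Sum>n<d. (1 / \<zeta>) ^ n * real (Suc n) * onorm (N ^^ n)) +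
    (\<Sum>a<d. \<Sum>b<d. (1 / \<zeta>) ^ (a + b + 1) * (onorm (?L a b) * real (a + b + 1)))"
  have E: "0 \<le> E"
    unfolding E_def using zeta_pos
    by (intro add_nonneg_nonneg sum_nonneg mult_nonneg_nonneg zero_le_power onorm_pos_le bounded_linear_pow L) auto
  have "lp_le p (\<lambda>j. u t j - leading (u 0) (\<zeta> * t) j) (E * D / sqrt (\<zeta> * t))"
    if sol: "is_solution u" and D: "lp_le p (u 0) D" and t: "1 \<le> \<zeta> * t" for u D t
  proof -
    let ?\<tau> = "\<zeta> * t" and ?x = "\<lambda>j. u 0 (j - 1)"
    have \<tau>: "0 < ?\<tau>" using t by linarith
    have t0: "0 \<le> t" using \<tau> zeta_pos by (simp add: zero_less_mult_iff)
    have xb: "norm (u 0 j) \<le> D" for j by (rule lp_le_coord[OF p D])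
    have eq: "u t j - \<zeta> *\<^sub>R R0 (pois_conv ?\<tau> 0 (\<lambda>j. M0 (?x j)) j) =
        (\<Sum>n<d. ((1 / \<zeta>) ^ n * pois ?\<tau> n) *\<^sub>R (N ^^ n) (u 0 j)) +
        (\<Sum>a<d. \<Sum>b<d. (1 / \<zeta>) ^ (a + b + 1) *\<^sub>R
          ?L a b (pois_conv ?\<tau> (a + b + 1) ?x j - pois_conv ?\<tau> 0 ?x j))" for j
    proof -
      have "pois_conv ?\<tau> 0 (\<lambda>j. M0 (?x j)) j = M0 (pois_conv ?\<tau> 0 ?x j)"
        by (rule pois_conv_linear[OF _ xb bounded_linear_M0]) (use \<tau> in simp)
      then show ?thesis
        using solution_formula[where x = "u 0" and j = j and w = "u t j", OF t0 xb] sol t0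
        unfolding is_solution_def
        by (simp add: R0_A_R0 Npow.diff A.diff scaleR_diff_right sum_subtractf)
    qed
    have 1: "lp_le p (\<lambda>j. \<Sum>n<d. ((1 / \<zeta>) ^ n * pois ?\<tau> n) *\<^sub>R (N ^^ n) (u 0 j))
        (\<Sum>n<d. (1 / \<zeta>) ^ n * (real (Suc n) / sqrt ?\<tau>) * (onorm (N ^^ n) * D))"
    proof (intro lp_le_sum p finite_lessThan)
      fix n
      have "lp_le p (\<lambda>j. ((1 / \<zeta>) ^ n * pois ?\<tau> n) *\<^sub>R (N ^^ n) (u 0 j))
          (\<bar>(1 / \<zeta>) ^ n * pois ?\<tau> n\<bar> * (onorm (N ^^ n) * D))"
        by (intro lp_le_scaleR lp_le_bounded_linear p D bounded_linear_pow)
      moreover have "\<bar>(1 / \<zeta>) ^ n * pois ?\<tau> n\<bar> = (1 / \<zeta>) ^ n * pois ?\<tau> n"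
        using pois_nonneg[of ?\<tau> n] zeta_pos \<tau> by simp
      then have "\<bar>(1 / \<zeta>) ^ n * pois ?\<tau> n\<bar> \<le> (1 / \<zeta>) ^ n * (real (Suc n) / sqrt ?\<tau>)"
        using mult_left_mono[OF pois_le_inverse_sqrt[OF t, of n], of "(1 / \<zeta>) ^ n"] zeta_pos
        by (simp only: zero_le_power zero_le_divide_1_iff less_imp_le)
      ultimately show "lp_le p (\<lambda>j. ((1 / \<zeta>) ^ n * pois ?\<tau> n) *\<^sub>R (N ^^ n) (u 0 j))
          ((1 / \<zeta>) ^ n * (real (Suc n) / sqrt ?\<tau>) * (onorm (N ^^ n) * D))"
        using lp_le_nonneg[OF D] onorm_pos_le[OF bounded_linear_pow]
        by (elim lp_le_mono) (intro mult_right_mono mult_nonneg_nonneg)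
    qed
    have 2: "lp_le p (\<lambda>j. \<Sum>a<d. \<Sum>b<d. (1 / \<zeta>) ^ (a + b + 1) *\<^sub>R
          ?L a b (pois_conv ?\<tau> (a + b + 1) ?x j - pois_conv ?\<tau> 0 ?x j))
        (\<Sum>a<d. \<Sum>b<d. \<bar>(1 / \<zeta>) ^ (a + b + 1)\<bar> * (onorm (?L a b) * (real (a + b + 1) / sqrt ?\<tau> * D)))"
      by (intro lp_le_sum p finite_lessThan lp_le_scaleR lp_le_bounded_linear L pois_conv_diff_lp_le \<tau> lp_le_shift D)
    have "(\<Sum>n<d. (1 / \<zeta>) ^ n * (real (Suc n) / sqrt ?\<tau>) * (onorm (N ^^ n) * D)) +
       (\<Sum>a<d. \<Sum>b<d. \<bar>(1 / \<zeta>) ^ (a + b + 1)\<bar> * (onorm (?L a b) * (real (a + b + 1) / sqrt ?\<tau> * D)))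
       = E * D / sqrt ?\<tau>"
    proof -
      have "E * D / sqrt ?\<tau> = E * (D / sqrt ?\<tau>)" by simp
      also have "\<dots> = (\<Sum>n<d. (1 / \<zeta>) ^ n * real (Suc n) * onorm (N ^^ n) * (D / sqrt ?\<tau>)) +
        (\<Sum>a<d. \<Sum>b<d. (1 / \<zeta>) ^ (a + b + 1) * (onorm (?L a b) * real (a + b + 1)) * (D / sqrt ?\<tau>))"
        by (simp only: E_def distrib_right sum_distrib_right)
      finally show ?thesis using zeta_pos by (simp add: mult_ac del: of_nat_Suc)
    qed
    then show ?thesis unfolding eq using lp_le_add[OF p 1 2] by (simp only:)
  qed
  then show ?thesis using E by blast
qed

text \<open>Since \<open>A\<^sub>1 A\<^sub>0\<^sup>-\<^sup>1 A\<^sub>1 = - A\<^sub>1\<close>, the generator turns the leading term of a solution into a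
  difference.\<close>

lemma solution_derivative_lp_le:
  assumes p: "1 \<le> p"
  shows "\<exists>E. \<forall>u D t. is_solution u \<longrightarrow> lp_le p (u 0) D \<longrightarrow> 1 \<le> \<zeta> * t \<longrightarrow>
    lp_le p (delay_op (\<lambda>v. N v - \<zeta> *\<^sub>R v) A (u t)) (E * D / sqrt (\<zeta> * t))"
proof -
  obtain E where E: "\<And>u D t. is_solution u \<Longrightarrow> lp_le p (u 0) D \<Longrightarrow> 1 \<le> \<zeta> * t \<Longrightarrow>
    lp_le p (\<lambda>j. u t j - leading (u 0) (\<zeta> * t) j) (E * D / sqrt (\<zeta> * t))"
    using solution_approx[OF p] by blast
  let ?F = "\<lambda>v. N v - \<zeta> *\<^sub>R v"
  have F: "bounded_linear ?F"
    by (intro bounded_linear_sub N bounded_linear_scaleR_right)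
  interpret F: bounded_linear ?F by (rule F)
  define K where "K = \<zeta> * (real k * (2 * onorm M0)) + onorm ?F * E + onorm A * E"
  have "lp_le p (delay_op ?F A (u t)) (K * D / sqrt (\<zeta> * t))"
    if sol: "is_solution u" and D: "lp_le p (u 0) D" and t: "1 \<le> \<zeta> * t" for u D t
  proof -
    let ?\<tau> = "\<zeta> * t"
    define e where "e j = u t j - \<zeta> *\<^sub>R R0 (pois_conv ?\<tau> 0 (\<lambda>j. M0 (u 0 (j - 1))) j)" for j
    define g where "g j = pois_conv ?\<tau> 0 (\<lambda>j. M0 (u 0 (j - 1))) j" for j
    have \<tau>: "0 < ?\<tau>" using t by linarith
    have e: "lp_le p e (E * D / sqrt ?\<tau>)" unfolding e_def[abs_def] by (rule E[OF sol D t])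
    have w: "lp_le p (\<lambda>j. M0 (u 0 (j - 1))) (onorm M0 * D)"
      by (intro lp_le_bounded_linear lp_le_shift p D bounded_linear_M0)
    have wb: "norm (M0 (u 0 i)) \<le> onorm M0 * D" for i using lp_le_coord[OF p w, of "i + 1"] by simp
    have xb: "norm (u 0 j) \<le> D" for j by (rule lp_le_coord[OF p D])
    have gM: "g j = M0 (pois_conv ?\<tau> 0 (\<lambda>j. u 0 (j - 1)) j)" for j
      unfolding g_def by (rule pois_conv_linear[OF _ xb bounded_linear_M0]) (use \<tau> in simp)
    \<comment> \<open>The average of values of M is again a value of M, hence in the range of A_1,
      where A_1 A_0^(-1) is -1.\<close>
    have AR: "A (R0 (g j)) = - g j" for j
      unfolding gM using M0_A[of "R0 (pois_conv ?\<tau> 0 (\<lambda>j. u 0 (j - 1)) j)"] by (simp add: M0_def)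
    have g1: "pois_conv ?\<tau> 0 (\<lambda>j. M0 (u 0 (j - 1)) - M0 (u 0 (j - 1 - 1))) j = g j - g (j - 1)" for j
    proof -
      have "pois_conv ?\<tau> 0 (\<lambda>j. M0 (u 0 (j - 1)) - M0 (u 0 (j - 1 - 1))) j =
        g j - pois_conv ?\<tau> 0 (\<lambda>j. M0 (u 0 (j - 1 - 1))) j"
        unfolding g_def using wb \<tau>
        by (intro pois_conv_diff[where C = "onorm M0 * D" and D = "onorm M0 * D"]) auto
      then show ?thesis by (simp add: g_def pois_conv_def algebra_simps)
    qed
    have "delay_op ?F A (u t) j = \<zeta> *\<^sub>R (g j - g (j - 1)) + ?F (e j) + A (e (j - 1))" for j
    proof -
      have ue: "u t j = \<zeta> *\<^sub>R R0 (g j) + e j" for j by (simp add: e_def g_def)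
      have "?F (u t j) = \<zeta> *\<^sub>R g j + ?F (e j)"
        unfolding ue F.add F.scaleR R0_inverse ..
      moreover have "A (u t (j - 1)) = \<zeta> *\<^sub>R (- g (j - 1)) + A (e (j - 1))"
        unfolding ue A.add A.scaleR AR ..
      ultimately show ?thesis by (simp add: delay_op_def algebra_simps)
    qed
    moreover have "lp_le p (\<lambda>j. \<zeta> *\<^sub>R (g j - g (j - 1)) + ?F (e j) + A (e (j - 1)))
        (\<bar>\<zeta>\<bar> * (real k / sqrt ?\<tau> * (onorm M0 * D + onorm M0 * D)) + onorm ?F * (E * D / sqrt ?\<tau>) + onorm A * (E * D / sqrt ?\<tau>))"
      unfolding g1[symmetric]
      by (intro lp_le_add lp_le_scaleR lp_le_bounded_linear lp_le_shift p e F A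
          pois_conv_difference_lp_le[OF p \<tau> w])
    moreover have "\<bar>\<zeta>\<bar> * (real k / sqrt ?\<tau> * (onorm M0 * D + onorm M0 * D)) + onorm ?F * (E * D / sqrt ?\<tau>) + onorm A * (E * D / sqrt ?\<tau>)
        = K * D / sqrt ?\<tau>"
      using zeta_pos by (simp add: K_def algebra_simps add_divide_distrib)
    ultimately show ?thesis by (simp only: delay_op_def)
  qed
  then show ?thesis by blast
qed

text \<open>Below the mode of the Poisson weights their differences are nonnegative, so nothing cancels.\<close>

lemma pois_conv_difference_lower:
  fixes v :: "int \<Rightarrow> real" and M :: nat
  defines "s \<equiv> 8 * k * M" and "P \<equiv> 64 * k * M\<^sup>2"
  assumes M: "1 \<le> M" and v: "\<And>j. 0 \<le> v j" and v0: "\<And>j. j < 0 \<Longrightarrow> v j = 0"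
    and h: "\<And>j. 0 \<le> j \<Longrightarrow> j \<le> 4 * int M \<Longrightarrow> h \<le> v j" and h0: "0 \<le> h"
    and I: "P - 2 * M \<le> I" "I \<le> P - M"
  shows "h / (160 * real k * real s) \<le> pois_conv ((real s)\<^sup>2) (k - 1) (\<lambda>j. v j - v (j - 1)) (int I)"
proof -
  \<comment> \<open>As \<tau> = k P, the sampled weights peak near l = P, and their deviation
    measured in l is s / k = 8 M. The position I lies M to 2 M below P, so every l < I is below the
    mode.\<close>
  define \<tau> where "\<tau> = (real s)\<^sup>2"
  let ?q = "\<lambda>l. pois \<tau> (k - 1 + k * l)"
  have s1: "1 \<le> s" using M k_pos by (simp add: s_def)
  have sP: "s\<^sup>2 = k * P" by (simp add: s_def P_def power_mult_distrib power2_eq_square)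
  have \<tau>: "0 < \<tau>" "\<tau> = real (k * P)" using s1 by (auto simp: \<tau>_def sP[symmetric])
  have PM: "64 * M \<le> P"
    using M k_pos mult_le_mono[of 1 k "M * 1" "M * M"] by (simp add: P_def power2_eq_square)
  have I1: "1 \<le> I" "I \<le> P" using I PM M by auto
  have conv: "pois_conv \<tau> (k - 1) (\<lambda>j. v j - v (j - 1)) (int I) =
      ?q 0 * v (int I) + (\<Sum>l<I. (?q (Suc l) - ?q l) * v (int I - 1 - int l))"
  proof -
    have "pois_conv \<tau> (k - 1) (\<lambda>j. v j - v (j - 1)) (int I) =
        (\<Sum>l<Suc I. ?q l * (v (int I - int l) - v (int I - int l - 1)))"
      unfolding pois_conv_def real_scaleR_def by (rule suminf_finite) (auto simp: v0)
    also have "\<dots> = (\<Sum>l<Suc I. ?q l * v (int I - int l)) - (\<Sum>l<Suc I. ?q l * v (int I - int l - 1))"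
      by (simp only: right_diff_distrib sum_subtractf)
    also have "(\<Sum>l<Suc I. ?q l * v (int I - int l)) =
        ?q 0 * v (int I) + (\<Sum>l<I. ?q (Suc l) * v (int I - 1 - int l))"
      by (subst sum.lessThan_Suc_shift) (simp add: algebra_simps)
    also have "(\<Sum>l<Suc I. ?q l * v (int I - int l - 1)) = (\<Sum>l<I. ?q l * v (int I - 1 - int l))"
      by (simp add: v0 algebra_simps)
    finally show ?thesis by (simp add: sum_subtractf left_diff_distrib)
  qed
  have nn: "0 \<le> ?q (Suc l) - ?q l" if "l < P" "Suc l < P" for l
  proof -
    have "k * Suc (Suc l) \<le> k * P" using that by (intro mult_le_mono2) simp
    then have "real (k - 1 + k * Suc l) \<le> \<tau>" unfolding \<tau>(2) of_nat_le_iff by simp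
    then show ?thesis using pois_mono_below_mode[of "k - 1 + k * l" "k - 1 + k * Suc l" \<tau>] \<tau> by simp
  qed
  define a where "a = k * M"
  have sa: "s = 8 * a" by (simp add: s_def a_def)
  \<comment> \<open>For l = P - 1 - r, the upper sample lies m = k (r - 1) + 1 below the mode, and r
    from 2 M + 1 to 4 M means s / 4 <= m <= s / 2. At the same time I - 1 - l = I - P + r lies in
    [1, 3 M], where the profile is at least h.\<close>
  define W where "W = (\<lambda>r. P - Suc r) ` {2 * M + 1..4 * M}"
  have inj: "inj_on (\<lambda>r. P - Suc r) {2 * M + 1..4 * M}" using PM M by (auto simp: inj_on_def)
  have big: "1 / (40 * \<tau>) \<le> ?q (Suc (P - Suc r)) - ?q (P - Suc r)" if r: "2 * M + 1 \<le> r" "r \<le> 4 * M" for r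
  proof -
    define x where "x = k * (r - 1)"
    define m where "m = x + 1"
    have xr: "x + k = k * r" using r by (cases r) (auto simp: x_def)
    have rP: "Suc (P - Suc r) = P - r" using r PM M by simp
    have kr: "k * r \<le> k * P" using r PM by simp
    have "k - 1 + k * (P - r) = s\<^sup>2 - m"
    proof -
      have "k - 1 + (k * P - (x + k)) = k * P - (x + 1)" using kr k_pos unfolding xr[symmetric] by linarith
      then show ?thesis by (simp only: sP m_def right_diff_distrib' xr)
    qed
    moreover have "real s \<le> 4 * real m"
    proof -
      have "2 * M \<le> r - 1" using r by linarith
      from mult_le_mono2[OF this, of k] have "2 * a \<le> x" by (simp only: a_def x_def mult.left_commute)
      then have "s \<le> 4 * m" unfolding sa m_def by simp
      then show ?thesis by linarith
    qed
    moreover have "2 * real m \<le> real s"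
    proof -
      have "k * r \<le> 4 * a" using r mult_le_mono2[of r "4 * M" k] by (simp add: a_def)
      moreover have "x + 1 \<le> k * r" unfolding xr[symmetric] using k_pos by simp
      ultimately have "x + 1 \<le> 4 * a" by (rule order_trans[rotated])
      then have "2 * m \<le> s" unfolding sa m_def by simp
      then show ?thesis by linarith
    qed
    ultimately have "1 / (40 * \<tau>) \<le> pois_diff \<tau> (k - 1 + k * (P - r))"
      using pois_diff_lower[OF s1] unfolding \<tau>_def by metis
    also have "\<dots> = ?q (P - r) - pois \<tau> (k - 1 + k * (P - r) - 1)"
    proof -
      have "1 \<le> k * (P - r)" using k_pos rP by (metis One_nat_def Suc_leI nat_0_less_mult_iff zero_less_Suc)
      then have "0 < k - 1 + k * (P - r)" by linarith
      then show ?thesis using pois_diff_Suc[OF \<tau>(1)] by (metis Suc_pred')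
    qed
    \<comment> \<open>Of the k unit increments between two samples only the last is estimated; the
      others are nonnegative.\<close>
    also have "\<dots> \<le> ?q (P - r) - ?q (P - Suc r)"
    proof -
      have e: "k * (P - r) = k * (P - Suc r) + k" unfolding rP[symmetric] by simp
      have "Suc (P - r) \<le> P" using r PM M by simp
      from mult_le_mono2[OF this, of k] have "k + k * (P - r) \<le> k * P" by simp
      then have "k - 1 + k * (P - r) - 1 \<le> k * P" by linarith
      then have "real (k - 1 + k * (P - r) - 1) \<le> \<tau>" unfolding \<tau>(2) of_nat_le_iff .
      moreover have "k - 1 + k * (P - Suc r) \<le> k - 1 + k * (P - r) - 1"
        using k_pos unfolding e by simp
      ultimately show ?thesis using pois_mono_below_mode \<tau>(1) by simp
    qed
    finally show ?thesis unfolding rP .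
  qed
  have cW: "card W = 2 * M" unfolding W_def card_image[OF inj] by simp
  \<comment> \<open>\<open>W\<close> has 2 M elements, and 2 M / (40 s^2) = 1 / (160 k s) because s
    = 8 k M.\<close>
  have "h / (160 * real k * real s) = real (2 * M) * (1 / (40 * \<tau>) * h)"
    using s1 k_pos M by (simp add: \<tau>_def s_def power2_eq_square field_simps)
  also have "\<dots> = (\<Sum>l\<in>W. 1 / (40 * \<tau>) * h)"
    by (simp add: cW)
  also have "\<dots> \<le> (\<Sum>l\<in>W. (?q (Suc l) - ?q l) * v (int I - 1 - int l))"
  proof (rule sum_mono)
    fix l assume "l \<in> W"
    then obtain r where r: "2 * M + 1 \<le> r" "r \<le> 4 * M" "l = P - Suc r" by (auto simp: W_def)
    have "int I - 1 - int l = int I - int P + int r" using r PM M by simp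
    then have "0 \<le> int I - 1 - int l" "int I - 1 - int l \<le> 4 * int M" using r I PM M by auto
    then show "1 / (40 * \<tau>) * h \<le> (?q (Suc l) - ?q l) * v (int I - 1 - int l)"
      using big[OF r(1,2)] r(3) h h0 \<tau> order_trans[OF _ big[OF r(1,2)], of 0] by (intro mult_mono) auto
  qed
  also have "\<dots> \<le> (\<Sum>l<I. (?q (Suc l) - ?q l) * v (int I - 1 - int l))"
  proof (rule sum_mono2)
    show "W \<subseteq> {..<I}" using I PM M by (auto simp: W_def)
    fix l assume "l \<in> {..<I} - W"
    then have "l < P" "Suc l < P" using I PM M by auto
    then show "0 \<le> (?q (Suc l) - ?q l) * v (int I - 1 - int l)" using nn v by simp
  qed simp
  also have "\<dots> \<le> pois_conv \<tau> (k - 1) (\<lambda>j. v j - v (j - 1)) (int I)"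
    unfolding conv using v pois_nonneg[of \<tau>] \<tau> by simp
  finally show ?thesis by (simp add: \<tau>_def)
qed

text \<open>Infinitely many scales of the profile are active, so no rate better than \<open>t\<^sup>-\<^sup>1\<^sup>/\<^sup>2\<close> survives;
  applying \<open>A\<close> to the solution removes every term but one.\<close>

lemma rate_optimal:
  assumes p: "1 \<le> p" and r: "r \<in> o[at_top](\<lambda>t. t powr (- 1 / 2))" and c: "A c \<noteq> 0"
  shows "\<exists>(v :: int \<Rightarrow> real) D. lp_le p v D \<and> (\<forall>u. is_solution u \<longrightarrow>
    u 0 = (\<lambda>j. (v j - v (j - 1)) *\<^sub>R A c) \<longrightarrow> \<not> (\<exists>C. \<forall>\<^sub>F t in at_top. lp_le p (u t) (C * \<bar>r t\<bar>)))"
proof -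
  let ?g = "\<lambda>M. if p = \<infinity> then 1 else real M powr (- (1 / enn2real p))"
  \<comment> \<open>The time at which \<zeta> t equals the parameter s^2 belonging to scale
    M.\<close>
  define \<theta> where "\<theta> M = (real (8 * k * M))\<^sup>2 / \<zeta>" for M
  have \<theta>_ge: "real M / \<zeta> \<le> \<theta> M" for M
  proof -
    have "M * 1 \<le> (8 * k * M) * (8 * k * M)"
      using k_pos by (cases "M = 0") (auto intro!: mult_le_mono)
    then have "real M \<le> (real (8 * k * M))\<^sup>2"
      unfolding power2_eq_square of_nat_mult[symmetric] of_nat_le_iff by simp
    then show ?thesis unfolding \<theta>_def using zeta_pos by (intro divide_right_mono) auto
  qed
  have \<theta>_lim: "filterlim \<theta> at_top sequentially"
  proof (rule filterlim_at_top_mono)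
    show "filterlim (\<lambda>M. real M * (1 / \<zeta>)) at_top sequentially"
      by (rule filterlim_at_top_mult_tendsto_pos[OF tendsto_const _ filterlim_real_sequentially]) (use zeta_pos in simp)
  qed (use \<theta>_ge in simp)
  \<comment> \<open>The scales are chosen from r before the profile is built. The gain 4^(-n) is to
    beat the amplitude 2^(-n) that the n-th scale has in the profile.\<close>
  have "\<exists>M\<ge>Suc n. \<bar>r (\<theta> M)\<bar> \<le> (1 / 4) ^ n * \<theta> M powr (- 1 / 2)" for n
  proof -
    have "\<forall>\<^sub>F t in at_top. norm (r t) \<le> (1 / 4) ^ n * norm (t powr (- 1 / 2))"
      by (rule landau_o.smallD[OF r]) simp
    then have "\<forall>\<^sub>F M in sequentially. norm (r (\<theta> M)) \<le> (1 / 4) ^ n * norm (\<theta> M powr (- 1 / 2))"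
      using \<theta>_lim by (rule eventually_compose_filterlim)
    then have "\<forall>\<^sub>F M in sequentially. Suc n \<le> M \<and> norm (r (\<theta> M)) \<le> (1 / 4) ^ n * norm (\<theta> M powr (- 1 / 2))"
      by (intro eventually_conj eventually_ge_at_top)
    then show ?thesis by (auto dest!: eventually_happens)
  qed
  then obtain M where M: "\<And>n. Suc n \<le> M n" and
    rM: "\<And>n. \<bar>r (\<theta> (M n))\<bar> \<le> (1 / 4) ^ n * \<theta> (M n) powr (- 1 / 2)" by metis
  have M1: "1 \<le> M n" for n using M[of n] by simp
  obtain v :: "int \<Rightarrow> real" and D where v: "\<And>j. 0 \<le> v j" "\<And>j. j < 0 \<Longrightarrow> v j = 0" and D: "lp_le p v D"
    and low: "\<And>n j. 0 \<le> j \<Longrightarrow> j \<le> 4 * int (M n) \<Longrightarrow> (1 / 2) ^ n * ?g (M n) \<le> v j"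
    using lp_profile_exists[OF p, of M] M1 by blast
  have "False" if sol: "is_solution u" and u0: "u 0 = (\<lambda>j. (v j - v (j - 1)) *\<^sub>R A c)"
    and C: "\<forall>\<^sub>F t in at_top. lp_le p (u t) (C * \<bar>r t\<bar>)" for u C
  proof -
    let ?f = "\<lambda>j. v j - v (j - 1)"
    have vb: "norm (?f j) \<le> D + D" for j by (rule lp_le_coord[OF p lp_le_diff[OF p D lp_le_shift[OF D]]])
    define K where "K = onorm A / (\<zeta> * norm (A c))"
    have K: "0 \<le> K" unfolding K_def using zeta_pos by (simp add: onorm_pos_le A)
    have Au: "A (u t j) = (\<zeta> * pois_conv (\<zeta> * t) (k - 1) ?f j) *\<^sub>R A c" if "0 \<le> t" for t j
      by (rule A_solution_formula[OF that vb]) (use sol that in \<open>simp add: is_solution_def u0\<close>)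
    \<comment> \<open>At the time of the n-th scale, more than M n coordinates give a norm of at
      least 2^(-n) / (160 k s), while the assumed rate allows a multiple of 4^(-n) / s. The factor 1
      / s cancels, and the inequality fails for large n.\<close>
    have key: "(1 / 2) ^ n \<le> 160 * real k * sqrt \<zeta> * (K * \<bar>C\<bar>) * (1 / 4) ^ n"
      if le: "lp_le p (u (\<theta> (M n))) (C * \<bar>r (\<theta> (M n))\<bar>)" for n
    proof -
      let ?m = "M n" and ?s = "8 * k * M n" and ?P = "64 * k * (M n)\<^sup>2"
      have s0: "0 < real ?s" using M1[of n] k_pos by simp
      have t0: "0 \<le> \<theta> ?m" and \<tau>: "\<zeta> * \<theta> ?m = (real ?s)\<^sup>2" using zeta_pos by (simp_all add: \<theta>_def)
      have f1: "lp_le p (pois_conv ((real ?s)\<^sup>2) (k - 1) ?f) (K * (C * \<bar>r (\<theta> ?m)\<bar>))"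
      proof (rule lp_le_map[OF p le K])
        fix j
        have "norm (A (u (\<theta> ?m) j)) = \<zeta> * norm (pois_conv ((real ?s)\<^sup>2) (k - 1) ?f j) * norm (A c)"
          unfolding Au[OF t0] \<tau> using zeta_pos by (simp add: abs_mult)
        moreover have "norm (A (u (\<theta> ?m) j)) \<le> onorm A * norm (u (\<theta> ?m) j)" by (rule onorm[OF A])
        ultimately show "norm (pois_conv ((real ?s)\<^sup>2) (k - 1) ?f j) \<le> K * norm (u (\<theta> ?m) j)"
          using c zeta_pos by (simp add: K_def field_simps)
      qed
      have f2: "real ?m \<le> real (card (int ` {?P - 2 * ?m..?P - ?m}))"
      proof -
        have "1 * ?m * 1 \<le> k * ?m * ?m" using k_pos M1[of n] by (intro mult_le_mono) auto
        then have "2 * ?m \<le> ?P" by (simp add: power2_eq_square)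
        then show ?thesis by (simp add: card_image)
      qed
      have f3: "(1 / 2) ^ n / (160 * real k * real ?s) * ?g ?m \<le> norm (pois_conv ((real ?s)\<^sup>2) (k - 1) ?f i)"
        if i: "i \<in> int ` {?P - 2 * ?m..?P - ?m}" for i
      proof -
        obtain I where I: "i = int I" "?P - 2 * ?m \<le> I" "I \<le> ?P - ?m" using i by (elim imageE) auto
        have "(1 / 2) ^ n * ?g ?m / (160 * real k * real ?s) \<le> pois_conv ((real ?s)\<^sup>2) (k - 1) ?f (int I)"
          by (rule pois_conv_difference_lower[OF M1 v low _ I(2,3)]) auto
        then show ?thesis by (simp add: I(1))
      qed
      have "(1 / 2) ^ n / (160 * real k * real ?s) \<le> K * (C * \<bar>r (\<theta> ?m)\<bar>)"
        by (rule lp_le_card[OF p f1 _ f2 M1 f3]) auto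
      also have "\<dots> \<le> K * (\<bar>C\<bar> * ((1 / 4) ^ n * \<theta> ?m powr (- 1 / 2)))"
        using K rM[of n] by (intro mult_left_mono mult_mono) auto
      also have "\<theta> ?m powr (- 1 / 2) = sqrt \<zeta> / real ?s"
      proof -
        have "0 < \<theta> ?m" using s0 zeta_pos unfolding \<theta>_def by (intro divide_pos_pos zero_less_power)
        then have "\<theta> ?m powr (- 1 / 2) = 1 / sqrt (\<theta> ?m)"
          using powr_minus_divide[of "\<theta> ?m" "1 / 2"] powr_half_sqrt[of "\<theta> ?m"] by simp
        also have "sqrt (\<theta> ?m) = real ?s / sqrt \<zeta>"
          using s0 by (simp add: \<theta>_def real_sqrt_divide)
        finally show ?thesis by simp
      qed
      finally have X: "(1 / 2) ^ n / (160 * real k * real ?s) \<le>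
          K * (\<bar>C\<bar> * ((1 / 4) ^ n * (sqrt \<zeta> / real ?s)))" .
      have "x \<le> 160 * \<kappa> * z * (K * \<bar>C\<bar>) * y"
        if "x / (160 * \<kappa> * S) \<le> K * (\<bar>C\<bar> * (y * (z / S)))" "0 < \<kappa>" "0 < S" for x y z \<kappa> S
        using that by (simp add: field_simps)
      from this[OF X _ s0] show ?thesis using k_pos by simp
    qed
    have "filterlim (\<lambda>n. \<theta> (M n)) at_top sequentially"
      by (rule filterlim_compose[OF \<theta>_lim])
        (rule filterlim_at_top_mono[OF filterlim_Suc], use M in simp)
    from eventually_compose_filterlim[OF C this]
    have "\<forall>\<^sub>F n in sequentially. lp_le p (u (\<theta> (M n))) (C * \<bar>r (\<theta> (M n))\<bar>)" .
    moreover have "\<forall>\<^sub>F n in sequentially. 160 * real k * sqrt \<zeta> * (K * \<bar>C\<bar>) * (1 / 2) ^ n < 1"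
    proof -
      have "(\<lambda>n. 160 * real k * sqrt \<zeta> * (K * \<bar>C\<bar>) * (1 / 2) ^ n) \<longlonglongrightarrow> 160 * real k * sqrt \<zeta> * (K * \<bar>C\<bar>) * 0"
        by (intro tendsto_mult tendsto_const LIMSEQ_realpow_zero) auto
      then show ?thesis by (intro order_tendstoD(2)) auto
    qed
    ultimately have "\<forall>\<^sub>F n::nat in sequentially. False"
    proof eventually_elim
      case (elim n)
      have "(1 / 4 :: real) ^ n = (1 / 2) ^ n * (1 / 2) ^ n" by (simp add: power_mult_distrib[symmetric])
      then have "(1 / 2) ^ n \<le> (160 * real k * sqrt \<zeta> * (K * \<bar>C\<bar>) * (1 / 2) ^ n) * (1 / 2) ^ n"
        using key[OF elim(1)] by (simp add: mult_ac)
      also have "\<dots> < 1 * (1 / 2) ^ n" using elim(2) by (intro mult_strict_right_mono) auto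
      finally show ?case by simp
    qed
    then show False by simp
  qed
  then show ?thesis using D by blast
qed

end

section \<open>Limits of means, and solutions in the norm of the sequence space\<close>

lemma lp_space_iff: "1 \<le> p \<Longrightarrow> x \<in> lp_space p \<longleftrightarrow> (\<exists>C. lp_le p x C)"
  using lp_le_iff by blast

text \<open>Membership is indispensable for reading the distances: a divergent sum has the value 0,
  so a small \<open>lp_dist\<close> alone would prove nothing.\<close>

lemma lp_dist_tendsto_iff:
  assumes p: "1 \<le> p" and mem: "\<forall>\<^sub>F t in F. (\<lambda>j. f t j - g j) \<in> lp_space p"
  shows "((\<lambda>t. lp_dist p (f t) g) \<longlongrightarrow> 0) F \<longleftrightarrow> (\<forall>\<epsilon>>0. \<forall>\<^sub>F t in F. lp_le p (\<lambda>j. f t j - g j) \<epsilon>)"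
proof
  assume lim: "((\<lambda>t. lp_dist p (f t) g) \<longlongrightarrow> 0) F"
  show "\<forall>\<epsilon>>0. \<forall>\<^sub>F t in F. lp_le p (\<lambda>j. f t j - g j) \<epsilon>"
  proof (intro allI impI)
    fix \<epsilon> :: real assume "0 < \<epsilon>"
    from order_tendstoD(2)[OF lim this] mem show "\<forall>\<^sub>F t in F. lp_le p (\<lambda>j. f t j - g j) \<epsilon>"
      by eventually_elim (simp add: lp_le_iff[OF p] lp_dist_def)
  qed
next
  assume le: "\<forall>\<epsilon>>0. \<forall>\<^sub>F t in F. lp_le p (\<lambda>j. f t j - g j) \<epsilon>"
  show "((\<lambda>t. lp_dist p (f t) g) \<longlongrightarrow> 0) F"
  proof (rule tendstoI)
    fix \<epsilon> :: real assume e: "0 < \<epsilon>"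
    then have "\<forall>\<^sub>F t in F. lp_le p (\<lambda>j. f t j - g j) (\<epsilon> / 2)" using le by simp
    then show "\<forall>\<^sub>F t in F. dist (lp_dist p (f t) g) 0 < \<epsilon>"
    proof eventually_elim
      case (elim t)
      then have "(\<lambda>j. f t j - g j) \<in> lp_space p" "lp_dist p (f t) g \<le> \<epsilon> / 2"
        by (simp_all add: lp_le_iff[OF p] lp_dist_def)
      then show ?case using lp_norm_nonneg[of "\<lambda>j. f t j - g j" p] e by (simp add: lp_dist_def)
    qed
  qed
qed

lemma lp_norm_bigo:
  assumes p: "1 \<le> p" and le: "\<forall>\<^sub>F t in F. lp_le p (f t) (C * g t)"
  shows "(\<lambda>t. lp_norm p (f t)) \<in> O[F](g)"
proof (rule bigoI)
  show "\<forall>\<^sub>F t in F. norm (lp_norm p (f t)) \<le> \<bar>C\<bar> * norm (g t)"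
    using le
  proof eventually_elim
    case (elim t)
    then have "f t \<in> lp_space p" "lp_norm p (f t) \<le> C * g t" by (simp_all add: lp_le_iff[OF p])
    moreover have "C * g t \<le> \<bar>C\<bar> * \<bar>g t\<bar>" using abs_ge_self[of "C * g t"] by (simp add: abs_mult)
    ultimately show ?case using lp_norm_nonneg[of "f t" p] by simp
  qed
qed

lemma lp_le_of_bigo:
  assumes p: "1 \<le> p" and O: "(\<lambda>t. lp_norm p (f t)) \<in> O[F](g)" and mem: "\<forall>\<^sub>F t in F. f t \<in> lp_space p"
  shows "\<exists>C. \<forall>\<^sub>F t in F. lp_le p (f t) (C * \<bar>g t\<bar>)"
proof -
  from O obtain C where "\<forall>\<^sub>F t in F. norm (lp_norm p (f t)) \<le> C * norm (g t)" by (elim landau_o.bigE)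
  then have "\<forall>\<^sub>F t in F. lp_le p (f t) (C * \<bar>g t\<bar>)"
    using mem by eventually_elim (simp add: lp_le_iff[OF p])
  then show ?thesis by blast
qed

section \<open>Means of shifts for each range of p\<close>

lemma mean_add: "mean n (\<lambda>j. x j + y j) j = mean n x j + mean n y j"
  by (simp add: mean_def sum.distrib scaleR_add_right)

lemma mean_finite_sum:
  assumes "finite F"
  shows "mean n (\<lambda>j. if j \<in> F then w j else 0) j = (\<Sum>i\<in>F. mean n (\<lambda>j. if j = i then w i else 0) j)"
proof -
  have "(if j \<in> F then w j else 0) = (\<Sum>i\<in>F. if j = i then w i else 0)" for j
    using assms by (simp add: sum.delta')
  then show ?thesis
    unfolding mean_def scaleR_sum_right[symmetric] by (subst sum.swap) simp
qed

lemma mean_spike: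
  "mean n (\<lambda>j. if j = i then a else 0) j = (if i < j \<and> j \<le> i + int n then (1 / real n) *\<^sub>R a else 0)"
proof -
  have "(\<Sum>l=1..n. if j - int l = i then a else 0) = (\<Sum>l=1..n. if l = nat (j - i) then (if i < j then a else 0) else 0)"
    by (intro sum.cong) auto
  also have "\<dots> = (if i < j \<and> j \<le> i + int n then a else 0)" by auto
  finally show ?thesis by (simp add: mean_def)
qed

text \<open>The mean spreads a over n coordinates of size |a| / n, of norm |a| n^(1/p - 1); this
  decays exactly because p > 1.\<close>

lemma mean_spike_lp_le:
  fixes a :: "'b::real_normed_vector"
  assumes p: "1 < p" "p < \<infinity>" and n: "1 \<le> n"
  shows "lp_le p (mean n (\<lambda>j. if j = i then a else 0)) (norm a * real n powr (1 / enn2real p - 1))"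
proof -
  define q where "q = enn2real p"
  have q: "1 \<le> q" using enn2real_ge_1[of p] p by (simp add: q_def)
  have "(\<Sum>j\<in>F. norm (mean n (\<lambda>j. if j = i then a else 0) j) powr q) \<le>
      (norm a * real n powr (1 / q - 1)) powr q" if F: "finite F" for F
  proof -
    have "(\<Sum>j\<in>F. norm (mean n (\<lambda>j. if j = i then a else 0) j) powr q) =
        (\<Sum>j\<in>F \<inter> {i<..i + int n}. (norm a / real n) powr q)"
      using F by (intro sum.mono_neutral_cong_right) (auto simp: mean_spike)
    also have "\<dots> = real (card (F \<inter> {i<..i + int n})) * (norm a / real n) powr q" by simp
    also have "\<dots> \<le> real n * (norm a / real n) powr q"
    proof (rule mult_right_mono)
      have "card (F \<inter> {i<..i + int n}) \<le> card {i<..i + int n}" by (intro card_mono) auto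
      then show "real (card (F \<inter> {i<..i + int n})) \<le> real n" by simp
    qed simp
    also have "\<dots> = norm a powr q * (real n powr 1 / real n powr q)" using n by (simp add: powr_divide)
    also have "real n powr 1 / real n powr q = real n powr (1 - q)" by (rule powr_diff[symmetric])
    also have "1 - q = (1 / q - 1) * q" using q by (simp add: field_simps)
    finally show ?thesis by (simp add: powr_mult powr_powr)
  qed
  moreover have "p \<noteq> \<infinity>" using p by auto
  ultimately show ?thesis by (simp add: lp_le_def q_def)
qed

lemma lp_le_tail:
  fixes w :: "int \<Rightarrow> 'b::real_normed_vector"
  assumes p: "1 \<le> p" "p < \<infinity>" and w: "lp_le p w D" and \<epsilon>: "0 < \<epsilon>"
  shows "\<exists>F. finite F \<and> lp_le p (\<lambda>j. if j \<in> F then 0 else w j) \<epsilon>"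
proof -
  define q where "q = enn2real p"
  have q: "1 \<le> q" using enn2real_ge_1[of p] p by (simp add: q_def)
  let ?f = "\<lambda>j. norm (w j) powr q"
  have b: "sum ?f F \<le> D powr q" if "finite F" for F using w p that by (auto simp: lp_le_def q_def)
  have s: "?f summable_on UNIV"
    by (rule nonneg_bdd_above_summable_on) (auto intro!: bdd_aboveI b)
  have "(sum ?f \<longlongrightarrow> infsum ?f UNIV) (finite_subsets_at_top UNIV)"
    using has_sum_infsum[OF s] by (simp add: has_sum_def)
  then have "\<forall>\<^sub>F F in finite_subsets_at_top UNIV. infsum ?f UNIV - \<epsilon> powr q < sum ?f F"
    by (rule order_tendstoD(1)) (use \<epsilon> in simp)
  then obtain F where F: "finite F" "infsum ?f UNIV - \<epsilon> powr q < sum ?f F"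
    by (auto simp: eventually_finite_subsets_at_top)
  have "(\<Sum>j\<in>G. norm (if j \<in> F then 0 else w j) powr q) \<le> \<epsilon> powr q" if G: "finite G" for G
  proof -
    have "(\<Sum>j\<in>G. norm (if j \<in> F then 0 else w j) powr q) = sum ?f (G - F)"
      using G q by (intro sum.mono_neutral_cong_right) auto
    also have "\<dots> = sum ?f (G \<union> F) - sum ?f F"
      using G F sum.union_disjoint[of "G - F" F ?f] by (simp add: Un_Diff_cancel2 Int_commute)
    also have "sum ?f (G \<union> F) \<le> infsum ?f UNIV"
      using finite_sum_le_infsum[OF s, of "G \<union> F"] G F by simp
    finally show ?thesis using F(2) by simp
  qed
  moreover have "p \<noteq> \<infinity>" using p by auto
  ultimately have "lp_le p (\<lambda>j. if j \<in> F then 0 else w j) \<epsilon>"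
    using \<epsilon> by (simp add: lp_le_def q_def)
  then show ?thesis using F(1) by blast
qed

text \<open>Mean ergodic theorem by density: means are contractions, so a small tail stays small,
  and the finitely many remaining coordinates are spikes.\<close>

lemma mean_tendsto_zero:
  fixes w :: "int \<Rightarrow> 'b::real_normed_vector"
  assumes p: "1 < p" "p < \<infinity>" and w: "lp_le p w D" and \<epsilon>: "0 < \<epsilon>"
  shows "\<forall>\<^sub>F n in sequentially. lp_le p (mean n w) \<epsilon>"
proof -
  have p1: "1 \<le> p" using p by simp
  have q: "1 < enn2real p" using p by (cases p) auto
  obtain F where F: "finite F" and tail: "lp_le p (\<lambda>j. if j \<in> F then 0 else w j) (\<epsilon> / 2)"
    using lp_le_tail[OF p1 p(2) w, of "\<epsilon> / 2"] \<epsilon> by auto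
  define c where "c = (\<Sum>i\<in>F. norm (w i))"
  have "((\<lambda>n. real n powr (1 / enn2real p - 1)) \<longlongrightarrow> 0) sequentially"
    using q by (intro tendsto_neg_powr filterlim_real_sequentially) simp
  from tendsto_mult_right_zero[OF this, of c]
  have "\<forall>\<^sub>F n in sequentially. c * real n powr (1 / enn2real p - 1) < \<epsilon> / 2"
    using \<epsilon> by (intro order_tendstoD(2)) auto
  moreover have "\<forall>\<^sub>F n::nat in sequentially. 1 \<le> n" by (rule eventually_ge_at_top)
  ultimately show ?thesis
  proof eventually_elim
    case (elim n)
    have split: "w = (\<lambda>j. (if j \<in> F then 0 else w j) + (if j \<in> F then w j else 0))" by auto
    have eq: "mean n w = (\<lambda>j. mean n (\<lambda>j. if j \<in> F then 0 else w j) j +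
        (\<Sum>i\<in>F. mean n (\<lambda>j. if j = i then w i else 0) j))"
      by (subst split, rule ext) (simp only: mean_add mean_finite_sum[OF F])
    have le: "lp_le p (\<lambda>j. mean n (\<lambda>j. if j \<in> F then 0 else w j) j +
        (\<Sum>i\<in>F. mean n (\<lambda>j. if j = i then w i else 0) j))
        (\<epsilon> / 2 + (\<Sum>i\<in>F. norm (w i) * real n powr (1 / enn2real p - 1)))"
      by (intro lp_le_add p1 mean_lp_le tail elim lp_le_sum F mean_spike_lp_le p)
    have "(\<Sum>i\<in>F. norm (w i) * real n powr (1 / enn2real p - 1)) = c * real n powr (1 / enn2real p - 1)"
      by (simp add: c_def sum_distrib_right)
    then have "\<epsilon> / 2 + (\<Sum>i\<in>F. norm (w i) * real n powr (1 / enn2real p - 1)) \<le> \<epsilon>"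
      using elim(1) by linarith
    with le show ?case unfolding eq by (rule lp_le_mono)
  qed
qed

text \<open>For p = 1 the mean keeps the norm of a spike, while 0 is the only constant sequence in
  the space.\<close>

lemma mean_spike_not_convergent:
  fixes a y :: "'b::real_normed_vector"
  assumes a: "a \<noteq> 0" and conv: "\<And>\<epsilon>. 0 < \<epsilon> \<Longrightarrow> \<forall>\<^sub>F n in sequentially.
    lp_le 1 (\<lambda>j. mean n (\<lambda>j. if j = 0 then a else 0) j - y) \<epsilon>"
    and y: "lp_le 1 (\<lambda>j. y) V"
  shows False
proof -
  have y0: "y = 0" using lp_le_constD[OF _ _ y] by simp
  have "\<forall>\<^sub>F n::nat in sequentially. 1 \<le> n \<and> lp_le 1 (\<lambda>j. mean n (\<lambda>j. if j = 0 then a else 0) j - y) (norm a / 2)"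
    using a by (intro eventually_conj eventually_ge_at_top conv) simp
  then obtain n :: nat where n: "1 \<le> n"
    and le: "lp_le 1 (mean n (\<lambda>j. if j = 0 then a else 0)) (norm a / 2)"
    by (auto simp: y0 dest!: eventually_happens)
  have "(\<Sum>j\<in>{0<..int n}. norm (mean n (\<lambda>j. if j = 0 then a else 0) j)) \<le> norm a / 2"
    using le unfolding lp_le_def by (auto dest: spec[of _ "{0<..int n}"])
  moreover have "(\<Sum>j\<in>{0<..int n}. norm (mean n (\<lambda>j. if j = 0 then a else 0) j)) = (\<Sum>j\<in>{0<..int n}. norm a / real n)"
    by (intro sum.cong) (auto simp: mean_spike)
  ultimately show False using n a by simp
qed

text \<open>However large n is, the n-th mean of a step is 0 at position 0 and a at position n, so
  no constant is uniformly close to it.\<close>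

lemma mean_step_not_convergent:
  fixes a y :: "'b::real_normed_vector"
  assumes a: "a \<noteq> 0" and conv: "\<And>\<epsilon>. 0 < \<epsilon> \<Longrightarrow> \<forall>\<^sub>F n in sequentially.
    lp_le \<infinity> (\<lambda>j. mean n (\<lambda>j. if 0 \<le> j then a else 0) j - y) \<epsilon>"
  shows False
proof -
  have "\<forall>\<^sub>F n::nat in sequentially. 1 \<le> n \<and> lp_le \<infinity> (\<lambda>j. mean n (\<lambda>j. if 0 \<le> j then a else 0) j - y) (norm a / 3)"
    using a by (intro eventually_conj eventually_ge_at_top conv) simp
  then obtain n :: nat where n: "1 \<le> n"
    and le: "lp_le \<infinity> (\<lambda>j. mean n (\<lambda>j. if 0 \<le> j then a else 0) j - y) (norm a / 3)"
    by (auto dest!: eventually_happens)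
  have "mean n (\<lambda>j. if 0 \<le> j then a else 0) 0 = 0" by (simp add: mean_def)
  moreover have "mean n (\<lambda>j. if 0 \<le> j then a else 0) (int n) = a"
    using n by (simp add: mean_def sum_constant_scaleR)
  ultimately have "norm y \<le> norm a / 3" "norm (a - y) \<le> norm a / 3"
    using le unfolding lp_le_def by (auto dest: spec[of _ "0::int"] spec[of _ "int n"])
  moreover have "norm a \<le> norm (a - y) + norm y" using norm_triangle_ineq[of "a - y" y] by simp
  moreover have "0 < norm a" using a by simp
  ultimately show False by linarith
qed

section \<open>From derivatives in norm to coordinates\<close>

lemma has_lp_derivative_quotient_mem:
  assumes p: "1 \<le> p" and d: "has_lp_derivative p u v t" and "0 \<le> t" "0 \<le> s"
  shows "(\<lambda>j. (1 / (s - t)) *\<^sub>R (u s j - u t j) - v j) \<in> lp_space p"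
proof -
  obtain C\<^sub>1 C\<^sub>2 C\<^sub>3 where "lp_le p (u s) C\<^sub>1" "lp_le p (u t) C\<^sub>2" "lp_le p v C\<^sub>3"
    using assms lp_le_lp_norm[OF p] unfolding has_lp_derivative_def by metis
  then have "lp_le p (\<lambda>j. (1 / (s - t)) *\<^sub>R (u s j - u t j) - v j) (\<bar>1 / (s - t)\<bar> * (C\<^sub>1 + C\<^sub>2) + C\<^sub>3)"
    by (intro lp_le_diff lp_le_scaleR p)
  then show ?thesis using lp_space_iff[OF p] by blast
qed

lemma has_lp_derivative_component:
  assumes p: "1 \<le> p" and d: "has_lp_derivative p u v t" and t: "0 \<le> t"
  shows "((\<lambda>s. u s j) has_vector_derivative v j) (at t within {0..})"
proof -
  let ?e = "\<lambda>s j. (1 / (s - t)) *\<^sub>R (u s j - u t j) - v j"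
  note mem = has_lp_derivative_quotient_mem[OF p d t]
  have lim: "((\<lambda>s. lp_dist p (\<lambda>j. (1 / (s - t)) *\<^sub>R (u s j - u t j)) v) \<longlongrightarrow> 0) (at t within {0..})"
    using d by (simp add: has_lp_derivative_def)
  have "((\<lambda>s. (1 / norm (s - t)) *\<^sub>R (u s j - (u t j + (s - t) *\<^sub>R v j))) \<longlongrightarrow> 0) (at t within {0..})"
  proof (rule Lim_null_comparison[OF _ lim])
    show "\<forall>\<^sub>F s in at t within {0..}. norm ((1 / norm (s - t)) *\<^sub>R (u s j - (u t j + (s - t) *\<^sub>R v j)))
        \<le> lp_dist p (\<lambda>j. (1 / (s - t)) *\<^sub>R (u s j - u t j)) v"
    proof (rule eventually_at_filter[THEN iffD2], rule always_eventually, intro allI impI)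
      fix s assume s: "s \<noteq> t" "s \<in> {0..}"
      have "u s j - (u t j + (s - t) *\<^sub>R v j) = (s - t) *\<^sub>R ?e s j"
        using s by (simp add: scaleR_diff_right)
      then have "norm ((1 / norm (s - t)) *\<^sub>R (u s j - (u t j + (s - t) *\<^sub>R v j))) = norm (?e s j)"
        using s by (simp only: norm_scaleR) simp
      also have "\<dots> \<le> lp_norm p (?e s)"
        using lp_le_coord[OF p lp_le_lp_norm[OF p mem], of s j] s by simp
      finally show "norm ((1 / norm (s - t)) *\<^sub>R (u s j - (u t j + (s - t) *\<^sub>R v j)))
          \<le> lp_dist p (\<lambda>j. (1 / (s - t)) *\<^sub>R (u s j - u t j)) v" by (simp add: lp_dist_def)
    qed
  qed
  then show ?thesis
    unfolding has_vector_derivative_def has_derivative_within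
    by (simp add: bounded_linear_scaleR_left)
qed

text \<open>Near t the difference quotient is within 1 of the derivative in norm, hence in every
  coordinate; this yields a bound uniform in j.\<close>

lemma has_lp_derivative_locally_bounded:
  assumes p: "1 \<le> p" and d: "has_lp_derivative p u v t" and t: "0 \<le> t"
  shows "\<exists>\<delta>>0. \<exists>C. \<forall>s j. 0 \<le> s \<longrightarrow> \<bar>s - t\<bar> < \<delta> \<longrightarrow> norm (u s j) \<le> C"
proof -
  let ?e = "\<lambda>s j. (1 / (s - t)) *\<^sub>R (u s j - u t j) - v j"
  note mem = has_lp_derivative_quotient_mem[OF p d t]
  obtain Ct where Ct: "lp_le p (u t) Ct"
    using d t lp_space_iff[OF p] by (auto simp: has_lp_derivative_def)
  obtain Cv where Cv: "lp_le p v Cv" using d lp_space_iff[OF p] by (auto simp: has_lp_derivative_def)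
  have "((\<lambda>s. lp_dist p (\<lambda>j. (1 / (s - t)) *\<^sub>R (u s j - u t j)) v) \<longlongrightarrow> 0) (at t within {0..})"
    using d by (simp add: has_lp_derivative_def)
  from order_tendstoD(2)[OF this, of 1] obtain \<delta> where \<delta>: "0 < \<delta>"
    and le: "\<And>s. 0 \<le> s \<Longrightarrow> s \<noteq> t \<Longrightarrow> \<bar>s - t\<bar> < \<delta> \<Longrightarrow> lp_norm p (?e s) < 1"
    by (auto simp: eventually_at dist_real_def lp_dist_def)
  have "norm (u s j) \<le> Ct + \<delta> * (1 + Cv)" if s: "0 \<le> s" "\<bar>s - t\<bar> < \<delta>" for s j
  proof (cases "s = t")
    case True
    have "0 \<le> \<delta> * (1 + Cv)" using \<delta> lp_le_nonneg[OF Cv] by simp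
    then show ?thesis using lp_le_coord[OF p Ct, of j] True by simp
  next
    case False
    have e1: "norm (?e s j) \<le> 1"
      using lp_le_coord[OF p lp_le_lp_norm[OF p mem[OF s(1)]], of j] le[OF s(1) False s(2)] by linarith
    have "u s j = u t j + (s - t) *\<^sub>R (?e s j + v j)" using False by simp
    then have "norm (u s j) \<le> norm (u t j) + \<bar>s - t\<bar> * norm (?e s j + v j)"
      by (metis norm_scaleR norm_triangle_ineq real_norm_def)
    also have "\<dots> \<le> Ct + \<delta> * (1 + Cv)"
      using s lp_le_coord[OF p Ct] lp_le_coord[OF p Cv] e1
      by (intro add_mono mult_mono norm_triangle_le) auto
    finally show ?thesis .
  qed
  then show ?thesis using \<delta> by blast
qed

text \<open>Compactness by bisection; it supplies the uniform bound that the Taylor remainder needs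
  on each time interval.\<close>

lemma bounded_on_segment_if_locally_bounded:
  fixes u :: "real \<Rightarrow> 'i \<Rightarrow> 'b::real_normed_vector"
  assumes loc: "\<And>t. 0 \<le> t \<Longrightarrow> \<exists>\<delta>>0. \<exists>C. \<forall>s j. 0 \<le> s \<longrightarrow> \<bar>s - t\<bar> < \<delta> \<longrightarrow> norm (u s j) \<le> C"
    and T: "0 \<le> T"
  shows "\<exists>C. \<forall>s j. 0 \<le> s \<longrightarrow> s \<le> T \<longrightarrow> norm (u s j) \<le> C"
proof -
  have "\<exists>C. \<forall>s j. 0 \<le> s \<and> 0 \<le> s \<and> s \<le> T \<longrightarrow> norm (u s j) \<le> C"
  proof (rule Bolzano[where P = "\<lambda>a b. \<exists>C. \<forall>s j. 0 \<le> s \<and> a \<le> s \<and> s \<le> b \<longrightarrow> norm (u s j) \<le> C", OF T])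
    fix a b c
    assume "\<exists>C. \<forall>s j. 0 \<le> s \<and> a \<le> s \<and> s \<le> b \<longrightarrow> norm (u s j) \<le> C"
      "\<exists>C. \<forall>s j. 0 \<le> s \<and> b \<le> s \<and> s \<le> c \<longrightarrow> norm (u s j) \<le> C"
    then obtain C D where C: "\<And>s j. 0 \<le> s \<and> a \<le> s \<and> s \<le> b \<longrightarrow> norm (u s j) \<le> C"
      and D: "\<And>s j. 0 \<le> s \<and> b \<le> s \<and> s \<le> c \<longrightarrow> norm (u s j) \<le> D" by metis
    have "norm (u s j) \<le> max C D" if "0 \<le> s" "a \<le> s" "s \<le> c" for s j
      using C[of s j] D[of s j] that by (cases "s \<le> b") auto
    then show "\<exists>C. \<forall>s j. 0 \<le> s \<and> a \<le> s \<and> s \<le> c \<longrightarrow> norm (u s j) \<le> C" by blast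
  next
    fix t :: real assume "0 \<le> t"
    from loc[OF this] obtain \<delta> C where "0 < \<delta>" and C: "\<And>s j. 0 \<le> s \<Longrightarrow> \<bar>s - t\<bar> < \<delta> \<Longrightarrow> norm (u s j) \<le> C"
      by metis
    then have "\<exists>C. \<forall>s j. 0 \<le> s \<and> a \<le> s \<and> s \<le> b \<longrightarrow> norm (u s j) \<le> C"
      if "a \<le> t \<and> t \<le> b \<and> b - a < \<delta>" for a b
      using that by (intro exI[of _ C] allI impI C) auto
    then show "\<exists>\<delta>>0. \<forall>a b. a \<le> t \<and> t \<le> b \<and> b - a < \<delta> \<longrightarrow>
        (\<exists>C. \<forall>s j. 0 \<le> s \<and> a \<le> s \<and> s \<le> b \<longrightarrow> norm (u s j) \<le> C)"
      using \<open>0 < \<delta>\<close> by blast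
  qed
  then show ?thesis by auto
qed

context delay_chain
begin

abbreviation F0 where "F0 \<equiv> \<lambda>v. N v - \<zeta> *\<^sub>R v"

lemma bounded_linear_F0: "bounded_linear F0"
  by (intro bounded_linear_sub N bounded_linear_scaleR_right)

text \<open>Multiplication by exp (\<zeta> t) turns an equation with A_0 into one with N, whose
  powers are understood.\<close>

lemma is_solutionI:
  assumes der: "\<And>t j. 0 \<le> t \<Longrightarrow> ((\<lambda>s. u s j) has_vector_derivative delay_op F0 A (u t) j) (at t within {0..})"
    and bnd: "\<And>T. 0 \<le> T \<Longrightarrow> \<exists>C. \<forall>s j. 0 \<le> s \<longrightarrow> s \<le> T \<longrightarrow> norm (u s j) \<le> C"
  shows "is_solution u"
  unfolding is_solution_def
proof (intro allI impI)
  fix t :: real and j assume t: "0 \<le> t"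
  let ?w = "\<lambda>s j. exp (\<zeta> * s) *\<^sub>R u s j"
  obtain C where C: "\<And>s j. 0 \<le> s \<Longrightarrow> s \<le> t \<Longrightarrow> norm (u s j) \<le> C" using bnd[OF t] by blast
  have "(\<lambda>n. (t ^ n / fact n) *\<^sub>R (B ^^ n) (?w 0) j) sums ?w t j"
  proof (rule delay_op_solution_sums[OF N A _ _ t])
    fix s j assume s: "0 \<le> (s::real)"
    have "((\<lambda>s. exp (\<zeta> * s) *\<^sub>R u s j) has_vector_derivative
        exp (\<zeta> * s) *\<^sub>R delay_op F0 A (u s) j + (\<zeta> * exp (\<zeta> * s)) *\<^sub>R u s j) (at s within {0..})"
      by (rule has_vector_derivative_scaleR[OF _ der[OF s]])
        (auto intro!: derivative_eq_intros)
    moreover have "exp (\<zeta> * s) *\<^sub>R delay_op F0 A (u s) j + (\<zeta> * exp (\<zeta> * s)) *\<^sub>R u s j = B (?w s) j"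
      by (simp add: delay_op_def N.scaleR A.scaleR algebra_simps)
    ultimately show "((\<lambda>s. ?w s j) has_vector_derivative B (?w s) j) (at s within {0..})" by simp
  next
    fix s j assume s: "0 \<le> s" "s \<le> t"
    show "norm (?w s j) \<le> exp (\<zeta> * t) * C"
      using s C[OF s, of j] zeta_pos by (auto intro!: mult_mono)
  qed
  then show "(\<lambda>n. (t ^ n / fact n) *\<^sub>R (B ^^ n) (u 0) j) sums (exp (\<zeta> * t) *\<^sub>R u t j)" by simp
qed

text \<open>The operator does not depend on time, so the derivative solves the same equation, with
  initial value A x_0. This transfers the optimality from (b) to (c).\<close>

lemma is_solution_derivative:
  assumes der: "\<And>t j. 0 \<le> t \<Longrightarrow> ((\<lambda>s. u s j) has_vector_derivative delay_op F0 A (u t) j) (at t within {0..})"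
    and bnd: "\<And>T. 0 \<le> T \<Longrightarrow> \<exists>C. \<forall>s j. 0 \<le> s \<longrightarrow> s \<le> T \<longrightarrow> norm (u s j) \<le> C"
  shows "is_solution (\<lambda>t. delay_op F0 A (u t))"
proof (rule is_solutionI)
  fix t :: real and j assume t: "0 \<le> t"
  show "((\<lambda>s. delay_op F0 A (u s) j) has_vector_derivative delay_op F0 A (delay_op F0 A (u t)) j) (at t within {0..})"
    unfolding delay_op_def[of _ _ "u _"] delay_op_def[of _ _ "\<lambda>j. _ j + _ j"]
    using der[OF t, of j] der[OF t, of "j - 1"]
    by (intro has_vector_derivative_add bounded_linear.has_vector_derivative[OF bounded_linear_F0]
        bounded_linear.has_vector_derivative[OF A]) (simp_all add: delay_op_def)
next
  fix T :: real assume "0 \<le> T"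
  then obtain C where C: "\<And>s j. 0 \<le> s \<Longrightarrow> s \<le> T \<Longrightarrow> norm (u s j) \<le> C" using bnd by blast
  have "norm (delay_op F0 A (u s) j) \<le> onorm F0 * C + onorm A * C" if "0 \<le> s" "s \<le> T" for s j
  proof -
    have "norm (F0 (u s j)) \<le> onorm F0 * C"
      using onorm[OF bounded_linear_F0, of "u s j"] C[OF that, of j] onorm_pos_le[OF bounded_linear_F0]
      by (meson mult_left_mono order_trans)
    moreover have "norm (A (u s (j - 1))) \<le> onorm A * C"
      using onorm[OF A, of "u s (j - 1)"] C[OF that, of "j - 1"] onorm_pos_le[OF A]
      by (meson mult_left_mono order_trans)
    ultimately show ?thesis unfolding delay_op_def by (intro norm_triangle_le add_mono)
  qed
  then show "\<exists>C. \<forall>s j. 0 \<le> s \<longrightarrow> s \<le> T \<longrightarrow> norm (delay_op F0 A (u s) j) \<le> C" by blast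
qed

end

section \<open>Asymptotic behaviour of the solutions\<close>

context delay_chain
begin

lemma inverse_sqrt_scaled: "0 < t \<Longrightarrow> c / sqrt (\<zeta> * t) = (c / sqrt \<zeta>) * t powr (- 1 / 2)"
  using powr_minus_divide[of t "1 / 2"] powr_half_sqrt[of t] by (simp add: real_sqrt_mult)

lemma eventually_scaled: "\<forall>\<^sub>F t in at_top. P t \<Longrightarrow> \<forall>\<^sub>F t in at_top. P (\<zeta> * t)"
  using eventually_compose_filterlim filterlim_tendsto_pos_mult_at_top[OF tendsto_const zeta_pos filterlim_ident]
  by fast

lemma eventually_unscaled: "\<forall>\<^sub>F t in at_top. P (\<zeta> * t) \<Longrightarrow> \<forall>\<^sub>F t in at_top. P t"
  using eventually_compose_filterlim[of "\<lambda>t. P (\<zeta> * t)" at_top "\<lambda>t. (1 / \<zeta>) * t" at_top]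
    filterlim_tendsto_pos_mult_at_top[OF tendsto_const[of "1 / \<zeta>"] _ filterlim_ident] zeta_pos by simp

text \<open>The leading term \<zeta> A_0^(-1) G_0 S M x_0 tends to \<zeta> A_0^(-1) (1/k) y, which
  is L y for y in the range of A_1.\<close>

lemma solution_tendsto:
  assumes p: "1 \<le> p" and sol: "is_solution u" and D: "lp_le p (u 0) D" and V: "lp_le p (\<lambda>j. y) V"
    and mean: "\<And>\<epsilon>. 0 < \<epsilon> \<Longrightarrow> \<exists>n\<ge>1. lp_le p (\<lambda>j. mean n (\<lambda>j. M0 (u 0 j)) j - y) \<epsilon>" and \<epsilon>: "0 < \<epsilon>"
  shows "\<forall>\<^sub>F t in at_top. lp_le p (\<lambda>j. u t j - (\<zeta> / real k) *\<^sub>R R0 y) \<epsilon>"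
proof -
  obtain E where E: "lp_le p (\<lambda>j. u t j - leading (u 0) (\<zeta> * t) j) (E * D / sqrt (\<zeta> * t))"
    if "1 \<le> \<zeta> * t" for t using solution_approx[OF p] sol D by blast
  define w where "w j = M0 (u 0 (j - 1))" for j
  have w: "lp_le p w (onorm M0 * D)"
    unfolding w_def[abs_def] by (intro lp_le_bounded_linear lp_le_shift p D bounded_linear_M0)
  have mw: "\<exists>n\<ge>1. lp_le p (\<lambda>j. mean n w j - y) \<eta>" if "0 < \<eta>" for \<eta>
  proof -
    obtain n where n: "n \<ge> 1" and le: "lp_le p (\<lambda>j. mean n (\<lambda>j. M0 (u 0 j)) j - y) \<eta>"
      using mean[OF \<open>0 < \<eta>\<close>] by blast
    have "mean n w j = mean n (\<lambda>j. M0 (u 0 j)) (j - 1)" for j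
      by (simp add: mean_def w_def algebra_simps)
    then show ?thesis using n lp_le_shift[OF le, of 1] by auto
  qed
  \<comment> \<open>Adding 1 to the operator norm keeps the divisor positive.\<close>
  define \<eta> where "\<eta> = \<epsilon> / (2 * (\<zeta> * (onorm R0 + 1)))"
  have oR: "0 \<le> onorm R0" by (rule onorm_pos_le[OF bounded_linear_R0])
  have \<eta>: "0 < \<eta>" using \<epsilon> zeta_pos oR by (simp add: \<eta>_def)
  have "\<forall>\<^sub>F \<tau> in at_top. 1 \<le> \<tau> \<and> E * D / sqrt \<tau> < \<epsilon> / 2 \<and>
      lp_le p (\<lambda>j. pois_conv \<tau> 0 w j - (1 / real k) *\<^sub>R y) \<eta>"
    using \<epsilon> by (intro eventually_conj eventually_ge_at_top eventually_div_sqrt_less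
        pois_conv_tendsto_of_mean[OF p w V mw \<eta>]) auto
  from eventually_scaled[OF this] show ?thesis
  proof eventually_elim
    case (elim t)
    let ?g = "\<lambda>j. pois_conv (\<zeta> * t) 0 w j"
    have eq: "u t j - (\<zeta> / real k) *\<^sub>R R0 y = (u t j - \<zeta> *\<^sub>R R0 (?g j)) + \<zeta> *\<^sub>R R0 (?g j - (1 / real k) *\<^sub>R y)" for j
      by (simp add: R0.diff R0.scaleR scaleR_diff_right)
    have le: "lp_le p (\<lambda>j. (u t j - \<zeta> *\<^sub>R R0 (?g j)) + \<zeta> *\<^sub>R R0 (?g j - (1 / real k) *\<^sub>R y))
        (E * D / sqrt (\<zeta> * t) + \<bar>\<zeta>\<bar> * (onorm R0 * \<eta>))"
      using E elim unfolding w_def[abs_def]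
      by (intro lp_le_add lp_le_scaleR lp_le_bounded_linear bounded_linear_R0 p) auto
    have "\<bar>\<zeta>\<bar> * (onorm R0 * \<eta>) \<le> \<zeta> * ((onorm R0 + 1) * \<eta>)"
      using zeta_pos \<eta> by simp
    also have "onorm R0 + 1 \<noteq> 0" using oR by linarith
    then have "\<zeta> * ((onorm R0 + 1) * \<eta>) = \<epsilon> / 2" using zeta_pos by (simp add: \<eta>_def)
    finally have "E * D / sqrt (\<zeta> * t) + \<bar>\<zeta>\<bar> * (onorm R0 * \<eta>) \<le> \<epsilon>"
      using conjunct1[OF conjunct2[OF elim]] by linarith
    with le show ?case unfolding eq by (rule lp_le_mono)
  qed
qed

text \<open>Applying A_0 to the leading term recovers the Poisson averages, so these converge along
  with the solution. Their limit is constant by shift invariance, and k times it is the limit of the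
  means.\<close>

lemma solution_tendsto_imp_mean:
  assumes p: "1 \<le> p" and sol: "is_solution u" and D: "lp_le p (u 0) D"
    and lim: "\<And>\<epsilon>. 0 < \<epsilon> \<Longrightarrow> \<forall>\<^sub>F t in at_top. lp_le p (\<lambda>j. u t j - z j) \<epsilon>"
  shows "\<exists>c. \<forall>\<epsilon>>0. \<forall>\<^sub>F n in sequentially. lp_le p (\<lambda>j. mean n (\<lambda>j. M0 (u 0 j)) j - A c) \<epsilon>"
proof -
  obtain E where E: "lp_le p (\<lambda>j. u t j - leading (u 0) (\<zeta> * t) j) (E * D / sqrt (\<zeta> * t))"
    if "1 \<le> \<zeta> * t" for t using solution_approx[OF p] sol D by blast
  interpret F0: bounded_linear F0 by (rule bounded_linear_F0)
  let ?w = "\<lambda>j. M0 (u 0 (j - 1))"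
  have w: "lp_le p (\<lambda>j. M0 (u 0 j)) (onorm M0 * D)"
    by (intro lp_le_bounded_linear p D bounded_linear_M0)
  define g where "g j = (1 / \<zeta>) *\<^sub>R F0 (z j)" for j
  have conv: "\<forall>\<^sub>F \<tau> in at_top. lp_le p (\<lambda>j. pois_conv \<tau> 0 ?w j - g j) \<epsilon>" if \<epsilon>: "0 < \<epsilon>" for \<epsilon>
  proof (rule eventually_unscaled)
    define c where "c = onorm F0 + 1"
    define \<eta> where "\<eta> = \<zeta> * \<epsilon> / (2 * c)"
    have oF: "0 \<le> onorm F0" by (rule onorm_pos_le[OF bounded_linear_F0])
    then have c: "0 < c" by (simp add: c_def)
    have \<eta>: "0 < \<eta>" using \<epsilon> zeta_pos c by (simp add: \<eta>_def)
    have "\<forall>\<^sub>F \<tau> in at_top. 1 \<le> \<tau> \<and> E * D / sqrt \<tau> < \<eta>"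
      using \<eta> by (intro eventually_conj eventually_ge_at_top eventually_div_sqrt_less)
    from eventually_scaled[OF this] lim[OF \<eta>]
    show "\<forall>\<^sub>F t in at_top. lp_le p (\<lambda>j. pois_conv (\<zeta> * t) 0 ?w j - g j) \<epsilon>"
    proof eventually_elim
      case (elim t)
      let ?P = "\<lambda>j. pois_conv (\<zeta> * t) 0 ?w j"
      have eq: "?P j - g j = (1 / \<zeta>) *\<^sub>R F0 ((u t j - z j) - (u t j - \<zeta> *\<^sub>R R0 (?P j)))" for j
      proof -
        have h1: "(u t j - z j) - (u t j - \<zeta> *\<^sub>R R0 (?P j)) = \<zeta> *\<^sub>R R0 (?P j) - z j" by simp
        have h2: "F0 (\<zeta> *\<^sub>R R0 (?P j) - z j) = \<zeta> *\<^sub>R ?P j - F0 (z j)"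
          unfolding F0.diff F0.scaleR R0_inverse ..
        show ?thesis unfolding h1 h2 g_def using zeta_pos by (simp add: scaleR_diff_right)
      qed
      have le: "lp_le p (\<lambda>j. (1 / \<zeta>) *\<^sub>R F0 ((u t j - z j) - (u t j - \<zeta> *\<^sub>R R0 (?P j))))
          (\<bar>1 / \<zeta>\<bar> * (onorm F0 * (\<eta> + E * D / sqrt (\<zeta> * t))))"
        using E elim by (intro lp_le_scaleR lp_le_bounded_linear[OF _ _ bounded_linear_F0] lp_le_diff p) auto
      have "\<bar>1 / \<zeta>\<bar> * (onorm F0 * (\<eta> + E * D / sqrt (\<zeta> * t))) \<le> (1 / \<zeta>) * (c * (\<eta> + \<eta>))"
      proof -
        have "onorm F0 * (\<eta> + E * D / sqrt (\<zeta> * t)) \<le> onorm F0 * (\<eta> + \<eta>)"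
          using elim(1) by (intro mult_left_mono oF) linarith
        also have "\<dots> \<le> c * (\<eta> + \<eta>)" using \<eta> unfolding c_def by (intro mult_right_mono) auto
        finally show ?thesis using zeta_pos by (simp add: divide_right_mono)
      qed
      also have "\<dots> = \<epsilon>" using zeta_pos c by (simp add: \<eta>_def)
      finally show ?case using le unfolding eq by (rule lp_le_mono[rotated])
    qed
  qed
  have gc: "g j = g (j - 1)" and gl: "((\<lambda>\<tau>. pois_conv \<tau> 0 ?w j) \<longlongrightarrow> g j) at_top" for j
    using pois_conv_limit_const[OF p lp_le_shift[OF w] conv] by auto
  have g0: "g j = g 0" for j
    by (induction j rule: int_induct[of _ 0]) (use gc in \<open>metis add_diff_cancel_right' diff_add_cancel\<close>)+
  \<comment> \<open>A subspace of a finite-dimensional space is closed, so the limit of averages in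
    the range of A_1 stays there.\<close>
  have "closed (range A)"
    by (intro closed_subspace linear_subspace_image bounded_linear.linear[OF A] subspace_UNIV)
  moreover have "\<forall>\<^sub>F \<tau> in at_top. pois_conv \<tau> 0 ?w 0 \<in> range A"
    using eventually_ge_at_top[of "0::real"]
  proof eventually_elim
    case (elim \<tau>)
    have "pois_conv \<tau> 0 ?w 0 = M0 (pois_conv \<tau> 0 (\<lambda>j. u 0 (j - 1)) 0)"
      by (rule pois_conv_linear[OF elim lp_le_coord[OF p D] bounded_linear_M0])
    then show ?case by (simp add: M0_def)
  qed
  ultimately have "g 0 \<in> range A" by (rule Lim_in_closed_set[OF _ _ trivial_limit_at_top_linorder gl])
  then obtain b where b: "g 0 = A b" by blast
  have "g = (\<lambda>j. A b)" using g0 b by auto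
  then have conv': "\<forall>\<^sub>F \<tau> in at_top. lp_le p (\<lambda>j. pois_conv \<tau> 0 ?w j - A b) \<epsilon>" if "0 < \<epsilon>" for \<epsilon>
    using conv[OF that] by simp
  have "\<forall>\<epsilon>>0. \<forall>\<^sub>F n in sequentially. lp_le p (\<lambda>j. mean n (\<lambda>j. M0 (u 0 j)) j - A (real k *\<^sub>R b)) \<epsilon>"
    using mean_tendsto_of_pois_conv[OF p w conv'] by (simp add: A.scaleR)
  then show ?thesis by blast
qed

text \<open>The rate O(1/n) of the means enters multiplied by n and for every n, as bounded partial
  sums.\<close>

lemma solution_rate:
  assumes p: "1 \<le> p" and sol: "is_solution u" and D: "lp_le p (u 0) D" and V: "lp_le p (\<lambda>j. y) V"
    and mean: "\<And>n. lp_le p (\<lambda>j. (\<Sum>i=1..n. M0 (u 0 (j - int i))) - real n *\<^sub>R y) C"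
  shows "\<exists>K. \<forall>\<^sub>F t in at_top. lp_le p (\<lambda>j. u t j - (\<zeta> / real k) *\<^sub>R R0 y) (K * t powr (- 1 / 2))"
proof -
  obtain E where E: "lp_le p (\<lambda>j. u t j - leading (u 0) (\<zeta> * t) j) (E * D / sqrt (\<zeta> * t))"
    if "1 \<le> \<zeta> * t" for t using solution_approx[OF p] sol D by blast
  have w: "lp_le p (\<lambda>j. M0 (u 0 j)) (onorm M0 * D)"
    by (intro lp_le_bounded_linear p D bounded_linear_M0)
  define K where "K = E * D + \<bar>\<zeta>\<bar> * (onorm R0 * (real k * (C + V)))"
  have "\<forall>\<^sub>F \<tau>::real in at_top. 1 \<le> \<tau>" by (rule eventually_ge_at_top)
  from eventually_scaled[OF this]
  have "\<forall>\<^sub>F t in at_top. lp_le p (\<lambda>j. u t j - (\<zeta> / real k) *\<^sub>R R0 y) ((K / sqrt \<zeta>) * t powr (- 1 / 2))"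
  proof eventually_elim
    case (elim t)
    let ?g = "\<lambda>j. pois_conv (\<zeta> * t) 0 (\<lambda>j. M0 (u 0 (j - 1))) j"
    have t: "0 < \<zeta> * t" using elim by linarith
    note t = t zero_less_mult_pos[OF t zeta_pos]
    have eq: "u t j - (\<zeta> / real k) *\<^sub>R R0 y = (u t j - \<zeta> *\<^sub>R R0 (?g j)) + \<zeta> *\<^sub>R R0 (?g j - (1 / real k) *\<^sub>R y)" for j
      by (simp add: R0.diff R0.scaleR scaleR_diff_right)
    have le: "lp_le p (\<lambda>j. (u t j - \<zeta> *\<^sub>R R0 (?g j)) + \<zeta> *\<^sub>R R0 (?g j - (1 / real k) *\<^sub>R y))
        (E * D / sqrt (\<zeta> * t) + \<bar>\<zeta>\<bar> * (onorm R0 * (real k * (C + V) / sqrt (\<zeta> * t))))"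
      by (intro lp_le_add lp_le_scaleR lp_le_bounded_linear bounded_linear_R0 p E elim
          pois_conv_rate_of_mean[OF p w V mean t(1)])
    have "E * D / sqrt (\<zeta> * t) + \<bar>\<zeta>\<bar> * (onorm R0 * (real k * (C + V) / sqrt (\<zeta> * t))) = K / sqrt (\<zeta> * t)"
      by (simp add: K_def add_divide_distrib)
    also have "\<dots> = (K / sqrt \<zeta>) * t powr (- 1 / 2)" by (rule inverse_sqrt_scaled[OF t(2)])
    finally show ?case using le unfolding eq by (simp only:)
  qed
  then show ?thesis by blast
qed

lemma solution_derivative_rate:
  assumes p: "1 \<le> p" and sol: "is_solution u" and D: "lp_le p (u 0) D"
  shows "\<exists>K. \<forall>\<^sub>F t in at_top. lp_le p (delay_op F0 A (u t)) (K * t powr (- 1 / 2))"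
proof -
  obtain E where E: "lp_le p (delay_op F0 A (u t)) (E * D / sqrt (\<zeta> * t))" if "1 \<le> \<zeta> * t" for t
    using solution_derivative_lp_le[OF p] sol D by blast
  have "\<forall>\<^sub>F \<tau>::real in at_top. 1 \<le> \<tau>" by (rule eventually_ge_at_top)
  from eventually_scaled[OF this]
  have "\<forall>\<^sub>F t in at_top. lp_le p (delay_op F0 A (u t)) ((E * D / sqrt \<zeta>) * t powr (- 1 / 2))"
  proof eventually_elim
    case (elim t)
    then have "0 < \<zeta> * t" by linarith
    then have "0 < t" using zeta_pos by (rule zero_less_mult_pos)
    then show ?case using E[OF elim] by (simp only: inverse_sqrt_scaled)
  qed
  then show ?thesis by blast
qed

end

section \<open>Passage to matrices and conclusion\<close>

lemma right_shift_funpow: "(right_shift ^^ n) x j = x (j - int n)"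
  by (induction n arbitrary: j) (auto simp: right_shift_def algebra_simps)

lemma shift_mean_eq: "shift_mean n x = mean n x"
  by (rule ext) (simp add: shift_mean_def mean_def right_shift_funpow)

text \<open>\<mu> - N = (\<mu> - \<zeta>) - A_0, so the spectrum {-\<zeta>} of A_0 becomes {0} and
  the resolvent identity is read at \<lambda> = \<mu> - \<zeta>.\<close>

lemma delay_chain_matrices:
  fixes A0 A1 :: "complex^'m^'m"
  assumes A1: "A1 \<noteq> 0" and \<zeta>: "\<zeta> > 0" and sp: "matrix_spectrum A0 = {- complex_of_real \<zeta>}"
    and id: "\<And>l. l \<noteq> - complex_of_real \<zeta> \<Longrightarrow> A1 ** matrix_resolvent l A0 ** A1
      = mat (complex_of_real \<zeta> ^ k / (l + complex_of_real \<zeta>) ^ k) ** A1"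
  defines "N \<equiv> A0 + mat (complex_of_real \<zeta>)"
  shows "delay_chain ((*v) N) ((*v) A1) \<zeta> k (DIM(complex^'m))"
proof -
  have shift: "mat \<mu> - N = mat (\<mu> - complex_of_real \<zeta>) - A0" for \<mu>
    by (simp add: N_def vec_eq_iff mat_def)
  have inv: "invertible (mat \<mu> - N)" if "\<mu> \<noteq> 0" for \<mu>
  proof -
    have "\<mu> - complex_of_real \<zeta> \<notin> matrix_spectrum A0" using that sp by simp
    then show ?thesis by (simp add: matrix_spectrum_def shift)
  qed
  have nil: "((*v) N ^^ DIM(complex^'m)) v = 0" for v
  proof (rule nilpotent_if_no_nonzero_eigenvalue)
    fix \<mu> :: complex and v assume "\<mu> \<noteq> 0" "N *v v = \<mu> *s v"
    then show "v = 0"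
      using matrix_inv_vec[OF inv, of \<mu> v 0] matrix_inv_vec[OF inv, of \<mu> 0 0]
        matrix_inv_mult(2)[OF inv, of \<mu>]
      by (metis diff_self mat_mult_vec matrix_inv_vec[OF inv] matrix_vector_mult_0_right matrix_vector_mult_diff_rdistrib)
  qed
  have id': "A1 ** matrix_inv (mat \<mu> - N) ** A1 = mat (complex_of_real \<zeta> ^ k / \<mu> ^ k) ** A1" if "\<mu> \<noteq> 0" for \<mu>
    using id[of "\<mu> - complex_of_real \<zeta>"] that by (simp add: matrix_resolvent_def shift)
  have coeffs: "A1 *v (((*v) N ^^ i) (A1 *v v)) = (if Suc i = k then complex_of_real \<zeta> ^ k *s (A1 *v v) else 0)" for i v
    by (rule resolvent_identity_coefficients(1)[OF nil inv id'])
  show ?thesis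
  proof (rule delay_chain.intro)
    show "((*v) N ^^ DIM(complex^'m)) v = 0" for v by (rule nil)
    show "A1 *v ((*v) N ^^ i) (A1 *v v) = (if Suc i = k then \<zeta> ^ k *\<^sub>R (A1 *v v) else 0)" for i v
      using coeffs[of i v] by (simp only: of_real_power[symmetric] of_real_vec_scale)
    show "0 < k"
    proof (rule ccontr)
      assume "\<not> 0 < k"
      then have "A1 = 0" by (intro resolvent_identity_coefficients(2)[OF nil inv id']) auto
      then show False using A1 by simp
    qed
    show "\<exists>v. A1 *v v \<noteq> 0" using A1 by (auto simp: matrix_eq)
  qed (use \<zeta> in auto)
qed

text \<open>\<open>x\<close> and \<open>x'\<close> are arbitrary functions satisfying the Cauchy
  problem; that the initial value determines them comes from the Taylor series.\<close>

theorem theorem4p1: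
  fixes p :: ennreal
    and A0 A1 :: "complex^'m^'m"
    and \<zeta> :: real and k :: nat
    and x x' :: "(int \<Rightarrow> complex^'m) \<Rightarrow> real \<Rightarrow> int \<Rightarrow> complex^'m"
    and X Y :: "(int \<Rightarrow> complex^'m) set"
  assumes "1 \<le> p"
    and "A1 \<noteq> 0"
    and "\<zeta> > 0"
    and "matrix_spectrum A0 = {- complex_of_real \<zeta>}"
    and "\<And>l. l \<noteq> - complex_of_real \<zeta> \<Longrightarrow>
           A1 ** matrix_resolvent l A0 ** A1
             = mat (complex_of_real \<zeta> ^ k / (l + complex_of_real \<zeta>) ^ k) ** A1"
    and X_def: "X = lp_space p"
    and sol: "\<And>x0. x0 \<in> X \<Longrightarrow> solves_system p A0 A1 x0 (x x0) (x' x0)"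
    and Y_def: "Y = {x0 \<in> X. \<exists>w\<in>X. ((\<lambda>t. lp_dist p (x x0 t) w) \<longlongrightarrow> 0) at_top}"
  shows
    "(\<forall>x0\<in>X. x0 \<in> Y \<longleftrightarrow> (\<exists>y0. mean_converges p A0 A1 x0 y0)) \<and>
     (\<forall>x0\<in>X. \<forall>y0. mean_converges p A0 A1 x0 y0 \<longrightarrow>
        const_seq (L_map A0 A1 y0) \<in> X \<and>
        ((\<lambda>t. lp_dist p (x x0 t) (const_seq (L_map A0 A1 y0))) \<longlongrightarrow> 0) at_top) \<and>
     (Y = X \<longleftrightarrow> 1 < p \<and> p < \<infinity>) \<and>
     (p < \<infinity> \<longrightarrow>
        (\<forall>y0\<in>matrix_range A1. const_seq y0 \<in> X \<longrightarrow>
           const_seq y0 = (\<lambda>j. 0) \<and> const_seq (L_map A0 A1 y0) = (\<lambda>j. 0))) \<and>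
     (\<forall>x0\<in>X. \<forall>y0. mean_converges_fast p A0 A1 x0 y0 \<longrightarrow>
        (\<lambda>t. lp_dist p (x x0 t) (const_seq (L_map A0 A1 y0))) \<in> O[at_top](\<lambda>t. t powr (- 1 / 2))) \<and>
     (\<forall>x0\<in>X. (\<lambda>t. lp_norm p (x' x0 t)) \<in> O[at_top](\<lambda>t. t powr (- 1 / 2))) \<and>
     (\<forall>r :: real \<Rightarrow> real. (\<forall>t>0. r t > 0) \<and> r \<in> o[at_top](\<lambda>t. t powr (- 1 / 2)) \<longrightarrow>
       \<not> (\<forall>x0\<in>X. \<forall>y0. mean_converges_fast p A0 A1 x0 y0 \<longrightarrow>
            (\<lambda>t. lp_dist p (x x0 t) (const_seq (L_map A0 A1 y0))) \<in> O[at_top](r)) \<and>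
       \<not> (\<forall>x0\<in>X. (\<lambda>t. lp_norm p (x' x0 t)) \<in> O[at_top](r)))"
proof -
  define N where "N = A0 + mat (complex_of_real \<zeta>)"
  obtain d where "delay_chain ((*v) N) ((*v) A1) \<zeta> k d"
    unfolding N_def using delay_chain_matrices[OF assms(2-5)] by blast
  then interpret D: delay_chain "(*v) N" "(*v) A1" \<zeta> k d .
  note p = assms(1)
  let ?G = "delay_op (\<lambda>v. N *v v - \<zeta> *\<^sub>R v) ((*v) A1)"
  have F0: "N *v v - \<zeta> *\<^sub>R v = A0 *v v" for v
    by (simp add: N_def matrix_vector_mult_add_rdistrib mat_mult_vec of_real_vec_scale)
  have sys: "sys_op A0 A1 y = ?G y" for y
    by (simp add: sys_op_def delay_op_def F0)
  have invA0: "invertible A0"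
  proof -
    have "0 \<notin> matrix_spectrum A0" using assms(3,4) by simp
    then have "invertible (mat 0 - A0)" by (simp only: matrix_spectrum_def mem_Collect_eq not_not)
    then obtain C where C: "(mat 0 - A0) ** C = mat 1" by (auto simp: invertible_def)
    have "A0 ** (0 - C) = mat 1"
    proof (rule matrix_eq[THEN iffD2], rule allI)
      fix v
      have "(mat 0 - A0) *v (C *v v) = v" using C by (simp add: matrix_vector_mul_assoc)
      then show "(A0 ** (0 - C)) *v v = mat 1 *v v"
        by (simp add: matrix_vector_mul_assoc[symmetric] matrix_vector_mult_diff_rdistrib
            matrix_vector_mult_diff_distrib mat_mult_vec del: diff_0)
    qed
    then show ?thesis using invertible_right_inverse by blast
  qed
  have inv: "matrix_inv A0 *v v = D.R0 v" for v
    by (rule matrix_inv_vec[OF invA0]) (use D.R0_inverse[of v] in \<open>simp only: F0\<close>)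
  have M: "M_op A0 A1 x0 = (\<lambda>j. D.M0 (x0 j))" for x0
    by (simp add: M_op_def D.M0_def matrix_vector_mul_assoc[symmetric] inv)
  \<comment> \<open>By \<open>D.M0_R0_A\<close>, A_1 A_0^(-1) maps A_0^(-1) A_1 b to (k / \<zeta>)
    A_1 b. This gives injectivity on the domain of the isomorphism and the explicit inverse.\<close>
  have L: "L_map A0 A1 y = (\<zeta> / real k) *\<^sub>R D.R0 y" if y: "y \<in> matrix_range A1" for y
  proof -
    obtain b where b: "y = A1 *v b" using y by (auto simp: matrix_range_def)
    let ?f = "\<lambda>v. (A1 ** matrix_inv A0) *v v"
    have f: "?f v = D.M0 v" for v by (simp add: D.M0_def matrix_vector_mul_assoc[symmetric] inv)
    have S: "matrix_range (matrix_inv A0 ** A1) = range (\<lambda>b. D.R0 (A1 *v b))"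
      by (simp add: matrix_range_def matrix_vector_mul_assoc[symmetric] inv)
    have "inj_on ?f (range (\<lambda>b. D.R0 (A1 *v b)))"
      using D.k_pos assms(3) by (auto simp: inj_on_def f D.M0_R0_A)
    moreover have "(\<zeta> / real k) *\<^sub>R D.R0 y = D.R0 (A1 *v ((\<zeta> / real k) *\<^sub>R b))"
      by (simp add: b D.A.scaleR D.R0.scaleR)
    then have "(\<zeta> / real k) *\<^sub>R D.R0 y \<in> range (\<lambda>b. D.R0 (A1 *v b))" by blast
    moreover have "?f ((\<zeta> / real k) *\<^sub>R D.R0 y) = y"
      using D.k_pos assms(3) by (simp only: f D.M0.scaleR) (simp add: b D.M0_R0_A)
    ultimately show ?thesis unfolding L_map_def S by (metis (no_types, lifting) inv_into_f_f)
  qed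
  have X: "x0 \<in> X \<longleftrightarrow> (\<exists>C. lp_le p x0 C)" for x0 unfolding X_def by (rule lp_space_iff[OF p])
  have mc: "mean_converges p A0 A1 x0 y0 \<longleftrightarrow> y0 \<in> matrix_range A1 \<and> const_seq y0 \<in> X \<and>
      (\<forall>\<epsilon>>0. \<forall>\<^sub>F n in sequentially. lp_le p (\<lambda>j. mean n (\<lambda>j. D.M0 (x0 j)) j - y0) \<epsilon>)"
    if x0: "x0 \<in> X" for x0 y0
  proof -
    obtain C where C: "lp_le p x0 C" using x0 X by blast
    have "\<forall>\<^sub>F n in sequentially. (\<lambda>j. shift_mean n (M_op A0 A1 x0) j - const_seq y0 j) \<in> lp_space p"
      if y0: "const_seq y0 \<in> X"
      using eventually_ge_at_top[of "1::nat"]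
    proof eventually_elim
      case (elim n)
      obtain V where V: "lp_le p (const_seq y0) V" using y0 X by blast
      have "lp_le p (\<lambda>j. mean n (\<lambda>j. D.M0 (x0 j)) j - const_seq y0 j) (onorm D.M0 * C + V)"
        by (intro lp_le_diff p V mean_lp_le elim lp_le_bounded_linear C D.bounded_linear_M0)
      then show ?case unfolding shift_mean_eq M lp_space_iff[OF p] by blast
    qed
    from lp_dist_tendsto_iff[OF p this] show ?thesis
      unfolding mean_converges_def X_def[symmetric] shift_mean_eq M by (auto simp: const_seq_def)
  qed
  have const_X: "(\<exists>V. lp_le p (\<lambda>j. y) V) \<longleftrightarrow> const_seq y \<in> X" for y :: "complex^'m"
    by (simp add: X const_seq_def)
  have solx: "x x0 0 = x0" and solx': "\<And>t. 0 \<le> t \<Longrightarrow> x' x0 t = ?G (x x0 t)"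
    and xX: "\<And>t. 0 \<le> t \<Longrightarrow> x x0 t \<in> X" and x'X: "\<And>t. 0 \<le> t \<Longrightarrow> x' x0 t \<in> X"
    and is_sol: "D.is_solution (x x0)" "D.is_solution (\<lambda>t. ?G (x x0 t))"
    if x0: "x0 \<in> X" for x0
  proof -
    have s: "x x0 0 = x0" "\<And>t. 0 \<le> t \<Longrightarrow> has_lp_derivative p (x x0) (x' x0 t) t"
      "\<And>t. 0 \<le> t \<Longrightarrow> x' x0 t = ?G (x x0 t)"
      using sol[OF x0] by (auto simp: solves_system_def sys)
    then show "x x0 0 = x0" "\<And>t. 0 \<le> t \<Longrightarrow> x' x0 t = ?G (x x0 t)" by auto
    show "x x0 t \<in> X" "x' x0 t \<in> X" if "0 \<le> t" for t
      using s(2)[OF that] that by (auto simp: has_lp_derivative_def X_def)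
    have der: "((\<lambda>s. x x0 s j) has_vector_derivative ?G (x x0 t) j) (at t within {0..})"
      if "0 \<le> t" for t j
      using has_lp_derivative_component[OF p s(2)[OF that] that] s(3)[OF that] by simp
    have bnd: "\<exists>C. \<forall>s j. 0 \<le> s \<longrightarrow> s \<le> T \<longrightarrow> norm (x x0 s j) \<le> C" if "0 \<le> T" for T
      by (rule bounded_on_segment_if_locally_bounded[OF has_lp_derivative_locally_bounded[OF p s(2)] that])
    show "D.is_solution (x x0)" by (rule D.is_solutionI[OF der bnd])
    show "D.is_solution (\<lambda>t. ?G (x x0 t))"
      by (rule D.is_solution_derivative[OF der bnd])
  qed
  have dist_iff: "((\<lambda>t. lp_dist p (x x0 t) w) \<longlongrightarrow> 0) at_top \<longleftrightarrow>
      (\<forall>\<epsilon>>0. \<forall>\<^sub>F t in at_top. lp_le p (\<lambda>j. x x0 t j - w j) \<epsilon>)" if x0: "x0 \<in> X" and w: "w \<in> X" for x0 w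
  proof (rule lp_dist_tendsto_iff[OF p])
    show "\<forall>\<^sub>F t in at_top. (\<lambda>j. x x0 t j - w j) \<in> lp_space p"
      using eventually_ge_at_top[of "0::real"]
    proof eventually_elim
      case (elim t)
      obtain C D where "lp_le p (x x0 t) C" "lp_le p w D" using xX[OF x0 elim] w X by blast
      from lp_le_diff[OF p this] show ?case unfolding lp_space_iff[OF p] by blast
    qed
  qed
  have conv: "const_seq (L_map A0 A1 y0) \<in> X \<and>
      ((\<lambda>t. lp_dist p (x x0 t) (const_seq (L_map A0 A1 y0))) \<longlongrightarrow> 0) at_top"
    if x0: "x0 \<in> X" and m: "mean_converges p A0 A1 x0 y0" for x0 y0
  proof -
    from m have y0: "y0 \<in> matrix_range A1" and yX: "const_seq y0 \<in> X"
      and mean: "\<And>\<epsilon>. 0 < \<epsilon> \<Longrightarrow> \<forall>\<^sub>F n in sequentially. lp_le p (\<lambda>j. mean n (\<lambda>j. D.M0 (x0 j)) j - y0) \<epsilon>"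
      unfolding mc[OF x0] by auto
    obtain V where V: "lp_le p (\<lambda>j. y0) V" using yX const_X by blast
    obtain C where C: "lp_le p (x x0 0) C" using x0 X solx by force
    have mean': "\<exists>n\<ge>1. lp_le p (\<lambda>j. mean n (\<lambda>j. D.M0 (x x0 0 j)) j - y0) \<epsilon>" if "0 < \<epsilon>" for \<epsilon>
      using eventually_happens[OF eventually_conj[OF eventually_ge_at_top[of 1] mean[OF that]]] solx[OF x0] by auto
    have "lp_le p (\<lambda>j. (\<zeta> / real k) *\<^sub>R D.R0 y0) (\<bar>\<zeta> / real k\<bar> * (onorm D.R0 * V))"
      by (intro lp_le_scaleR lp_le_bounded_linear p V D.bounded_linear_R0)
    then have LX: "const_seq (L_map A0 A1 y0) \<in> X" unfolding L[OF y0] const_X[symmetric] by blast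
    have "\<forall>\<epsilon>>0. \<forall>\<^sub>F t in at_top. lp_le p (\<lambda>j. x x0 t j - const_seq (L_map A0 A1 y0) j) \<epsilon>"
      unfolding L[OF y0] const_seq_def
      using D.solution_tendsto[OF p is_sol(1)[OF x0] C V mean'] by blast
    then show ?thesis using LX dist_iff[OF x0 LX] by blast
  qed
  have Y_iff: "x0 \<in> Y \<longleftrightarrow> (\<exists>y0. mean_converges p A0 A1 x0 y0)" if x0: "x0 \<in> X" for x0
  proof
    assume "x0 \<in> Y"
    then obtain w where w: "w \<in> X" "((\<lambda>t. lp_dist p (x x0 t) w) \<longlongrightarrow> 0) at_top" by (auto simp: Y_def)
    then have lim: "\<And>\<epsilon>. 0 < \<epsilon> \<Longrightarrow> \<forall>\<^sub>F t in at_top. lp_le p (\<lambda>j. x x0 t j - w j) \<epsilon>"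
      using dist_iff[OF x0 w(1)] by blast
    obtain C where C: "lp_le p x0 C" using x0 X by blast
    then have "lp_le p (x x0 0) C" by (simp add: solx[OF x0])
    from D.solution_tendsto_imp_mean[OF p is_sol(1)[OF x0] this lim] obtain c where
      c: "\<And>\<epsilon>. 0 < \<epsilon> \<Longrightarrow> \<forall>\<^sub>F n in sequentially. lp_le p (\<lambda>j. mean n (\<lambda>j. D.M0 (x0 j)) j - A1 *v c) \<epsilon>"
      unfolding solx[OF x0] by blast
    from eventually_happens[OF eventually_conj[OF eventually_ge_at_top[of 1] c[of 1]]]
    obtain n where n: "1 \<le> n" "lp_le p (\<lambda>j. mean n (\<lambda>j. D.M0 (x0 j)) j - A1 *v c) 1" by auto
    have "lp_le p (mean n (\<lambda>j. D.M0 (x0 j))) (onorm D.M0 * C)"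
      by (intro mean_lp_le p n lp_le_bounded_linear C D.bounded_linear_M0)
    from lp_le_diff[OF p this n(2)] have "const_seq (A1 *v c) \<in> X" unfolding const_X[symmetric] by auto
    then have "mean_converges p A0 A1 x0 (A1 *v c)"
      unfolding mc[OF x0] using c by (auto simp: matrix_range_def)
    then show "\<exists>y0. mean_converges p A0 A1 x0 y0" by blast
  next
    assume "\<exists>y0. mean_converges p A0 A1 x0 y0"
    then show "x0 \<in> Y" using conv[OF x0] x0 unfolding Y_def by blast
  qed
  obtain c where c: "A1 *v c \<noteq> 0" using D.A_nonzero by blast
  have zero_X: "const_seq 0 \<in> X" using lp_le_zero[OF p, of 0] unfolding const_X[symmetric] by blast
  have zero_range: "0 \<in> matrix_range A1" unfolding matrix_range_def by (rule image_eqI[of _ _ 0]) simp_all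
  have L0: "L_map A0 A1 0 = 0" using L[OF zero_range] by (simp add: D.R0.zero)
  have const_zero: "y0 = 0" if "p < \<infinity>" "const_seq y0 \<in> X" for y0 :: "complex^'m"
    using that lp_le_constD[OF p that(1)] const_X by blast
  have Y_eq_X: "Y = X \<longleftrightarrow> 1 < p \<and> p < \<infinity>"
  proof
    assume YX: "Y = X"
    have "p \<noteq> 1"
    proof
      assume p1: "p = 1"
      \<comment> \<open>The values lie in the range of A_1, where M acts as -1, so the means are
        those of a spike.\<close>
      let ?x0 = "\<lambda>j::int. if j = 0 then A1 *v c else 0"
      have "(\<Sum>j\<in>F. norm (?x0 j)) \<le> norm (A1 *v c)" if "finite F" for F
      proof -
        have "(\<Sum>j\<in>F. norm (?x0 j)) = (\<Sum>j\<in>F. if j = 0 then norm (A1 *v c) else 0)" by (intro sum.cong) auto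
        then show ?thesis using that by simp
      qed
      then have "lp_le p ?x0 (norm (A1 *v c))" by (simp add: lp_le_def p1)
      then have x0: "?x0 \<in> X" using X by blast
      then obtain y0 where y0: "mean_converges p A0 A1 ?x0 y0" using Y_iff YX by blast
      have e: "(\<lambda>j. D.M0 (?x0 j)) = (\<lambda>j. if j = 0 then - (A1 *v c) else 0)"
        by (auto simp: D.M0_A D.M0.zero)
      from y0[unfolded mc[OF x0] e] have m: "\<And>\<epsilon>. 0 < \<epsilon> \<Longrightarrow> \<forall>\<^sub>F n in sequentially.
          lp_le 1 (\<lambda>j. mean n (\<lambda>j. if j = 0 then - (A1 *v c) else 0) j - y0) \<epsilon>" and "const_seq y0 \<in> X"
        unfolding p1 by auto
      then obtain V where "lp_le 1 (\<lambda>j. y0) V" using const_X p1 by blast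
      then show False using mean_spike_not_convergent[OF _ m] c by simp
    qed
    moreover have "p \<noteq> \<infinity>"
    proof
      assume pi: "p = \<infinity>"
      \<comment> \<open>As for p = 1, with a step in place of the spike.\<close>
      let ?x0 = "\<lambda>j::int. if 0 \<le> j then A1 *v c else 0"
      have "lp_le p ?x0 (norm (A1 *v c))" by (simp add: lp_le_def pi)
      then have x0: "?x0 \<in> X" using X by blast
      then obtain y0 where y0: "mean_converges p A0 A1 ?x0 y0" using Y_iff YX by blast
      have e: "(\<lambda>j. D.M0 (?x0 j)) = (\<lambda>j. if 0 \<le> j then - (A1 *v c) else 0)"
        by (auto simp: D.M0_A D.M0.zero)
      from y0[unfolded mc[OF x0] e] have m: "\<And>\<epsilon>. 0 < \<epsilon> \<Longrightarrow> \<forall>\<^sub>F n in sequentially.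
          lp_le \<infinity> (\<lambda>j. mean n (\<lambda>j. if 0 \<le> j then - (A1 *v c) else 0) j - y0) \<epsilon>"
        unfolding pi by auto
      then show False using mean_step_not_convergent[OF _ m] c by simp
    qed
    ultimately show "1 < p \<and> p < \<infinity>" using p by (auto simp: less_top[symmetric])
  next
    assume pp: "1 < p \<and> p < \<infinity>"
    have "x0 \<in> Y" if x0: "x0 \<in> X" for x0
    proof -
      obtain C where C: "lp_le p x0 C" using x0 X by blast
      have "mean_converges p A0 A1 x0 0"
        unfolding mc[OF x0] using zero_range zero_X pp
          mean_tendsto_zero[OF _ _ lp_le_bounded_linear[OF p C D.bounded_linear_M0]] by auto
      then show ?thesis using Y_iff[OF x0] by blast
    qed
    then show "Y = X" by (auto simp: Y_def)
  qed
  have fast: "(\<lambda>t. lp_dist p (x x0 t) (const_seq (L_map A0 A1 y0))) \<in> O[at_top](\<lambda>t. t powr (- 1 / 2))"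
    if x0: "x0 \<in> X" and m: "mean_converges_fast p A0 A1 x0 y0" for x0 y0
  proof -
    have "mean_converges p A0 A1 x0 y0"
      and O: "(\<lambda>n. lp_dist p (mean n (\<lambda>j. D.M0 (x0 j))) (const_seq y0)) \<in> O(\<lambda>n. 1 / real n)"
      using m by (simp_all only: mean_converges_fast_def shift_mean_eq M)
    then have y0: "y0 \<in> matrix_range A1" and yX: "const_seq y0 \<in> X" unfolding mc[OF x0] by auto
    obtain V where V: "lp_le p (\<lambda>j. y0) V" using yX const_X by blast
    obtain C where C: "lp_le p x0 C" using x0 X by blast
    define W where "W j = D.M0 (x0 j)" for j
    have W: "lp_le p W (onorm D.M0 * C)"
      unfolding W_def[abs_def] by (intro lp_le_bounded_linear p C D.bounded_linear_M0)
    define D' where "D' = onorm D.M0 * C + V"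
    have D': "0 \<le> D'" using lp_le_nonneg[OF W] lp_le_nonneg[OF V] by (simp add: D'_def)
    \<comment> \<open>A bound growing with n, for the finitely many n below the threshold hidden in
      the O(1/n).\<close>
    have any: "lp_le p (\<lambda>j. (\<Sum>i=1..n. W (j - int i)) - real n *\<^sub>R y0) (real n * D')" for n
    proof -
      have "lp_le p (\<lambda>j. (\<Sum>i=1..n. W (j - int i)) - real n *\<^sub>R y0) ((\<Sum>i=1..n. onorm D.M0 * C) + \<bar>real n\<bar> * V)"
        by (rule lp_le_diff[OF p lp_le_sum[OF p _ lp_le_shift[OF W]] lp_le_scaleR[OF p V]]) simp
      then show ?thesis by (simp add: D'_def distrib_left)
    qed
    from O obtain K where "\<forall>\<^sub>F n in sequentially. norm (lp_dist p (mean n W) (const_seq y0)) \<le> K * norm (1 / real n)"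
      unfolding W_def[abs_def] by (elim landau_o.bigE)
    then obtain n0 where n0: "\<And>n. n0 \<le> n \<Longrightarrow> norm (lp_dist p (mean n W) (const_seq y0)) \<le> K * norm (1 / real n)"
      by (auto simp: eventually_sequentially)
    have "lp_le p (\<lambda>j. (\<Sum>i=1..n. W (j - int i)) - real n *\<^sub>R y0) (\<bar>K\<bar> + real n0 * D')" for n
    proof (cases "n0 \<le> n \<and> 1 \<le> n")
      case True
      have eq: "(\<Sum>i=1..n. W (j - int i)) - real n *\<^sub>R y0 = real n *\<^sub>R (mean n W j - const_seq y0 j)" for j
        using True by (simp add: mean_def const_seq_def scaleR_diff_right)
      have "lp_le p (\<lambda>j. mean n W j - const_seq y0 j) (onorm D.M0 * C + V)"
        unfolding const_seq_def using True by (intro lp_le_diff p mean_lp_le W V) simp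
      then have "(\<lambda>j. mean n W j - const_seq y0 j) \<in> lp_space p" using lp_space_iff[OF p] by blast
      moreover have "lp_norm p (\<lambda>j. mean n W j - const_seq y0 j) \<le> \<bar>K\<bar> / real n"
      proof -
        have "K * norm (1 / real n) \<le> \<bar>K\<bar> / real n" using True by (simp add: divide_right_mono)
        then show ?thesis using n0[of n] True by (simp add: lp_dist_def)
      qed
      ultimately have "lp_le p (\<lambda>j. mean n W j - const_seq y0 j) (\<bar>K\<bar> / real n)" by (simp add: lp_le_iff[OF p])
      from lp_le_scaleR[OF p this, of "real n"] True
      have "lp_le p (\<lambda>j. (\<Sum>i=1..n. W (j - int i)) - real n *\<^sub>R y0) \<bar>K\<bar>" unfolding eq by simp
      then show ?thesis by (rule lp_le_mono) (use D' in simp)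
    next
      case False
      then have "real n \<le> real n0" by auto
      then have "real n * D' \<le> \<bar>K\<bar> + real n0 * D'" using mult_right_mono[OF _ D'] by (smt (verit))
      with any show ?thesis by (rule lp_le_mono)
    qed
    then have mean: "lp_le p (\<lambda>j. (\<Sum>i=1..n. D.M0 (x x0 0 (j - int i))) - real n *\<^sub>R y0) (\<bar>K\<bar> + real n0 * D')" for n
      by (simp add: W_def solx[OF x0])
    have "lp_le p (x x0 0) C" using C by (simp add: solx[OF x0])
    from D.solution_rate[OF p is_sol(1)[OF x0] this V mean] obtain K' where
      "\<forall>\<^sub>F t in at_top. lp_le p (\<lambda>j. x x0 t j - (\<zeta> / real k) *\<^sub>R D.R0 y0) (K' * t powr (- 1 / 2))" by blast
    from lp_norm_bigo[OF p this] show ?thesis unfolding L[OF y0] lp_dist_def const_seq_def .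
  qed
  have deriv: "(\<lambda>t. lp_norm p (x' x0 t)) \<in> O[at_top](\<lambda>t. t powr (- 1 / 2))" if x0: "x0 \<in> X" for x0
  proof -
    obtain C where "lp_le p (x x0 0) C" using x0 X solx by force
    from D.solution_derivative_rate[OF p is_sol(1)[OF x0] this] obtain K where
      K: "\<forall>\<^sub>F t in at_top. lp_le p (?G (x x0 t)) (K * t powr (- 1 / 2))" by blast
    have "\<forall>\<^sub>F t in at_top. lp_le p (x' x0 t) (K * t powr (- 1 / 2))"
      using K eventually_ge_at_top[of "0::real"] by eventually_elim (simp add: solx'[OF x0])
    then show ?thesis by (rule lp_norm_bigo[OF p])
  qed
  have optimal: "\<not> (\<forall>x0\<in>X. \<forall>y0. mean_converges_fast p A0 A1 x0 y0 \<longrightarrow>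
        (\<lambda>t. lp_dist p (x x0 t) (const_seq (L_map A0 A1 y0))) \<in> O[at_top](r)) \<and>
       \<not> (\<forall>x0\<in>X. (\<lambda>t. lp_norm p (x' x0 t)) \<in> O[at_top](r))"
    if r: "r \<in> o[at_top](\<lambda>t. t powr (- 1 / 2))" for r :: "real \<Rightarrow> real"
  proof -
    obtain v :: "int \<Rightarrow> real" and E where v: "lp_le p v E"
      and opt: "\<And>u. D.is_solution u \<Longrightarrow> u 0 = (\<lambda>j. (v j - v (j - 1)) *\<^sub>R (A1 *v c)) \<Longrightarrow>
        \<not> (\<exists>C. \<forall>\<^sub>F t in at_top. lp_le p (u t) (C * \<bar>r t\<bar>))"
      using D.rate_optimal[OF p r c] by blast
    have vec: "lp_le p (\<lambda>j. f j *\<^sub>R b) (norm b * C)" if "lp_le p f C" for f :: "int \<Rightarrow> real" and b :: "complex^'m" and C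
      by (rule lp_le_map[OF p that]) (simp_all add: mult.commute)
    \<comment> \<open>M acts as -1 on this difference, so its partial sums telescope: the means tend
      to 0 at the rate 1/n, and z = 0.\<close>
    let ?x0 = "\<lambda>j. (v j - v (j - 1)) *\<^sub>R (A1 *v c)"
    have x0: "?x0 \<in> X" using vec[OF lp_le_diff[OF p v lp_le_shift[OF v, of 1]]] X by blast
    have M0_x0: "D.M0 (?x0 i) = (v (i - 1) - v i) *\<^sub>R (A1 *v c)" for i
      unfolding D.M0.scaleR D.M0_A by (simp add: scaleR_diff_left)
    have sum: "(\<Sum>i=1..n. D.M0 (?x0 (j - int i))) = (v (j - 1 - int n) - v (j - 1)) *\<^sub>R (A1 *v c)" for n j
    proof (induction n)
      case (Suc n)
      then show ?case unfolding M0_x0 by (simp add: algebra_simps)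
    qed simp
    have mean: "lp_le p (mean n (\<lambda>j. D.M0 (?x0 j))) (norm (A1 *v c) * (E + E) * (1 / real n))" for n
    proof -
      have "lp_le p (\<lambda>j. v (j - 1 - int n) - v (j - 1)) (E + E)"
        using lp_le_diff[OF p lp_le_shift[OF v, of "1 + int n"] lp_le_shift[OF v, of 1]] by (simp add: algebra_simps)
      from lp_le_scaleR[OF p vec[OF this], of "1 / real n" "A1 *v c"]
      show ?thesis unfolding mean_def[abs_def] sum by (simp add: mult_ac)
    qed
    have "mean_converges_fast p A0 A1 ?x0 0"
    proof -
      have "\<forall>\<^sub>F n in sequentially. lp_le p (\<lambda>j. mean n (\<lambda>j. D.M0 (?x0 j)) j - 0) \<epsilon>" if "0 < \<epsilon>" for \<epsilon>
        using eventually_div_nat_less[OF that, of "norm (A1 *v c) * (E + E)"]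
      proof eventually_elim
        case (elim n)
        then show ?case using mean[of n] by (auto intro: lp_le_mono)
      qed
      then have "mean_converges p A0 A1 ?x0 0" unfolding mc[OF x0] using zero_range zero_X by blast
      moreover have "(\<lambda>n. lp_norm p (mean n (\<lambda>j. D.M0 (?x0 j)))) \<in> O(\<lambda>n. 1 / real n)"
        by (rule lp_norm_bigo[OF p always_eventually]) (use mean in blast)
      ultimately show ?thesis
        by (simp add: mean_converges_fast_def shift_mean_eq M lp_dist_def const_seq_def)
    qed
    moreover have "(\<lambda>t. lp_dist p (x ?x0 t) (const_seq (L_map A0 A1 0))) \<notin> O[at_top](r)"
    proof
      assume "(\<lambda>t. lp_dist p (x ?x0 t) (const_seq (L_map A0 A1 0))) \<in> O[at_top](r)"
      then have "(\<lambda>t. lp_norm p (x ?x0 t)) \<in> O[at_top](r)" by (simp add: L0 lp_dist_def const_seq_def)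
      moreover have "\<forall>\<^sub>F t in at_top. x ?x0 t \<in> lp_space p"
        using eventually_ge_at_top[of "0::real"] by eventually_elim (use xX[OF x0] X_def in auto)
      ultimately show False using lp_le_of_bigo[OF p] opt[OF is_sol(1)[OF x0] solx[OF x0]] by blast
    qed
    ultimately have 1: "\<not> (\<forall>x0\<in>X. \<forall>y0. mean_converges_fast p A0 A1 x0 y0 \<longrightarrow>
        (\<lambda>t. lp_dist p (x x0 t) (const_seq (L_map A0 A1 y0))) \<in> O[at_top](r))" using x0 by blast
    \<comment> \<open>Chosen so that A maps it to \<open>?x0\<close>: A_0 cancels A_0^(-1), and A_1
      A_0^(-1) A_1 = -A_1 supplies the shifted term. The derivative of this solution is thus the
      critical solution of (b).\<close>
    let ?x1 = "\<lambda>j. v j *\<^sub>R D.R0 (A1 *v c)"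
    have x1: "?x1 \<in> X" using vec[OF v] X by blast
    have init: "?G (x ?x1 0) = ?x0"
    proof
      fix j
      have "N *v ?x1 j - \<zeta> *\<^sub>R ?x1 j = v j *\<^sub>R (N *v D.R0 (A1 *v c) - \<zeta> *\<^sub>R D.R0 (A1 *v c))"
        by (simp add: D.N.scaleR scaleR_diff_right mult.commute)
      then have "N *v ?x1 j - \<zeta> *\<^sub>R ?x1 j = v j *\<^sub>R (A1 *v c)" by (simp only: D.R0_inverse)
      moreover have "A1 *v ?x1 (j - 1) = - (v (j - 1) *\<^sub>R (A1 *v c))"
        using D.M0_A[of c] by (simp add: D.A.scaleR D.M0_def)
      ultimately show "?G (x ?x1 0) j = ?x0 j"
        unfolding solx[OF x1] delay_op_def by (simp add: scaleR_diff_left)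
    qed
    have "(\<lambda>t. lp_norm p (x' ?x1 t)) \<notin> O[at_top](r)"
    proof
      assume O: "(\<lambda>t. lp_norm p (x' ?x1 t)) \<in> O[at_top](r)"
      have "\<forall>\<^sub>F t in at_top. x' ?x1 t \<in> lp_space p"
        using eventually_ge_at_top[of "0::real"] by eventually_elim (use x'X[OF x1] X_def in auto)
      from lp_le_of_bigo[OF p O this] obtain C where C: "\<forall>\<^sub>F t in at_top. lp_le p (x' ?x1 t) (C * \<bar>r t\<bar>)" by blast
      have "\<forall>\<^sub>F t in at_top. lp_le p (?G (x ?x1 t)) (C * \<bar>r t\<bar>)"
        using C eventually_ge_at_top[of "0::real"] by eventually_elim (simp add: solx'[OF x1])
      then show False using opt[OF is_sol(2)[OF x1] init] by blast
    qed
    then show ?thesis using 1 x1 by blast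
  qed
  have zero: "const_seq y0 = (\<lambda>j. 0) \<and> const_seq (L_map A0 A1 y0) = (\<lambda>j. 0)"
    if "p < \<infinity>" "const_seq y0 \<in> X" for y0
    using const_zero[OF that] L0 by (simp add: const_seq_def)
  show ?thesis
  proof (intro conjI)
    show "\<forall>x0\<in>X. x0 \<in> Y \<longleftrightarrow> (\<exists>y0. mean_converges p A0 A1 x0 y0)"
      by (intro ballI Y_iff)
    show "\<forall>x0\<in>X. \<forall>y0. mean_converges p A0 A1 x0 y0 \<longrightarrow> const_seq (L_map A0 A1 y0) \<in> X \<and>
        ((\<lambda>t. lp_dist p (x x0 t) (const_seq (L_map A0 A1 y0))) \<longlongrightarrow> 0) at_top"
      by (intro ballI allI impI conv)
    show "Y = X \<longleftrightarrow> 1 < p \<and> p < \<infinity>" by (rule Y_eq_X)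
    show "p < \<infinity> \<longrightarrow> (\<forall>y0\<in>matrix_range A1. const_seq y0 \<in> X \<longrightarrow>
        const_seq y0 = (\<lambda>j. 0) \<and> const_seq (L_map A0 A1 y0) = (\<lambda>j. 0))"
      by (intro ballI impI zero)
    show "\<forall>x0\<in>X. \<forall>y0. mean_converges_fast p A0 A1 x0 y0 \<longrightarrow>
        (\<lambda>t. lp_dist p (x x0 t) (const_seq (L_map A0 A1 y0))) \<in> O[at_top](\<lambda>t. t powr (- 1 / 2))"
      by (intro ballI allI impI fast)
    show "\<forall>x0\<in>X. (\<lambda>t. lp_norm p (x' x0 t)) \<in> O[at_top](\<lambda>t. t powr (- 1 / 2))"
      by (intro ballI deriv)
    show "\<forall>r :: real \<Rightarrow> real. (\<forall>t>0. r t > 0) \<and> r \<in> o[at_top](\<lambda>t. t powr (- 1 / 2)) \<longrightarrow>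
       \<not> (\<forall>x0\<in>X. \<forall>y0. mean_converges_fast p A0 A1 x0 y0 \<longrightarrow>
            (\<lambda>t. lp_dist p (x x0 t) (const_seq (L_map A0 A1 y0))) \<in> O[at_top](r)) \<and>
       \<not> (\<forall>x0\<in>X. (\<lambda>t. lp_norm p (x' x0 t)) \<in> O[at_top](r))"
      by (intro allI impI optimal) (erule conjunct2)
  qed
qed

end
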